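(* There exist positive constants $S_1, S_2$ with $S_1 < S_2$ such that for every $S$ with $S_1 < S < S_2$ there exists a convex surface $\Gamma^{S}$ in hyperbolic 3-space $\mathbb{H}^3$ with surface area $S(\Gamma^S)=S$ and total mean curvature satisfying $$M(\Gamma^S) < \min\{ M_1(S), M_2(S)\} = \min\left\{\sqrt{16\pi S + 4 S^2},\ \sqrt{2\pi^3 S + \tfrac{\pi^2}{4} S^2}\right\}.$$
   Context: $\mathbb{H}^3$ is hyperbolic 3-space of constant sectional curvature $-1$. A convex body is a bounded closed (geodesically) convex set in $\mathbb{H}^3$; a convex surface is the boundary $\Gamma=\partial\Omega$ of a convex body $\Omega$ (no regularity is assumed). $S(\Gamma)$ denotes the surface area of $\Gamma$; if $\Omega$ is degenerate (has empty interior, i.e. lies in a totally geodesic plane), the area is counted with both faces, so $S(\Gamma)$ is twice the two-dimensional area of $\Omega$. Total mean curvature: if $\Gamma$ is $C^{1,1}$ (hence twice differentiable almost everywhere), $M(\Gamma)=\int_\Gamma H\,d\mu$, where $H=\mathrm{trace}(\mathrm{II}_\Gamma)$ is the sum of the principal curvatures with respect to the orientation making them nonnegative. For a general convex surface $\Gamma=\partial\Omega$, $M(\Gamma)=\lim_{\epsilon\to0^+}M(\Gamma_\epsilon)$, where $\Gamma_\epsilon=\partial\{x\in\mathbb{H}^3:\mathrm{dist}(x,\Omega)\le\epsilon\}$ is the outer parallel surface at distance $\epsilon$, which is $C^{1,1}$ and convex. $M_1(S)=\sqrt{16\pi S+4S^2}$ is the total mean curvature of the geodesic sphere in $\mathbb{H}^3$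 with surface area $S$. $M_2(S)=\sqrt{2\pi^3 S+\frac{\pi^2}{4}S^2}$ is the total mean curvature of the flat double disk with surface area $S$, where a flat double disk is a geodesic disk in a totally geodesic plane (isometric to $\mathbb{H}^2$) of $\mathbb{H}^3$, regarded as a degenerate convex body with both faces counted in the surface area. *)

theory Defs
  imports "HOL-Analysis.Analysis"
begin

section \<open>Hyperbolic 3-space\<close>

text \<open>
  The hyperboloid model: the upper sheet of the unit hyperboloid in Minkowski space
  \<open>\<real>\<^sup>3 \<times> \<real>\<close> (the last component is the time coordinate). The Minkowski form restricts to a
  Riemannian metric of constant curvature \<open>-1\<close> on it, whose distance function is
  \<open>arcosh (- mink p q)\<close>.
\<close>

type_synonym mspace = "(real^3) \<times> real"

definition mink :: "mspace \<Rightarrow> mspace \<Rightarrow> real" where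
  "mink u v = fst u \<bullet> fst v - snd u * snd v"

lemma mink_simps:
  "mink u v = mink v u"
  "mink (u + w) v = mink u v + mink w v" "mink v (u + w) = mink v u + mink v w"
  "mink (u - w) v = mink u v - mink w v" "mink v (u - w) = mink v u - mink v w"
  "mink (r *\<^sub>R u) v = r * mink u v" "mink v (r *\<^sub>R u) = r * mink v u"
  by (auto simp: mink_def inner_commute algebra_simps inner_simps)

typedef hyp3 = "{x :: mspace. mink x x = - 1 \<and> snd x > 0}"
  by (rule exI[of _ "(0, 1)"]) (simp add: mink_def)

lemma Rep_hyp3_mink [simp]: "mink (Rep_hyp3 p) (Rep_hyp3 p) = - 1"
  and Rep_hyp3_pos: "snd (Rep_hyp3 p) > 0"
  using Rep_hyp3[of p] by auto

lemma mink_orthogonal_pos: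
  assumes "mink w (Rep_hyp3 p) = 0"
  shows "mink w w \<ge> 0" and "mink w w = 0 \<Longrightarrow> w = 0"
proof -
  define y where "y = Rep_hyp3 p"
  have y: "fst y \<bullet> fst y = (snd y)\<^sup>2 - 1" "snd y > 0"
    using Rep_hyp3_mink[of p] Rep_hyp3_pos[of p] unfolding y_def mink_def
    by (auto simp: power2_eq_square)
  have "fst w \<bullet> fst y = snd w * snd y"
    using assms unfolding y_def mink_def by simp
  then have "(snd w)\<^sup>2 * (snd y)\<^sup>2 \<le> (fst w \<bullet> fst w) * ((snd y)\<^sup>2 - 1)"
    using Cauchy_Schwarz_ineq[of "fst w" "fst y"] y(1) by (simp add: power_mult_distrib)
  then have *: "fst w \<bullet> fst w \<le> (snd y)\<^sup>2 * mink w w"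
    unfolding mink_def by (simp add: algebra_simps power2_eq_square)
  then have "0 \<le> (snd y)\<^sup>2 * mink w w"
    using inner_ge_zero order_trans by blast
  then show "mink w w \<ge> 0"
    using y(2) by (simp add: zero_le_mult_iff)
  assume 0: "mink w w = 0"
  then have f: "fst w = 0"
    using * inner_ge_zero[of "fst w"] by (metis inner_eq_zero_iff mult_zero_right order_antisym)
  then have "snd w = 0"
    using 0 by (simp add: mink_def)
  with f show "w = 0"
    by (simp add: prod_eq_iff)
qed

lemma mink_Cauchy_Schwarz:
  assumes u: "mink u (Rep_hyp3 p) = 0" and v: "mink v (Rep_hyp3 p) = 0"
  shows "(mink u v)\<^sup>2 \<le> mink u u * mink v v"
proof (cases "mink v v = 0")
  case True
  then have "v = 0"
    using mink_orthogonal_pos(2)[OF v] by simp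
  then show ?thesis
    by (simp add: mink_def)
next
  case False
  then have pos: "mink v v > 0"
    using mink_orthogonal_pos(1)[OF v] by simp
  define t where "t = mink u v / mink v v"
  have t: "t * mink v v = mink u v"
    using False by (simp add: t_def)
  have "mink (u - t *\<^sub>R v) (Rep_hyp3 p) = 0"
    using u v by (simp add: mink_simps)
  then have "0 \<le> mink (u - t *\<^sub>R v) (u - t *\<^sub>R v)"
    by (rule mink_orthogonal_pos)
  also have "\<dots> = mink u u - 2 * t * mink u v + t * (t * mink v v)"
    by (simp add: mink_simps(2-7) mink_simps(1)[of v u] algebra_simps)
  also have "\<dots> = mink u u - t * mink u v"
    unfolding t by simp
  finally have "0 \<le> (mink u u - t * mink u v) * mink v v"
    using pos by simp
  also have "\<dots> = mink u u * mink v v - (t * mink v v) * mink u v"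
    by (simp add: algebra_simps)
  finally show ?thesis
    unfolding t by (simp add: power2_eq_square)
qed

lemma minus_mink_ge_1: "- mink (Rep_hyp3 p) (Rep_hyp3 q) \<ge> 1"
proof -
  let ?p = "Rep_hyp3 p" and ?q = "Rep_hyp3 q"
  define a where "a = - mink ?p ?q"
  have "mink (?p - a *\<^sub>R ?q) ?q = 0"
    by (simp add: mink_simps(2-7) a_def)
  then have "0 \<le> mink (?p - a *\<^sub>R ?q) (?p - a *\<^sub>R ?q)"
    by (rule mink_orthogonal_pos)
  also have "\<dots> = a\<^sup>2 - 1"
    by (simp add: mink_simps(2-7) mink_simps(1)[of ?q ?p] a_def algebra_simps power2_eq_square)
  finally have a2: "a\<^sup>2 \<ge> 1" by simp
  have n: "norm (fst (Rep_hyp3 r)) \<le> snd (Rep_hyp3 r)" for r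
  proof (rule power2_le_imp_le)
    show "(norm (fst (Rep_hyp3 r)))\<^sup>2 \<le> (snd (Rep_hyp3 r))\<^sup>2"
      using Rep_hyp3_mink[of r] unfolding mink_def power2_norm_eq_inner power2_eq_square[of "snd _"]
      by linarith
  qed (use Rep_hyp3_pos[of r] in simp)
  have "fst ?p \<bullet> fst ?q \<le> norm (fst ?p) * norm (fst ?q)"
    by (rule norm_cauchy_schwarz)
  also have "\<dots> \<le> snd ?p * snd ?q"
    by (intro mult_mono n) (use Rep_hyp3_pos[of p] in auto)
  finally have "a \<ge> 0"
    by (simp add: a_def mink_def)
  with a2 have "1 \<le> a"
    by (smt (verit) power2_le_imp_le one_power2)
  then show ?thesis
    by (simp add: a_def)
qed

instantiation hyp3 :: metric_space
begin

definition dist_hyp3_def: "dist p q = arcosh (- mink (Rep_hyp3 p) (Rep_hyp3 q))"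

definition uniformity_hyp3_def:
  "(uniformity :: (hyp3 \<times> hyp3) filter) = (INF e\<in>{0 <..}. principal {(x, y). dist x y < e})"

definition open_hyp3_def:
  "open (U :: hyp3 set) \<longleftrightarrow> (\<forall>x\<in>U. eventually (\<lambda>(x', y). x' = x \<longrightarrow> y \<in> U) uniformity)"

instance
proof
  fix p q r :: hyp3
  let ?p = "Rep_hyp3 p" and ?q = "Rep_hyp3 q" and ?r = "Rep_hyp3 r"
  show "dist p q = 0 \<longleftrightarrow> p = q"
  proof
    assume "dist p q = 0"
    then have 1: "mink ?p ?q = - 1"
      using minus_mink_ge_1[of p q] by (simp add: dist_hyp3_def)
    then have "mink (?p - ?q) ?q = 0" "mink (?p - ?q) (?p - ?q) = 0"
      by (simp_all add: mink_simps(2-7) mink_simps(1)[of ?q ?p])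
    then have "?p - ?q = 0"
      by (rule mink_orthogonal_pos)
    then show "p = q"
      by (simp add: Rep_hyp3_inject)
  qed (simp add: dist_hyp3_def)
  define a b c where "a = - mink ?p ?r" and "b = - mink ?q ?r" and "c = - mink ?p ?q"
  have ge: "a \<ge> 1" "b \<ge> 1" "c \<ge> 1"
    using minus_mink_ge_1 by (auto simp: a_def b_def c_def)
  define u v where "u = ?p - a *\<^sub>R ?r" and "v = ?q - b *\<^sub>R ?r"
  have "mink u ?r = 0" "mink v ?r = 0"
    by (simp_all add: u_def v_def a_def b_def mink_simps(2-7))
  from mink_Cauchy_Schwarz[OF this]
  have "(a * b - c)\<^sup>2 \<le> (a\<^sup>2 - 1) * (b\<^sup>2 - 1)"
    by (simp add: u_def v_def a_def b_def c_def mink_simps(2-7) mink_simps(1)[of ?r ?p]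
        mink_simps(1)[of ?r ?q] power2_eq_square algebra_simps)
  then have "\<bar>a * b - c\<bar> \<le> sqrt ((a\<^sup>2 - 1) * (b\<^sup>2 - 1))"
    by (metis real_sqrt_abs real_sqrt_le_mono)
  then have "c \<le> a * b + sqrt (a\<^sup>2 - 1) * sqrt (b\<^sup>2 - 1)"
    by (simp add: real_sqrt_mult)
  also have "\<dots> = cosh (arcosh a + arcosh b)"
    using ge by (simp add: cosh_add sinh_arcosh_real)
  finally have "cosh (arcosh c) \<le> cosh (arcosh a + arcosh b)"
    using ge by simp
  then have "arcosh c \<le> arcosh a + arcosh b"
    using ge by (subst (asm) cosh_real_nonneg_le_iff) auto
  then show "dist p q \<le> dist p r + dist q r"
    by (simp add: dist_hyp3_def a_def b_def c_def)
qed (simp_all add: uniformity_hyp3_def open_hyp3_def)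

end

section \<open>Convex bodies\<close>

text \<open>Hyperbolic space is uniquely geodesic, so the geodesic segment from \<open>p\<close> to \<open>q\<close> is the
  set of points between them.\<close>

definition geodesic_segment :: "hyp3 \<Rightarrow> hyp3 \<Rightarrow> hyp3 set" where
  "geodesic_segment p q = {x. dist p x + dist x q = dist p q}"

definition geodesically_convex :: "hyp3 set \<Rightarrow> bool" where
  "geodesically_convex C \<longleftrightarrow> (\<forall>p\<in>C. \<forall>q\<in>C. geodesic_segment p q \<subseteq> C)"

definition convex_body :: "hyp3 set \<Rightarrow> bool" where
  "convex_body \<Omega> \<longleftrightarrow> \<Omega> \<noteq> {} \<and> bounded \<Omega> \<and> closed \<Omega> \<and> geodesically_convex \<Omega>"

definition parallel_body :: "hyp3 set \<Rightarrow> real \<Rightarrow> hyp3 set" where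
  "parallel_body \<Omega> \<epsilon> = {x. infdist x \<Omega> \<le> \<epsilon>}"

section \<open>Surface area\<close>

text \<open>
  Area is two-dimensional Hausdorff measure for the hyperbolic distance. The outer measure
  \<open>hausdorff2\<close> carries no constant; \<open>area_measure\<close> is normalised so that the unit square of
  the Euclidean plane has area 1. With this normalisation it agrees with Lebesgue measure on
  the plane and with Riemannian area on smooth surfaces.
\<close>

definition hausdorff2_pre :: "real \<Rightarrow> 'a::metric_space set \<Rightarrow> ennreal" where
  "hausdorff2_pre \<delta> A =
     (INF C \<in> {C :: nat \<Rightarrow> 'a set. A \<subseteq> (\<Union>i. C i) \<and> (\<forall>i. bounded (C i) \<and> diameter (C i) \<le> \<delta>)}.
        \<Sum>i. ennreal ((diameter (C i))\<^sup>2))"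

definition hausdorff2 :: "'a::metric_space set \<Rightarrow> ennreal" where
  "hausdorff2 A = (SUP \<delta>\<in>{0<..}. hausdorff2_pre \<delta> A)"

definition area_measure :: "'a::metric_space measure" where
  "area_measure =
     measure_of UNIV (sets borel) (\<lambda>A. hausdorff2 A / hausdorff2 (cbox 0 1 :: (real^2) set))"

text \<open>The boundary of a degenerate body is the body itself; both of its faces are counted.\<close>

definition surface_area :: "hyp3 set \<Rightarrow> ennreal" where
  "surface_area \<Omega> =
     (if interior \<Omega> = {} then 2 * emeasure area_measure (frontier \<Omega>)
      else emeasure area_measure (frontier \<Omega>))"

section \<open>Total mean curvature\<close>

text \<open>\<open>n\<close> is normal at \<open>p\<close> to a totally geodesic plane (a section of the hyperboloid by a
  hyperplane through the origin) that supports \<open>\<Omega>\<close> at \<open>p\<close>, and points away from \<open>\<Omega>\<close>. If the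
  boundary is \<open>C\<^sup>1\<close>, this plane is tangent to it, and \<open>n\<close> is unique.\<close>

definition outward_unit_normal :: "hyp3 set \<Rightarrow> hyp3 \<Rightarrow> mspace \<Rightarrow> bool" where
  "outward_unit_normal \<Omega> p n \<longleftrightarrow>
     mink n n = 1 \<and> mink n (Rep_hyp3 p) = 0 \<and> (\<forall>x\<in>\<Omega>. mink n (Rep_hyp3 x) \<le> 0)"

text \<open>
  The trace of the second fundamental form at \<open>p\<close>. In the hyperboloid model the covariant
  derivative of the unit normal field \<open>\<nu>\<close> in a direction tangent to the surface is its ordinary
  derivative in Minkowski space, so the shape operator is the restriction of \<open>A\<close> to the
  tangent plane of the surface, the Minkowski orthogonal complement of \<open>p\<close> and \<open>\<nu>(p)\<close>.
  The outward normal makes the principal curvatures of a convex surface nonnegative.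
\<close>

definition has_mean_curvature :: "hyp3 set \<Rightarrow> hyp3 \<Rightarrow> real \<Rightarrow> bool" where
  "has_mean_curvature \<Omega> p h \<longleftrightarrow>
     (\<exists>\<nu> A. (\<forall>q\<in>frontier \<Omega>. outward_unit_normal \<Omega> q (\<nu> (Rep_hyp3 q))) \<and>
        (\<nu> has_derivative A) (at (Rep_hyp3 p) within Rep_hyp3 ` frontier \<Omega>) \<and>
        (\<forall>e\<^sub>1 e\<^sub>2. mink e\<^sub>1 e\<^sub>1 = 1 \<and> mink e\<^sub>2 e\<^sub>2 = 1 \<and> mink e\<^sub>1 e\<^sub>2 = 0 \<and>
            (\<forall>e\<in>{e\<^sub>1, e\<^sub>2}. mink e (Rep_hyp3 p) = 0 \<and> mink e (\<nu> (Rep_hyp3 p)) = 0) \<longrightarrow>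
            h = mink (A e\<^sub>1) e\<^sub>1 + mink (A e\<^sub>2) e\<^sub>2))"

definition has_mean_curvature_integral :: "hyp3 set \<Rightarrow> real \<Rightarrow> bool" where
  "has_mean_curvature_integral \<Omega> m \<longleftrightarrow>
     (\<exists>H. (AE p in restrict_space area_measure (frontier \<Omega>). has_mean_curvature \<Omega> p (H p)) \<and>
        has_bochner_integral (restrict_space area_measure (frontier \<Omega>)) H m)"

text \<open>\<open>\<Gamma>\<close> is locally a regular level set of a function with Lipschitz derivative; regularity
  concerns the restriction of the function to the hyperboloid.\<close>

definition C11_surface :: "hyp3 set \<Rightarrow> bool" where
  "C11_surface \<Gamma> \<longleftrightarrow>
     (\<forall>p\<in>\<Gamma>. \<exists>U (f :: mspace \<Rightarrow> real) (f' :: mspace \<Rightarrow> mspace \<Rightarrow>\<^sub>L real) L.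
        open U \<and> Rep_hyp3 p \<in> U \<and>
        (\<forall>x\<in>U. (f has_derivative blinfun_apply (f' x)) (at x)) \<and> L-lipschitz_on U f' \<and>
        (\<exists>v. mink v (Rep_hyp3 p) = 0 \<and> blinfun_apply (f' (Rep_hyp3 p)) v \<noteq> 0) \<and>
        (\<forall>q. Rep_hyp3 q \<in> U \<longrightarrow> (q \<in> \<Gamma> \<longleftrightarrow> f (Rep_hyp3 q) = 0)))"

definition has_total_mean_curvature :: "hyp3 set \<Rightarrow> real \<Rightarrow> bool" where
  "has_total_mean_curvature \<Omega> m \<longleftrightarrow>
     (if C11_surface (frontier \<Omega>) then has_mean_curvature_integral \<Omega> m
      else \<exists>M. (\<forall>\<epsilon>>0. has_mean_curvature_integral (parallel_body \<Omega> \<epsilon>) (M \<epsilon>)) \<and>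
        (M \<longlongrightarrow> m) (at_right 0))"

text \<open>The total mean curvature of the geodesic sphere, respectively the flat double disk, of
  area \<open>S\<close>.\<close>

definition M\<^sub>1 :: "real \<Rightarrow> real" where
  "M\<^sub>1 S = sqrt (16 * pi * S + 4 * S\<^sup>2)"

definition M\<^sub>2 :: "real \<Rightarrow> real" where
  "M\<^sub>2 S = sqrt (2 * pi ^ 3 * S + pi\<^sup>2 / 4 * S\<^sup>2)"

end

theory Submission
  imports Defs "HOL-Real_Asymp.Real_Asymp"
begin

text \<open>
  Why the theorem is true. In hyperbolic 3-space the outer parallel surface at distance \<open>\<delta>\<close> of a
  convex surface with area \<open>S\<close> and total mean curvature \<open>M\<close> satisfies the Steiner formulas
  \<open>S(\<delta>) + 2\<pi> = (S + 2\<pi>) cosh 2\<delta> + (M/2) sinh 2\<delta>\<close> and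
  \<open>M(\<delta>) = 2 (S + 2\<pi>) sinh 2\<delta> + M cosh 2\<delta>\<close>, so that \<open>M\<^sup>2 - 4 (S + 2\<pi>)\<^sup>2\<close> is constant along the
  parallel surfaces. Geodesic spheres have the value \<open>-16\<pi>\<^sup>2\<close>, which is another way of writing \<open>M\<^sub>1\<close>.
  A convex body with a smaller value therefore beats the sphere of equal area, and all its outer
  parallel bodies do so too; their areas fill a half-line. The flat double disk is no competitor
  as long as \<open>M\<^sub>1 \<le> M\<^sub>2\<close>, that is, for areas up to the point \<open>S\<^sub>2\<close> where the two curves cross.
  So one body is needed whose invariant is below \<open>-16\<pi>\<^sup>2\<close> and whose area \<open>S\<^sub>1\<close> is below \<open>S\<^sub>2\<close>.

  Such a body is a ball from which a plane has cut off a cap. The family below has exterior angle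
  \<open>\<pi>/4\<close> along the circular edge, and the cosh of the radius of the ball is \<open>C\<close>. For \<open>C = 1.27\<close> the area
  is about \<open>7.57\<close>, just below \<open>S\<^sub>2 = 7.66...\<close>, and the total mean curvature is smaller than that of the
  sphere by about one part in ten thousand (\<open>body_beats_sphere\<close>, \<open>M1_le_M2\<close>).

  Only the parallel bodies with \<open>\<delta> > 0\<close> are used. Their boundary is of class \<open>C\<^sup>1\<^sup>,\<^sup>1\<close>
  (\<open>C11_surface_surface\<close>), so the total mean curvature is an integral over the boundary itself and no
  limit has to be taken. The boundary consists of a part of a sphere, a part of a tube around the
  edge, and a disk in an equidistant surface of the plane (\<open>frontier_body\<close>). The body is an intersection
  of sets \<open>{x. mink x n \<le> c}\<close> with \<open>c \<ge> 0\<close>. These are convex because a point of a geodesic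
  segment is a combination of the end points whose coefficients sum to at most 1
  (\<open>geodesic_segment_combination\<close>), and they provide the outward normals: where the constraint is
  active, \<open>n + c x\<close> points outwards.

  Area is a Hausdorff measure. Caratheodory's construction makes it a Borel measure, translation
  invariance makes it a multiple of Lebesgue measure in the plane (\<open>hausdorff2_plane\<close>), and a
  parametrisation that is almost an isometry near each point transports this to surfaces
  (\<open>area_formula_orthogonal_coordinates\<close>). The three parts of the boundary are surfaces of revolution
  with profiles of constant speed, for which the formula becomes an elementary integral
  (\<open>area_strip\<close>).
\<close>

section \<open>Two-dimensional Hausdorff measure\<close>

lemma hausdorff2_pre_mono: "A \<subseteq> B \<Longrightarrow> hausdorff2_pre \<delta> A \<le> hausdorff2_pre \<delta> B"
  unfolding hausdorff2_pre_def by (rule INF_superset_mono) auto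

lemma hausdorff2_pre_antimono:
  assumes "d \<le> e" shows "hausdorff2_pre e A \<le> hausdorff2_pre d A"
  unfolding hausdorff2_pre_def
  by (rule INF_superset_mono) (auto intro: order_trans[OF _ assms])

lemma hausdorff2_mono: "A \<subseteq> B \<Longrightarrow> hausdorff2 A \<le> hausdorff2 B"
  unfolding hausdorff2_def by (intro SUP_mono') (simp add: hausdorff2_pre_mono)

lemma hausdorff2_pre_le: "0 < \<delta> \<Longrightarrow> hausdorff2_pre \<delta> A \<le> hausdorff2 A"
  unfolding hausdorff2_def by (rule SUP_upper) simp

lemma hausdorff2_pre_leI:
  assumes "A \<subseteq> (\<Union>i. C i)" "\<And>i. bounded (C i)" "\<And>i. diameter (C i) \<le> \<delta>"
    "(\<Sum>i. ennreal ((diameter (C i))\<^sup>2)) \<le> x"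
  shows "hausdorff2_pre \<delta> A \<le> x"
  unfolding hausdorff2_pre_def by (rule INF_lower2[of C]) (use assms in auto)

lemma hausdorff2_pre_obtain:
  assumes "hausdorff2_pre \<delta> A < x"
  obtains C :: "nat \<Rightarrow> 'a::metric_space set" where
    "A \<subseteq> (\<Union>i. C i)" "\<And>i. bounded (C i)" "\<And>i. diameter (C i) \<le> \<delta>"
    "(\<Sum>i. ennreal ((diameter (C i))\<^sup>2)) < x"
  using assms unfolding hausdorff2_pre_def INF_less_iff by blast

text \<open>The coverings of the single sets, each optimal up to \<open>e / 2 ^ (n + 1)\<close>, are joined into one sequence.\<close>

lemma hausdorff2_pre_countable_subadditive:
  fixes A :: "nat \<Rightarrow> 'a::metric_space set"
  shows "hausdorff2_pre \<delta> (\<Union>n. A n) \<le> (\<Sum>n. hausdorff2_pre \<delta> (A n))"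
proof (cases "(\<Sum>n. hausdorff2_pre \<delta> (A n)) = top")
  case False
  have fin: "hausdorff2_pre \<delta> (A n) < top" for n
    using ennreal_suminf_lessD[of "\<lambda>n. hausdorff2_pre \<delta> (A n)" top n] False
    by (simp add: less_top)
  show ?thesis
  proof (rule ennreal_le_epsilon)
    fix e :: real assume e: "0 < e"
    define r where "r n = e * (1/2) ^ Suc n" for n :: nat
    have r: "r n > 0" for n using e by (simp add: r_def)
    have rsum: "(\<Sum>n. ennreal (r n)) = ennreal e"
      using power_half_series sums_mult[OF power_half_series, of e] r
      by (intro suminf_ennreal_eq) (auto simp: r_def less_imp_le)
    have "\<exists>C. A n \<subseteq> (\<Union>i. C i) \<and> (\<forall>i. bounded (C i) \<and> diameter (C i) \<le> \<delta>) \<and>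
       (\<Sum>i. ennreal ((diameter (C i))\<^sup>2)) \<le> hausdorff2_pre \<delta> (A n) + ennreal (r n)" for n
    proof -
      have "hausdorff2_pre \<delta> (A n) < hausdorff2_pre \<delta> (A n) + ennreal (r n)"
        using fin[of n] r[of n]
        by (cases "hausdorff2_pre \<delta> (A n)") (auto simp: ennreal_plus[symmetric] ennreal_lessI simp del: ennreal_plus)
      from hausdorff2_pre_obtain[OF this] show ?thesis by (metis less_imp_le)
    qed
    then obtain C where C: "\<And>n. A n \<subseteq> (\<Union>i. C n i)" "\<And>n i. bounded (C n i)"
      "\<And>n i. diameter (C n i) \<le> \<delta>"
      "\<And>n. (\<Sum>i. ennreal ((diameter (C n i))\<^sup>2)) \<le> hausdorff2_pre \<delta> (A n) + ennreal (r n)"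
      by metis
    define D where "D k = C (fst (prod_decode k)) (snd (prod_decode k))" for k
    have "(\<Sum>k. (\<lambda>(n, i). ennreal ((diameter (C n i))\<^sup>2)) (prod_decode k))
        = (\<Sum>n. \<Sum>i. ennreal ((diameter (C n i))\<^sup>2))"
      by (rule suminf_ennreal_2dimen) simp
    then have "(\<Sum>k. ennreal ((diameter (D k))\<^sup>2)) = (\<Sum>n. \<Sum>i. ennreal ((diameter (C n i))\<^sup>2))"
      by (simp only: D_def case_prod_beta)
    also have "\<dots> \<le> (\<Sum>n. hausdorff2_pre \<delta> (A n) + ennreal (r n))"
      by (intro suminf_le C(4)) auto
    also have "\<dots> = (\<Sum>n. hausdorff2_pre \<delta> (A n)) + ennreal e"
      by (subst suminf_add[symmetric]) (auto simp: rsum)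
    finally have "(\<Sum>k. ennreal ((diameter (D k))\<^sup>2)) \<le> (\<Sum>n. hausdorff2_pre \<delta> (A n)) + ennreal e" .
    moreover have "(\<Union>n. A n) \<subseteq> (\<Union>k. D k)"
    proof
      fix x assume "x \<in> (\<Union>n. A n)"
      then obtain n i where "x \<in> C n i" using C(1) by blast
      then have "x \<in> D (prod_encode (n, i))" by (simp add: D_def)
      then show "x \<in> (\<Union>k. D k)" by blast
    qed
    ultimately show "hausdorff2_pre \<delta> (\<Union>n. A n) \<le> (\<Sum>n. hausdorff2_pre \<delta> (A n)) + ennreal e"
      by (intro hausdorff2_pre_leI[where C = D]) (auto simp: D_def C)
  qed
qed auto

lemma hausdorff2_countable_subadditive:
  fixes A :: "nat \<Rightarrow> 'a::metric_space set"
  shows "hausdorff2 (\<Union>n. A n) \<le> (\<Sum>n. hausdorff2 (A n))"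
  unfolding hausdorff2_def[of "\<Union>n. A n"]
proof (rule SUP_least)
  fix \<delta> :: real assume "\<delta> \<in> {0<..}"
  then show "hausdorff2_pre \<delta> (\<Union>n. A n) \<le> (\<Sum>n. hausdorff2 (A n))"
    using hausdorff2_pre_countable_subadditive[of \<delta> A]
    by (elim order_trans) (intro suminf_le hausdorff2_pre_le, auto)
qed

lemma hausdorff2_pre_singleton: "0 < \<delta> \<Longrightarrow> hausdorff2_pre \<delta> {x} = 0"
  using hausdorff2_pre_leI[of "{x}" "\<lambda>i. {x}" \<delta> 0] by simp

lemma hausdorff2_singleton [simp]: "hausdorff2 {x} = 0"
  unfolding hausdorff2_def by (rule antisym) (auto simp: hausdorff2_pre_singleton intro!: SUP_least)

lemma hausdorff2_empty [simp]: "hausdorff2 {} = 0"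
  using hausdorff2_mono[of "{}" "{undefined}"] by simp

lemma outer_measure_space_hausdorff2: "outer_measure_space UNIV hausdorff2"
  unfolding outer_measure_space_def positive_def increasing_def countably_subadditive_def
  by (auto intro: hausdorff2_mono hausdorff2_countable_subadditive)

lemma hausdorff2_subadditive: "hausdorff2 (A \<union> B) \<le> hausdorff2 A + hausdorff2 B"
proof -
  have "A \<union> B = (\<Union>n::nat. binaryset A B n)" by (simp add: UN_binaryset_eq)
  also have "hausdorff2 \<dots> \<le> (\<Sum>n. hausdorff2 (binaryset A B n))"
    by (rule hausdorff2_countable_subadditive)
  also have "\<dots> = (\<Sum>n\<in>{0, 1::nat}. hausdorff2 (binaryset A B n))"
    by (intro suminf_finite) (auto simp: binaryset_def)
  finally show ?thesis by (simp add: binaryset_def)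
qed

text \<open>A covering by sets of diameter less than the distance of \<open>A\<close> and \<open>B\<close> splits into a
  covering of \<open>A\<close> and a covering of \<open>B\<close>.\<close>

lemma hausdorff2_metric_additive:
  fixes A B :: "'a::metric_space set"
  assumes e: "0 < e" and sep: "\<And>x y. x \<in> A \<Longrightarrow> y \<in> B \<Longrightarrow> e \<le> dist x y"
  shows "hausdorff2 A + hausdorff2 B \<le> hausdorff2 (A \<union> B)"
proof -
  have *: "hausdorff2_pre \<delta> A + hausdorff2_pre \<delta> B \<le> hausdorff2_pre \<delta> (A \<union> B)"
    if \<delta>: "0 < \<delta>" "\<delta> < e" for \<delta>
  proof (subst (3) hausdorff2_pre_def, rule INF_greatest, clarify)
    fix C :: "nat \<Rightarrow> 'a set"
    assume C: "A \<union> B \<subseteq> (\<Union>i. C i)" "\<forall>i. bounded (C i) \<and> diameter (C i) \<le> \<delta>"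
    define S where "S T i = (if C i \<inter> T = {} then {} else C i)" for T i
    have S: "hausdorff2_pre \<delta> T \<le> (\<Sum>i. ennreal ((diameter (S T i))\<^sup>2))" if "T \<subseteq> A \<union> B" for T
    proof (rule hausdorff2_pre_leI[where C = "S T"])
      show "T \<subseteq> (\<Union>i. S T i)"
      proof
        fix x assume "x \<in> T"
        then have "x \<in> (\<Union>i. C i)" using that C(1) by blast
        then obtain i where "x \<in> C i" by blast
        with \<open>x \<in> T\<close> have "x \<in> S T i" by (auto simp: S_def)
        then show "x \<in> (\<Union>i. S T i)" by blast
      qed
    qed (use C \<delta> in \<open>auto simp: S_def\<close>)
    have disj: "C i \<inter> A = {} \<or> C i \<inter> B = {}" for i
    proof (rule ccontr)
      assume "\<not> ?thesis"
      then obtain x y where xy: "x \<in> C i" "x \<in> A" "y \<in> C i" "y \<in> B" by blast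
      then have "dist x y \<le> diameter (C i)" using C(2) diameter_bounded_bound by blast
      with C(2) \<delta> sep[OF xy(2,4)] show False by (smt (verit))
    qed
    have "hausdorff2_pre \<delta> A + hausdorff2_pre \<delta> B \<le>
        (\<Sum>i. ennreal ((diameter (S A i))\<^sup>2)) + (\<Sum>i. ennreal ((diameter (S B i))\<^sup>2))"
      by (intro add_mono S) auto
    also have "\<dots> = (\<Sum>i. ennreal ((diameter (S A i))\<^sup>2) + ennreal ((diameter (S B i))\<^sup>2))"
      by (simp add: suminf_add)
    also have "\<dots> \<le> (\<Sum>i. ennreal ((diameter (C i))\<^sup>2))"
    proof (intro suminf_le)
      show "ennreal ((diameter (S A i))\<^sup>2) + ennreal ((diameter (S B i))\<^sup>2)
        \<le> ennreal ((diameter (C i))\<^sup>2)" for i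
        using disj[of i] by (auto simp: S_def)
    qed auto
    finally show "hausdorff2_pre \<delta> A + hausdorff2_pre \<delta> B \<le> (\<Sum>i. ennreal ((diameter (C i))\<^sup>2))" .
  qed
  have le: "hausdorff2_pre d1 A + hausdorff2_pre d2 B \<le> hausdorff2 (A \<union> B)"
    if d: "0 < d1" "0 < d2" for d1 d2
  proof -
    define d where "d = min (min d1 d2) (e / 2)"
    have "d > 0" "d < e" using d e by (auto simp: d_def min_def)
    have "hausdorff2_pre d1 A + hausdorff2_pre d2 B \<le> hausdorff2_pre d A + hausdorff2_pre d B"
      by (intro add_mono hausdorff2_pre_antimono) (auto simp: d_def)
    also have "\<dots> \<le> hausdorff2 (A \<union> B)"
      using *[OF \<open>d > 0\<close> \<open>d < e\<close>] hausdorff2_pre_le[OF \<open>d > 0\<close>] order_trans by blast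
    finally show ?thesis .
  qed
  have "hausdorff2 A + hausdorff2 B =
    (SUP d1\<in>{0<..}. SUP d2\<in>{0<..}. hausdorff2_pre d1 A + hausdorff2_pre d2 B)"
    unfolding hausdorff2_def
    by (subst ennreal_SUP_add_left[symmetric], force, subst ennreal_SUP_add_right[symmetric]) auto
  also have "\<dots> \<le> hausdorff2 (A \<union> B)"
    by (intro SUP_least le) auto
  finally show ?thesis .
qed

text \<open>Caratheodory's criterion for metric outer measures. The part of \<open>X - F\<close> at distance at least
  \<open>1 / n\<close> from \<open>F\<close> is separated from \<open>X \<inter> F\<close>, so only the tail of the shells around \<open>F\<close> is lost, and
  it vanishes in the limit.\<close>

lemma closed_in_lambda_system_hausdorff2:
  fixes F :: "'a::metric_space set"
  assumes F: "closed F"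
  shows "F \<in> lambda_system UNIV UNIV hausdorff2"
proof -
  have "hausdorff2 (X \<inter> F) + hausdorff2 (X - F) \<le> hausdorff2 X" for X
  proof (cases "hausdorff2 X = top \<or> F = {}")
    case True
    then show ?thesis by auto
  next
    case False
    then have fin: "hausdorff2 X < top" and ne: "F \<noteq> {}" by (auto simp: less_top)
    \<comment> \<open>Shells \<open>R n\<close> whose indices differ by at least two are separated, so the even ones and the odd ones
      are additive, and their measures are summable.\<close>
    define G where "G n = {x\<in>X. 1 / real (Suc n) \<le> infdist x F}" for n
    define R where "R n = G (Suc n) - G n" for n
    have Gmono: "G m \<subseteq> G n" if "m \<le> n" for m n
      using that by (auto simp: G_def elim!: order_trans[rotated] intro!: divide_left_mono)
    have GU: "X - F = (\<Union>n. G n)"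
    proof
      show "X - F \<subseteq> (\<Union>n. G n)"
      proof
        fix x assume x: "x \<in> X - F"
        then have "infdist x F > 0"
          using F ne by (metis DiffD2 infdist_nonneg in_closed_iff_infdist_zero less_eq_real_def)
        then obtain n where "inverse (real (Suc n)) < infdist x F"
          using reals_Archimedean by blast
        then have "x \<in> G n" using x by (auto simp: G_def inverse_eq_divide)
        then show "x \<in> (\<Union>n. G n)" by blast
      qed
      show "(\<Union>n. G n) \<subseteq> X - F"
      proof
        fix x assume "x \<in> (\<Union>n. G n)"
        then obtain n where n: "x \<in> X" "1 / real (Suc n) \<le> infdist x F" by (auto simp: G_def)
        moreover have "0 < 1 / real (Suc n)" by simp
        ultimately have "infdist x F \<noteq> 0" by linarith
        with n show "x \<in> X - F" using infdist_zero by blast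
      qed
    qed
    have sepR: "hausdorff2 A + hausdorff2 B \<le> hausdorff2 (A \<union> B)"
      if "A \<subseteq> G n" "\<And>y. y \<in> B \<Longrightarrow> infdist y F \<le> 1 / real (Suc (Suc n))" for A B n
    proof (rule hausdorff2_metric_additive[where e = "1 / real (Suc n) - 1 / real (Suc (Suc n))"])
      show "0 < 1 / real (Suc n) - 1 / real (Suc (Suc n))"
        using frac_less2[of 1 1 "real (Suc n)" "real (Suc (Suc n))"] by simp
      fix x y assume "x \<in> A" "y \<in> B"
      then have "1 / real (Suc n) \<le> infdist x F" "infdist y F \<le> 1 / real (Suc (Suc n))"
        using that by (auto simp: G_def)
      then show "1 / real (Suc n) - 1 / real (Suc (Suc n)) \<le> dist x y"
        using infdist_triangle[of x F y] by linarith
    qed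
    have Gle: "hausdorff2 (X \<inter> F) + hausdorff2 (G n) \<le> hausdorff2 X" for n
    proof -
      have "hausdorff2 (G n) + hausdorff2 (X \<inter> F) \<le> hausdorff2 (G n \<union> (X \<inter> F))"
        by (rule sepR) auto
      also have "\<dots> \<le> hausdorff2 X" by (rule hausdorff2_mono) (auto simp: G_def)
      finally show ?thesis by (simp add: add.commute)
    qed
    have Rsub: "R m \<subseteq> G n" if "Suc m \<le> n" for m n
      using Gmono[OF that] by (auto simp: R_def)
    have Rsmall: "infdist y F \<le> 1 / real (Suc n)" if "y \<in> R n" for y n
      using that by (auto simp: R_def G_def)
    have even_odd: "(\<Sum>i<n. hausdorff2 (R (2 * i + c))) \<le> hausdorff2 X" for n c
    proof -
      have "(\<Sum>i<n. hausdorff2 (R (2 * i + c))) \<le> hausdorff2 (\<Union>i<n. R (2 * i + c))"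
      proof (induction n)
        case (Suc n)
        have "hausdorff2 (\<Union>i<n. R (2 * i + c)) + hausdorff2 (R (2 * n + c))
            \<le> hausdorff2 ((\<Union>i<n. R (2 * i + c)) \<union> R (2 * n + c))"
        proof (cases "n = 0")
          case False
          show ?thesis
          proof (rule sepR[where n = "2 * n + c - 1"])
            show "(\<Union>i<n. R (2 * i + c)) \<subseteq> G (2 * n + c - 1)"
              by (auto intro!: subsetD[OF Rsub])
          next
            show "infdist y F \<le> 1 / real (Suc (Suc (2 * n + c - 1)))" if "y \<in> R (2 * n + c)" for y
              using Rsmall[OF that] False by simp
          qed
        qed simp
        moreover have "(\<Union>i<n. R (2 * i + c)) \<union> R (2 * n + c) = (\<Union>i<Suc n. R (2 * i + c))"
          by (auto simp: less_Suc_eq)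
        ultimately show ?case using Suc by (auto intro: order_trans add_right_mono)
      qed simp
      also have "\<dots> \<le> hausdorff2 X" by (rule hausdorff2_mono) (auto simp: R_def G_def)
      finally show ?thesis .
    qed
    have "(\<Sum>i<2 * n. hausdorff2 (R i)) \<le> 2 * hausdorff2 X" for n
    proof -
      have "(\<Sum>i<2 * n. hausdorff2 (R i)) =
          (\<Sum>i<n. hausdorff2 (R (2 * i + 0))) + (\<Sum>i<n. hausdorff2 (R (2 * i + 1)))"
        by (induction n) (auto simp: algebra_simps)
      also have "\<dots> \<le> hausdorff2 X + hausdorff2 X"
        by (intro add_mono even_odd)
      finally show ?thesis by (simp add: mult_2)
    qed
    moreover have "(\<Sum>i<n. hausdorff2 (R i)) \<le> (\<Sum>i<2 * n. hausdorff2 (R i))" for n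
      by (intro sum_mono2) auto
    ultimately have "(\<Sum>i<n. hausdorff2 (R i)) \<le> 2 * hausdorff2 X" for n
      using order_trans by blast
    then have sumR: "(\<Sum>i. hausdorff2 (R i)) \<le> 2 * hausdorff2 X"
      by (intro suminf_le_const summableI)
    then have finR: "(\<Sum>i. hausdorff2 (R i)) \<noteq> top"
      using fin le_less_trans[OF sumR, of top] by (simp add: ennreal_mult_less_top)
    have tail: "hausdorff2 (X - F) \<le> hausdorff2 (G n) + (\<Sum>i. hausdorff2 (R (i + n)))" for n
    proof -
      have "X - F \<subseteq> G n \<union> (\<Union>i. R (i + n))"
      proof
        fix x assume "x \<in> X - F"
        then obtain m where m: "x \<in> G m" using GU by blast
        define k where "k = (LEAST m. x \<in> G m)"
        have k: "x \<in> G k" "\<And>j. j < k \<Longrightarrow> x \<notin> G j"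
          unfolding k_def using m by (auto intro: LeastI dest: not_less_Least)
        show "x \<in> G n \<union> (\<Union>i. R (i + n))"
        proof (cases "k \<le> n")
          case True then show ?thesis using Gmono k(1) by blast
        next
          case False
          then have "x \<in> R ((k - 1 - n) + n)"
            using k(1) k(2)[of "k - 1"] by (auto simp: R_def)
          then show ?thesis by blast
        qed
      qed
      then have "hausdorff2 (X - F) \<le> hausdorff2 (G n \<union> (\<Union>i. R (i + n)))" by (rule hausdorff2_mono)
      also have "\<dots> \<le> hausdorff2 (G n) + hausdorff2 (\<Union>i. R (i + n))" by (rule hausdorff2_subadditive)
      also have "\<dots> \<le> hausdorff2 (G n) + (\<Sum>i. hausdorff2 (R (i + n)))"
        by (intro add_left_mono hausdorff2_countable_subadditive)
      finally show ?thesis .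
    qed
    have "hausdorff2 (X \<inter> F) + hausdorff2 (X - F) \<le> hausdorff2 X + (\<Sum>i. hausdorff2 (R (i + n)))" for n
    proof -
      have "hausdorff2 (X \<inter> F) + hausdorff2 (X - F) \<le>
        (hausdorff2 (X \<inter> F) + hausdorff2 (G n)) + (\<Sum>i. hausdorff2 (R (i + n)))"
        using add_left_mono[OF tail] by (simp add: add.assoc)
      also have "\<dots> \<le> hausdorff2 X + (\<Sum>i. hausdorff2 (R (i + n)))"
        by (intro add_right_mono Gle)
      finally show ?thesis .
    qed
    moreover have "(\<lambda>n. hausdorff2 X + (\<Sum>i. hausdorff2 (R (i + n)))) \<longlonglongrightarrow> hausdorff2 X + 0"
    proof (intro tendsto_add tendsto_const)
      obtain r where r: "\<And>i. hausdorff2 (R i) = ennreal (r i)" "\<And>i. r i \<ge> 0"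
      proof -
        have "hausdorff2 (R i) \<noteq> top" for i
          using finR ennreal_suminf_lessD[of "\<lambda>i. hausdorff2 (R i)" top i] by (simp add: less_top)
        then have "hausdorff2 (R i) = ennreal (enn2real (hausdorff2 (R i)))" for i
          by (simp add: less_top)
        then show ?thesis using that[of "\<lambda>i. enn2real (hausdorff2 (R i))"] by simp
      qed
      have sm: "summable r"
        using finR r by (simp add: summable_suminf_not_top)
      have "(\<Sum>i. hausdorff2 (R (i + n))) = ennreal (\<Sum>i. r (i + n))" for n
        unfolding r using sm r(2) by (intro suminf_ennreal2) auto
      moreover have "(\<lambda>n. \<Sum>i. r (i + n)) \<longlonglongrightarrow> 0"
        using suminf_exist_split2[OF sm] by simp
      ultimately show "(\<lambda>n. \<Sum>i. hausdorff2 (R (i + n))) \<longlonglongrightarrow> 0"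
        using tendsto_ennrealI[of "\<lambda>n. \<Sum>i. r (i + n)" 0] by simp
    qed
    ultimately show ?thesis
      by (intro LIMSEQ_le_const[of _ "hausdorff2 X"]) auto
  qed
  moreover have "hausdorff2 X \<le> hausdorff2 (X \<inter> F) + hausdorff2 (X - F)" for X
    using hausdorff2_subadditive[of "X \<inter> F" "X - F"] by (simp add: Un_Diff_Int Un_commute)
  ultimately have "hausdorff2 (X \<inter> F) + hausdorff2 (X - F) = hausdorff2 X" for X
    by (rule antisym)
  moreover have "F \<inter> X = X \<inter> F" "(UNIV - F) \<inter> X = X - F" for X by auto
  ultimately show ?thesis by (simp add: lambda_system_def)
qed

lemma measure_space_hausdorff2:
  "measure_space UNIV (sets borel) (hausdorff2 :: 'a::metric_space set \<Rightarrow> ennreal)"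
proof -
  interpret U: sigma_algebra UNIV "UNIV :: 'a set set" by (simp add: sigma_algebra_iff2)
  let ?L = "lambda_system UNIV UNIV (hausdorff2 :: 'a set \<Rightarrow> ennreal)"
  have L: "measure_space UNIV ?L hausdorff2"
    by (rule U.caratheodory_lemma[OF outer_measure_space_hausdorff2])
  then interpret L: sigma_algebra UNIV ?L by (simp add: measure_space_def)
  have sub: "sets borel \<subseteq> ?L"
    unfolding borel_eq_closed
    by (subst sets_measure_of, simp, intro L.sigma_sets_subset) (auto intro: closed_in_lambda_system_hausdorff2)
  show ?thesis
    unfolding measure_space_def
  proof (intro conjI)
    show "sigma_algebra UNIV (sets (borel :: 'a measure))"
      using sets.sigma_algebra_axioms[of "borel :: 'a measure"] by simp
    show "positive (sets borel) (hausdorff2 :: 'a set \<Rightarrow> ennreal)" by (simp add: positive_def)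
    show "countably_additive (sets borel) (hausdorff2 :: 'a set \<Rightarrow> ennreal)"
    proof (rule countably_additiveI)
      fix A :: "nat \<Rightarrow> 'a set"
      assume A: "range A \<subseteq> sets borel" "disjoint_family A"
      then have "range A \<subseteq> ?L" using sub by blast
      with A(2) show "(\<Sum>i. hausdorff2 (A i)) = hausdorff2 (\<Union>i. A i)"
        using L unfolding measure_space_def countably_additive_def by blast
    qed
  qed
qed

lemma ennreal_le_mult_of_less:
  fixes x a :: ennreal
  assumes "\<And>y. a < y \<Longrightarrow> x \<le> ennreal c * y" and c: "0 < c"
  shows "x \<le> ennreal c * a"
proof (cases "a = top")
  case False
  show ?thesis
  proof (rule ennreal_le_epsilon)
    fix e :: real assume e: "0 < e"
    have "a < a + ennreal (e / c)"
      using False e c by (cases a) (auto simp: ennreal_plus[symmetric] ennreal_less_iff simp del: ennreal_plus)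
    then have "x \<le> ennreal c * (a + ennreal (e / c))" by (rule assms)
    also have "\<dots> = ennreal c * a + ennreal e"
      using c e by (simp add: distrib_left ennreal_mult[symmetric])
    finally show "x \<le> ennreal c * a + ennreal e" .
  qed
qed (use c in \<open>simp add: ennreal_mult_top\<close>)

text \<open>Lipschitz maps carry coverings to coverings. This is the only way in which the measures of
  sets in different spaces are compared below.\<close>

lemma hausdorff2_lipschitz_image:
  fixes f :: "'a::metric_space \<Rightarrow> 'b::metric_space"
  assumes L: "0 < L" and f: "\<And>x y. x \<in> A \<Longrightarrow> y \<in> A \<Longrightarrow> dist (f x) (f y) \<le> L * dist x y"
  shows "hausdorff2 (f ` A) \<le> ennreal (L\<^sup>2) * hausdorff2 A"
  unfolding hausdorff2_def[of "f ` A"]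
proof (rule SUP_least)
  fix \<delta> :: real assume "\<delta> \<in> {0<..}"
  then have \<delta>: "0 < \<delta>" by simp
  have "hausdorff2_pre \<delta> (f ` A) \<le> ennreal (L\<^sup>2) * x" if "hausdorff2_pre (\<delta> / L) A < x" for x
  proof -
    from hausdorff2_pre_obtain[OF that] obtain C :: "nat \<Rightarrow> 'a set" where
      C: "A \<subseteq> (\<Union>i. C i)" "\<And>i. bounded (C i)" "\<And>i. diameter (C i) \<le> \<delta> / L"
        "(\<Sum>i. ennreal ((diameter (C i))\<^sup>2)) < x" by blast
    have D: "dist u v \<le> L * diameter (C i)" if uv: "u \<in> f ` (C i \<inter> A)" "v \<in> f ` (C i \<inter> A)" for u v i
    proof -
      obtain x y where xy: "x \<in> C i \<inter> A" "y \<in> C i \<inter> A" "u = f x" "v = f y" using uv by blast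
      then have "dist u v \<le> L * dist x y" using f by blast
      also have "\<dots> \<le> L * diameter (C i)"
        using L xy diameter_bounded_bound[OF C(2)] by (intro mult_left_mono) auto
      finally show ?thesis .
    qed
    have bd: "bounded (f ` (C i \<inter> A))" for i
      unfolding bounded_two_points using D by blast
    have dm: "diameter (f ` (C i \<inter> A)) \<le> L * diameter (C i)" for i
    proof (cases "C i \<inter> A = {}")
      case True
      then show ?thesis using L diameter_ge_0[OF C(2)] by simp
    next
      case False
      then show ?thesis
        unfolding diameter_def[of "f ` _"] using D by (auto intro!: cSUP_least)
    qed
    show ?thesis
    proof (rule hausdorff2_pre_leI[where C = "\<lambda>i. f ` (C i \<inter> A)"])
      show "f ` A \<subseteq> (\<Union>i. f ` (C i \<inter> A))" using C(1) by blast
      show "diameter (f ` (C i \<inter> A)) \<le> \<delta>" for i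
        using dm[of i] mult_left_mono[OF C(3)[of i], of L] L by simp
      have "(\<Sum>i. ennreal ((diameter (f ` (C i \<inter> A)))\<^sup>2))
          \<le> (\<Sum>i. ennreal (L\<^sup>2) * ennreal ((diameter (C i))\<^sup>2))"
      proof (intro suminf_le)
        show "ennreal ((diameter (f ` (C i \<inter> A)))\<^sup>2) \<le> ennreal (L\<^sup>2) * ennreal ((diameter (C i))\<^sup>2)" for i
          using power_mono[OF dm diameter_ge_0[OF bd], of i 2]
          by (simp add: ennreal_mult[symmetric] power_mult_distrib)
      qed auto
      also have "\<dots> = ennreal (L\<^sup>2) * (\<Sum>i. ennreal ((diameter (C i))\<^sup>2))" by simp
      also have "\<dots> \<le> ennreal (L\<^sup>2) * x" using C(4) by (intro mult_left_mono) auto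
      finally show "(\<Sum>i. ennreal ((diameter (f ` (C i \<inter> A)))\<^sup>2)) \<le> ennreal (L\<^sup>2) * x" .
    qed (use bd in auto)
  qed
  then have "hausdorff2_pre \<delta> (f ` A) \<le> ennreal (L\<^sup>2) * hausdorff2_pre (\<delta> / L) A"
    by (rule ennreal_le_mult_of_less) (use L in auto)
  also have "\<dots> \<le> ennreal (L\<^sup>2) * hausdorff2 A"
    using \<delta> L by (intro mult_left_mono hausdorff2_pre_le) auto
  finally show "hausdorff2_pre \<delta> (f ` A) \<le> ennreal (L\<^sup>2) * hausdorff2 A" .
qed

section \<open>Hausdorff measure of the plane\<close>

lemma hausdorff2_isometric_image:
  fixes f :: "'a::metric_space \<Rightarrow> 'b::metric_space"
  assumes f: "\<And>x y. x \<in> A \<Longrightarrow> y \<in> A \<Longrightarrow> dist (f x) (f y) = dist x y"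
  shows "hausdorff2 (f ` A) = hausdorff2 A"
proof (rule antisym)
  show "hausdorff2 (f ` A) \<le> hausdorff2 A"
    using hausdorff2_lipschitz_image[of 1 A f] f by simp
  have inj: "inj_on f A" using f by (intro inj_onI) (metis dist_eq_0_iff)
  have "hausdorff2 (inv_into A f ` (f ` A)) \<le> hausdorff2 (f ` A)"
    using hausdorff2_lipschitz_image[of 1 "f ` A" "inv_into A f"] f inj
    by (simp add: image_iff) (metis inv_into_f_f order_refl f)
  then show "hausdorff2 A \<le> hausdorff2 (f ` A)"
    using inj by (simp add: inv_into_image_cancel)
qed

text \<open>Surfaces are parametrised by \<open>real \<times> real\<close>, where Tonelli's theorem is at hand; the normalising
  square lives in \<open>real ^ 2\<close>, which is isometric.\<close>

abbreviation unit_square :: "(real \<times> real) set" where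
  "unit_square \<equiv> {0..1} \<times> {0..1}"

lemma hausdorff2_unit_square: "hausdorff2 (cbox 0 1 :: (real^2) set) = hausdorff2 unit_square"
proof -
  let ?f = "\<lambda>x :: real^2. (x $ 1, x $ 2)"
  have "unit_square \<subseteq> ?f ` cbox 0 1"
  proof clarify
    fix a b :: real assume "a \<in> {0..1}" "b \<in> {0..1}"
    then have "vector [a, b] \<in> (cbox 0 1 :: (real^2) set)"
      by (auto simp: mem_box_cart forall_2)
    then have "?f (vector [a, b]) \<in> ?f ` cbox 0 1" by (rule imageI)
    then show "(a, b) \<in> ?f ` cbox 0 1" by simp
  qed
  moreover have "?f ` cbox 0 1 \<subseteq> unit_square"
    by (auto simp: mem_box_cart forall_2)
  ultimately have "?f ` cbox 0 1 = unit_square" by (rule antisym[rotated])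
  moreover have "hausdorff2 (?f ` cbox 0 1) = hausdorff2 (cbox 0 1 :: (real^2) set)"
    by (rule hausdorff2_isometric_image)
       (simp add: dist_Pair_Pair dist_vec_def L2_set_def sum_2)
  ultimately show ?thesis by simp
qed

text \<open>A grid of \<open>n\<^sup>2\<close> squares covers the unit square, each of squared diameter \<open>2 / n\<^sup>2\<close>.\<close>

lemma hausdorff2_unit_square_le: "hausdorff2 unit_square \<le> 2"
  unfolding hausdorff2_def
proof (rule SUP_least)
  fix \<delta> :: real assume "\<delta> \<in> {0<..}"
  then obtain n :: nat where n: "2 / \<delta> < real n" "n > 0"
    using reals_Archimedean2[of "2 / \<delta>"] by (metis bot_nat_0.not_eq_extremum greaterThan_iff
        divide_pos_pos not_less_iff_gr_or_eq of_nat_0 zero_less_numeral order_less_trans)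
  then have n': "2 / real n < \<delta>" using \<open>\<delta> \<in> {0<..}\<close> by (simp add: field_simps)
  define Q where "Q i j = {real i / n..(real i + 1) / n} \<times> {real j / n..(real j + 1) / n}" for i j :: nat
  define C where "C k = (if k < n * n then Q (k div n) (k mod n) else {})" for k
  have dQ: "dist x y \<le> sqrt (2 / (real n)\<^sup>2)" if xy: "x \<in> Q i j" "y \<in> Q i j" for x y i j
  proof -
    have 1: "\<bar>a - b\<bar> \<le> 1 / n" if "real i / n \<le> a" "a \<le> (real i + 1) / n" "real i / n \<le> b" "b \<le> (real i + 1) / n"
      for a b :: real and i :: nat
      using that by (simp add: add_divide_distrib abs_le_iff)
    have "\<bar>fst x - fst y\<bar> \<le> 1 / n" "\<bar>snd x - snd y\<bar> \<le> 1 / n"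
      using xy 1 by (auto simp: Q_def)
    from this[THEN power_mono, of 2] show ?thesis
      by (auto simp: dist_prod_def dist_real_def power_divide intro!: real_sqrt_le_mono)
  qed
  have bC: "bounded (C k)" for k
    by (auto simp: C_def Q_def intro!: bounded_Times)
  have dC: "diameter (C k) \<le> sqrt (2 / (real n)\<^sup>2)" for k
    unfolding diameter_def C_def using dQ by (auto intro!: cSUP_least)
  show "hausdorff2_pre \<delta> unit_square \<le> 2"
  proof (rule hausdorff2_pre_leI[where C = C])
    show "unit_square \<subseteq> (\<Union>k. C k)"
    proof clarify
      fix a b :: real assume "a \<in> {0..1}" "b \<in> {0..1}"
      moreover have ex: "\<exists>i<n. real i / n \<le> a \<and> a \<le> (real i + 1) / n" if "a \<in> {0..1}" for a :: real
      proof (cases "a = 1")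
        case True
        then show ?thesis using n(2) by (intro exI[of _ "n - 1"]) (auto simp: of_nat_diff)
      next
        case False
        define i where "i = nat \<lfloor>a * n\<rfloor>"
        have i: "real i = of_int \<lfloor>a * n\<rfloor>" using that by (simp add: i_def)
        have "real i \<le> a * n" "a * n < real i + 1" using i by linarith+
        moreover have "a * real n < 1 * real n" using that False n(2) by (intro mult_strict_right_mono) auto
        ultimately have "i < n" by linarith
        then show ?thesis using n(2) \<open>real i \<le> a * n\<close> \<open>a * n < real i + 1\<close>
          by (intro exI[of _ i]) (auto simp: field_simps)
      qed
      ultimately obtain i j where ij: "i < n" "j < n" "(a, b) \<in> Q i j"
        using ex[of a] ex[of b] unfolding Q_def mem_Times_iff atLeastAtMost_iff fst_conv snd_conv
        by metis
      have "i * n + j < n * n"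
      proof -
        have "i * n + j < (i + 1) * n" using ij by simp
        also have "\<dots> \<le> n * n" using ij by (intro mult_right_mono) auto
        finally show ?thesis .
      qed
      then have "(a, b) \<in> C (i * n + j)" using ij by (simp add: C_def)
      then show "(a, b) \<in> (\<Union>k. C k)" by blast
    qed
    have "sqrt (2 / (real n)\<^sup>2) \<le> 2 / real n"
      using real_sqrt_le_mono[of 2 4] by (simp add: real_sqrt_divide divide_right_mono)
    with dC n' show "diameter (C k) \<le> \<delta>" for k
      by (meson less_eq_real_def order_trans)
    have "(\<Sum>k. ennreal ((diameter (C k))\<^sup>2)) = (\<Sum>k<n * n. ennreal ((diameter (C k))\<^sup>2))"
      by (intro suminf_finite) (auto simp: C_def)
    also have "\<dots> \<le> (\<Sum>k<n * n. ennreal (2 / (real n)\<^sup>2))"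
    proof (intro sum_mono ennreal_leI)
      show "(diameter (C k))\<^sup>2 \<le> 2 / (real n)\<^sup>2" for k
        using power_mono[OF dC diameter_ge_0[OF bC], of k 2] by simp
    qed
    also have "\<dots> = ennreal (real (n * n) * (2 / (real n)\<^sup>2))"
      by (simp add: ennreal_of_nat_eq_real_of_nat ennreal_mult[symmetric])
    also have "\<dots> = 2" using n(2) by (simp add: power2_eq_square)
    finally show "(\<Sum>k. ennreal ((diameter (C k))\<^sup>2)) \<le> 2" .
  qed (rule bC)
qed

lemma emeasure_lborel_rectangle:
  fixes a b c d :: real
  assumes "a \<le> b" "c \<le> d"
  shows "emeasure lborel ({a..b} \<times> {c..d}) = ennreal ((b - a) * (d - c))"
  unfolding lborel_prod[symmetric] using assms
  by (subst lborel.emeasure_pair_measure_Times) (auto simp: ennreal_mult)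

text \<open>A set of diameter \<open>d\<close> lies in a square of Lebesgue measure \<open>4 d\<^sup>2\<close>. Positivity matters because the
  area measure divides by this number.\<close>

lemma hausdorff2_unit_square_ge: "1 / 4 \<le> hausdorff2 unit_square"
proof -
  have "1 / 4 \<le> hausdorff2_pre 1 unit_square"
    unfolding hausdorff2_pre_def
  proof (rule INF_greatest, clarify)
    fix C :: "nat \<Rightarrow> (real \<times> real) set"
    assume C: "unit_square \<subseteq> (\<Union>i. C i)" "\<forall>i. bounded (C i) \<and> diameter (C i) \<le> 1"
    have "\<exists>B. C i \<subseteq> B \<and> B \<in> sets borel \<and> emeasure lborel B \<le> 4 * ennreal ((diameter (C i))\<^sup>2)" for i
    proof (cases "C i = {}")
      case False
      then obtain p where p: "p \<in> C i" by blast
      let ?d = "diameter (C i)"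
      have d: "0 \<le> ?d" using C(2) diameter_ge_0 by blast
      let ?B = "{fst p - ?d..fst p + ?d} \<times> {snd p - ?d..snd p + ?d}"
      have "C i \<subseteq> ?B"
      proof
        fix x assume "x \<in> C i"
        then have "dist x p \<le> ?d" using C(2) p diameter_bounded_bound by blast
        then have "dist (fst x) (fst p) \<le> ?d" "dist (snd x) (snd p) \<le> ?d"
          using dist_fst_le[of x p] dist_snd_le[of x p] by linarith+
        then show "x \<in> ?B" by (auto simp: dist_real_def mem_Times_iff abs_le_iff)
      qed
      moreover have "emeasure lborel ?B = 4 * ennreal (?d\<^sup>2)"
        using d by (simp add: emeasure_lborel_rectangle power2_eq_square ennreal_mult' flip: ennreal_numeral)
      moreover have "?B \<in> sets borel" by (intro borel_closed closed_Times) auto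
      ultimately show ?thesis by (metis order_refl)
    qed (auto intro!: exI[of _ "{}"])
    then obtain B where B: "\<And>i. C i \<subseteq> B i" "\<And>i. B i \<in> sets borel"
      "\<And>i. emeasure lborel (B i) \<le> 4 * ennreal ((diameter (C i))\<^sup>2)" by metis
    have "1 = emeasure lborel unit_square"
      by (simp add: emeasure_lborel_rectangle)
    also have "\<dots> \<le> emeasure lborel (\<Union>i. B i)"
    proof (intro emeasure_mono)
      show "unit_square \<subseteq> (\<Union>i. B i)" using C(1) B(1) by (meson UN_mono order_refl order_trans)
    qed (use B in auto)
    also have "\<dots> \<le> (\<Sum>i. emeasure lborel (B i))"
      using B by (intro emeasure_subadditive_countably) auto
    also have "\<dots> \<le> (\<Sum>i. 4 * ennreal ((diameter (C i))\<^sup>2))"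
      by (intro suminf_le B) auto
    also have "\<dots> = 4 * (\<Sum>i. ennreal ((diameter (C i))\<^sup>2))" by simp
    finally have "1 \<le> 4 * (\<Sum>i. ennreal ((diameter (C i))\<^sup>2))" .
    then show "1 / 4 \<le> (\<Sum>i. ennreal ((diameter (C i))\<^sup>2))"
      by (simp add: divide_le_posI_ennreal mult.commute)
  qed
  also have "\<dots> \<le> hausdorff2 unit_square" by (rule hausdorff2_pre_le) simp
  finally show ?thesis .
qed

text \<open>Tonelli's theorem for \<open>M\<close> and Lebesgue measure, applied to the indicator of \<open>x \<in> B \<and> y - x \<in> Q\<close>:
  integrating first over \<open>y\<close> gives the measure of \<open>B\<close> under \<open>M\<close>, and first over \<open>x\<close>, after a shift by
  \<open>y\<close>, a multiple of its Lebesgue measure.\<close>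

lemma translation_invariant_measure_eq:
  fixes M :: "'a::euclidean_space measure"
  assumes sets: "sets M = sets borel" and sf: "sigma_finite_measure M"
    and inv: "\<And>x A. A \<in> sets borel \<Longrightarrow> emeasure M ((\<lambda>y. x + y) -` A) = emeasure M A"
    and Q: "Q \<in> sets borel" "emeasure lborel Q = 1"
    and A: "A \<in> sets borel"
  shows "emeasure M A = emeasure M Q * emeasure lborel A"
proof -
  interpret M: sigma_finite_measure M by fact
  interpret P: pair_sigma_finite M lborel by unfold_locales
  note [measurable_cong] = sets
  have sp: "space M = UNIV" using sets_eq_imp_space_eq[OF sets] by simp
  define Q' where "Q' = uminus -` Q"
  have Q'[measurable]: "Q' \<in> sets borel"
    using measurable_sets[of uminus borel borel Q] Q by (simp add: Q'_def)
  note [measurable] = Q(1)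
  have distr: "distr M borel (\<lambda>y. x + y) = M" for x
    by (rule measure_eqI) (use sets inv sp in \<open>auto simp: emeasure_distr\<close>)
  have *: "emeasure M B = emeasure lborel B * emeasure M Q'" if B[measurable]: "B \<in> sets borel" for B
  proof -
    have "emeasure M B = (\<integral>\<^sup>+x. indicator B x \<partial>M)" using B sets by simp
    also have "\<dots> = (\<integral>\<^sup>+x. (\<integral>\<^sup>+y. indicator B x * indicator Q (y - x) \<partial>lborel) \<partial>M)"
    proof (rule nn_integral_cong)
      fix x
      have "(\<integral>\<^sup>+y. indicator Q (y - x) \<partial>lborel) = (\<integral>\<^sup>+y. indicator Q y \<partial>distr lborel borel (\<lambda>y. -x + y))"
        by (subst nn_integral_distr) (auto simp: Q)
      also have "\<dots> = 1" by (subst lborel_distr_plus) (use Q in simp)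
      finally show "indicator B x = (\<integral>\<^sup>+y. indicator B x * indicator Q (y - x) \<partial>lborel)"
        by (subst nn_integral_cmult) auto
    qed
    also have "\<dots> = (\<integral>\<^sup>+y. (\<integral>\<^sup>+x. indicator B x * indicator Q (y - x) \<partial>M) \<partial>lborel)"
      by (rule P.Fubini'[symmetric]) measurable
    also have "\<dots> = (\<integral>\<^sup>+y. (\<integral>\<^sup>+x. indicator B (y + x) * indicator Q' x \<partial>M) \<partial>lborel)"
    proof (rule nn_integral_cong)
      fix y
      have "(\<integral>\<^sup>+x. indicator B x * indicator Q (y - x) \<partial>M)
          = (\<integral>\<^sup>+x. indicator B x * indicator Q (y - x) \<partial>distr M borel (\<lambda>x. y + x))"
        by (simp add: distr)
      also have "\<dots> = (\<integral>\<^sup>+x. indicator B (y + x) * indicator Q' x \<partial>M)"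
        by (subst nn_integral_distr) (auto simp: Q'_def indicator_def)
      finally show "(\<integral>\<^sup>+x. indicator B x * indicator Q (y - x) \<partial>M)
          = (\<integral>\<^sup>+x. indicator B (y + x) * indicator Q' x \<partial>M)" .
    qed
    also have "\<dots> = (\<integral>\<^sup>+x. (\<integral>\<^sup>+y. indicator B (y + x) * indicator Q' x \<partial>lborel) \<partial>M)"
      by (rule P.Fubini') measurable
    also have "\<dots> = (\<integral>\<^sup>+x. emeasure lborel B * indicator Q' x \<partial>M)"
    proof (rule nn_integral_cong)
      fix x
      have "(\<integral>\<^sup>+y. indicator B (y + x) \<partial>lborel) = (\<integral>\<^sup>+y. indicator B y \<partial>distr lborel borel (\<lambda>y. x + y))"
        by (subst nn_integral_distr) (auto simp: add.commute)
      also have "\<dots> = emeasure lborel B" by (subst lborel_distr_plus) simp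
      finally show "(\<integral>\<^sup>+y. indicator B (y + x) * indicator Q' x \<partial>lborel) = emeasure lborel B * indicator Q' x"
        by (subst nn_integral_multc) auto
    qed
    also have "\<dots> = emeasure lborel B * emeasure M Q'"
      by (subst nn_integral_cmult) (auto simp: sets)
    finally show ?thesis .
  qed
  show ?thesis using *[OF A] *[OF Q(1)] Q(2) by (simp add: mult.commute)
qed

definition hausdorff2_measure :: "'a::metric_space measure" where
  "hausdorff2_measure = measure_of UNIV (sets borel) hausdorff2"

lemma sets_hausdorff2_measure [simp, measurable_cong]: "sets hausdorff2_measure = sets borel"
  unfolding hausdorff2_measure_def using sets.sigma_sets_eq[of borel] by (simp add: sets_measure_of_conv)

lemma space_hausdorff2_measure [simp]: "space hausdorff2_measure = UNIV"
  by (simp add: hausdorff2_measure_def space_measure_of_conv)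

lemma emeasure_hausdorff2_measure:
  fixes A :: "'a::metric_space set"
  shows "A \<in> sets borel \<Longrightarrow> emeasure hausdorff2_measure A = hausdorff2 A"
  using measure_space_hausdorff2[where 'a = 'a] sets.sigma_sets_eq[of "borel :: 'a measure"]
  by (simp add: hausdorff2_measure_def emeasure_measure_of_conv)

text \<open>Large squares are Lipschitz images of the unit square.\<close>

lemma sigma_finite_hausdorff2_plane:
  "sigma_finite_measure (hausdorff2_measure :: (real \<times> real) measure)"
proof
  define A :: "nat \<Rightarrow> (real \<times> real) set" where
    "A n = {- real n - 1..real n + 1} \<times> {- real n - 1..real n + 1}" for n
  have fin: "emeasure hausdorff2_measure (A n) \<noteq> \<infinity>" for n
  proof -
    let ?L = "2 * real n + 2"
    let ?f = "\<lambda>x. (- real n - 1, - real n - 1) + ?L *\<^sub>R x"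
    have "A n \<subseteq> ?f ` unit_square"
    proof
      fix x assume x: "x \<in> A n"
      let ?y = "((fst x + real n + 1) / ?L, (snd x + real n + 1) / ?L)"
      have "x = ?f ?y" by (cases x) (simp add: field_simps)
      moreover have "?y \<in> unit_square" using x by (auto simp: A_def field_simps)
      ultimately show "x \<in> ?f ` unit_square" by blast
    qed
    then have "hausdorff2 (A n) \<le> hausdorff2 (?f ` unit_square)" by (rule hausdorff2_mono)
    also have "\<dots> \<le> ennreal (?L\<^sup>2) * hausdorff2 unit_square"
      by (rule hausdorff2_lipschitz_image) (auto simp: dist_norm simp flip: scaleR_diff_right)
    also have "\<dots> \<le> ennreal (?L\<^sup>2) * 2"
      by (intro mult_left_mono hausdorff2_unit_square_le) auto
    also have "\<dots> < \<infinity>" by (simp add: ennreal_mult_less_top)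
    finally have "hausdorff2 (A n) < \<infinity>" .
    moreover have "A n \<in> sets borel" unfolding A_def by (intro borel_closed closed_Times) auto
    ultimately show ?thesis by (simp add: emeasure_hausdorff2_measure)
  qed
  have U: "(\<Union>n. A n) = UNIV"
  proof -
    have "x \<in> (\<Union>n. A n)" for x
    proof -
      obtain n :: nat where "\<bar>fst x\<bar> + \<bar>snd x\<bar> \<le> real n" using real_arch_simple by blast
      then have "x \<in> A n" by (auto simp: A_def mem_Times_iff)
      then show ?thesis by blast
    qed
    then show ?thesis by blast
  qed
  show "\<exists>A::(real \<times> real) set set. countable A \<and> A \<subseteq> sets hausdorff2_measure \<and>
      \<Union> A = space hausdorff2_measure \<and> (\<forall>a\<in>A. emeasure hausdorff2_measure a \<noteq> \<infinity>)"
    by (rule exI[of _ "range A"]) (use fin U in \<open>auto simp: A_def intro!: borel_closed closed_Times\<close>)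
qed

lemma unit_square_borel [measurable]: "unit_square \<in> sets borel"
  by (intro borel_closed closed_Times) auto

lemma hausdorff2_translate:
  fixes A :: "'a::real_normed_vector set"
  shows "hausdorff2 ((\<lambda>y. x + y) -` A) = hausdorff2 A"
proof -
  have "(\<lambda>y. x + y) -` A = (\<lambda>y. - x + y) ` A" by (force simp: image_iff)
  also have "hausdorff2 \<dots> = hausdorff2 A"
    by (rule hausdorff2_isometric_image) (simp add: dist_norm)
  finally show ?thesis .
qed

text \<open>The constant is left unevaluated because it cancels in the area measure.\<close>

lemma hausdorff2_plane:
  fixes A :: "(real \<times> real) set"
  assumes A: "A \<in> sets borel"
  shows "hausdorff2 A = hausdorff2 unit_square * emeasure lborel A"
proof -
  have "emeasure hausdorff2_measure A = emeasure hausdorff2_measure unit_square * emeasure lborel A"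
  proof (rule translation_invariant_measure_eq[OF _ sigma_finite_hausdorff2_plane])
    fix x :: "real \<times> real" and B :: "(real \<times> real) set" assume B: "B \<in> sets borel"
    then have "(\<lambda>y. x + y) -` B \<in> sets borel"
      using measurable_sets[of "\<lambda>y. x + y" borel borel B] by simp
    with B show "emeasure hausdorff2_measure ((\<lambda>y. x + y) -` B) = emeasure hausdorff2_measure B"
      by (simp add: emeasure_hausdorff2_measure hausdorff2_translate)
  qed (use A in \<open>auto simp: emeasure_lborel_rectangle\<close>)
  then show ?thesis using A by (simp add: emeasure_hausdorff2_measure)
qed

lemma emeasure_lborel_diagonal_image:
  fixes A :: "(real \<times> real) set"
  assumes a: "0 < a" and b: "0 < b" and A: "A \<in> sets borel"
  shows "(\<lambda>p. (a * fst p, b * snd p)) ` A \<in> sets borel"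
    and "emeasure lborel ((\<lambda>p. (a * fst p, b * snd p)) ` A) = ennreal (a * b) * emeasure lborel A"
proof -
  let ?D = "\<lambda>p :: real \<times> real. (a * fst p, b * snd p)"
  let ?E = "\<lambda>p :: real \<times> real. (fst p / a, snd p / b)"
  have im: "?D ` B = ?E -` B" for B
    using a b by (force simp: image_iff prod_eq_iff)
  have E[measurable]: "?E \<in> borel_measurable borel" 
    by (intro borel_measurable_continuous_onI continuous_intros) (use a b in auto)
  have meas: "?D ` B \<in> sets borel" if "B \<in> sets borel" for B
    using measurable_sets[OF E that] by (simp add: im)
  then show "?D ` A \<in> sets borel" using A .
  let ?M = "distr lborel borel ?E"
  have em: "emeasure ?M B = emeasure lborel (?D ` B)" if "B \<in> sets borel" for B
    using that by (subst emeasure_distr) (auto simp: im)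
  have sq: "?D ` ({c..c+h} \<times> {d..d+h}) = {a*c..a*(c+h)} \<times> {b*d..b*(d+h)}" for c d h
    using a b by (auto simp: im field_simps)
  have "emeasure ?M A = emeasure ?M unit_square * emeasure lborel A"
  proof (rule translation_invariant_measure_eq)
    show "sigma_finite_measure ?M"
    proof
      let ?A = "\<lambda>n::nat. {- real n..- real n + 2 * real n} \<times> {- real n..- real n + 2 * real n}"
      have "x \<in> (\<Union>n. ?A n)" for x
      proof -
        obtain n :: nat where "\<bar>fst x\<bar> + \<bar>snd x\<bar> \<le> real n" using real_arch_simple by blast
        then have "x \<in> ?A n" by (auto simp: mem_Times_iff)
        then show ?thesis by blast
      qed
      then have U: "(\<Union>n. ?A n) = UNIV" by blast
      have bo: "?A n \<in> sets borel" for n by (intro borel_closed closed_Times) auto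
      have "emeasure ?M (?A n) \<noteq> \<infinity>" for n
        unfolding em[OF bo] sq using a b by (subst emeasure_lborel_rectangle) (auto intro!: mult_left_mono)
      then show "\<exists>A::(real \<times> real) set set. countable A \<and> A \<subseteq> sets ?M \<and>
          \<Union> A = space ?M \<and> (\<forall>a\<in>A. emeasure ?M a \<noteq> \<infinity>)"
        by (intro exI[of _ "range ?A"]) (use U bo in auto)
    qed
  next
    fix x :: "real \<times> real" and B :: "(real \<times> real) set" assume B: "B \<in> sets borel"
    have B': "(\<lambda>y. x + y) -` B \<in> sets borel"
      using measurable_sets[of "\<lambda>y. x + y" borel borel B] B by simp
    have "?D ` ((\<lambda>y. x + y) -` B) = (\<lambda>y. ?D x + y) -` (?D ` B)"
      using a b by (cases x) (auto simp: im add_divide_distrib)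
    then have "emeasure ?M ((\<lambda>y. x + y) -` B) = emeasure lborel ((\<lambda>y. ?D x + y) -` (?D ` B))"
      using em[OF B'] by simp
    also have "\<dots> = emeasure (distr lborel borel (\<lambda>y. ?D x + y)) (?D ` B)"
      using meas[OF B] by (subst emeasure_distr) auto
    also have "\<dots> = emeasure lborel (?D ` B)" by (simp add: lborel_distr_plus)
    finally show "emeasure ?M ((\<lambda>y. x + y) -` B) = emeasure ?M B" using em[OF B] by simp
  qed (use A in \<open>auto simp: emeasure_lborel_rectangle\<close>)
  moreover have "emeasure ?M unit_square = ennreal (a * b)"
    using em[OF unit_square_borel] sq[of 0 1 0] a b by (simp add: emeasure_lborel_rectangle)
  ultimately show "emeasure lborel (?D ` A) = ennreal (a * b) * emeasure lborel A"
    using em[OF A] by simp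
qed

lemma sets_area_measure [simp, measurable_cong]: "sets area_measure = sets borel"
  unfolding area_measure_def using sets.sigma_sets_eq[of borel] by (simp add: sets_measure_of_conv)

lemma space_area_measure [simp]: "space area_measure = UNIV"
  by (simp add: area_measure_def space_measure_of_conv)

lemma emeasure_area_measure:
  fixes A :: "'a::metric_space set"
  assumes "A \<in> sets borel"
  shows "emeasure area_measure A = hausdorff2 A / hausdorff2 unit_square"
proof -
  have "measure_space UNIV (sets borel) (\<lambda>A::'a set. hausdorff2 A / hausdorff2 unit_square)"
    using measure_space_hausdorff2[where 'a = 'a]
    by (simp add: measure_space_def positive_def countably_additive_def)
  then show ?thesis
    using sets.sigma_sets_eq[of "borel :: 'a measure"] assms
    by (simp add: area_measure_def emeasure_measure_of_conv hausdorff2_unit_square)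
qed

section \<open>The area formula\<close>

lemma ennreal_le_of_le_mult:
  fixes x y :: ennreal
  assumes "\<And>K. 1 < K \<Longrightarrow> x \<le> ennreal K * y"
  shows "x \<le> y"
proof (cases "y = top")
  case False
  then obtain r where r: "y = ennreal r" "0 \<le> r" by (cases y) auto
  show ?thesis
  proof (rule ennreal_le_epsilon)
    fix e :: real assume e: "0 < e"
    have "x \<le> ennreal (1 + e / (r + 1)) * y"
      using e r(2) by (intro assms) (simp add: field_simps)
    also have "\<dots> = ennreal ((1 + e / (r + 1)) * r)"
      using e r by (simp add: ennreal_mult)
    also have "\<dots> \<le> ennreal (r + e)"
      using e r(2) by (intro ennreal_leI) (simp add: field_simps)
    finally show "x \<le> y + ennreal e" using e r by simp
  qed
qed auto

text \<open>By Lindelof's theorem countably many comparison neighbourhoods suffice; cut into disjoint pieces,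
  they give the comparison globally, and the factor \<open>K\<close> is arbitrarily close to 1.\<close>

lemma measure_eq_of_locally_comparable:
  fixes M N :: "'a::second_countable_topology measure"
  assumes sets: "sets M = sets borel" "sets N = sets borel"
    and U: "open U" "emeasure M (- U) = 0" "emeasure N (- U) = 0"
    and loc: "\<And>K p. 1 < K \<Longrightarrow> p \<in> U \<Longrightarrow> \<exists>V. open V \<and> p \<in> V \<and> (\<forall>E\<in>sets borel. E \<subseteq> V \<inter> U \<longrightarrow>
       emeasure M E \<le> ennreal K * emeasure N E \<and> emeasure N E \<le> ennreal K * emeasure M E)"
  shows "M = N"
proof (rule measure_eqI)
  show "sets M = sets N" using sets by simp
  fix A assume "A \<in> sets M"
  then have A: "A \<in> sets borel" by (simp add: sets)
  have *: "emeasure M A \<le> ennreal K * emeasure N A \<and> emeasure N A \<le> ennreal K * emeasure M A"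
    if K: "1 < K" for K
  proof -
    obtain V where V: "\<And>p. p \<in> U \<Longrightarrow> open (V p) \<and> p \<in> V p \<and> (\<forall>E\<in>sets borel. E \<subseteq> V p \<inter> U \<longrightarrow>
       emeasure M E \<le> ennreal K * emeasure N E \<and> emeasure N E \<le> ennreal K * emeasure M E)"
      using loc[OF K] by metis
    obtain F where F: "F \<subseteq> V ` U" "countable F" "\<Union>F = \<Union>(V ` U)"
      by (rule Lindelof[of "V ` U"]) (use V in auto)
    define G where "G = from_nat_into (insert {} F)"
    have rG: "range G = insert {} F" unfolding G_def using F(2) by (intro range_from_nat_into) auto
    define D where "D n = disjointed G n \<inter> U \<inter> A" for n
    have "G n \<in> sets borel" for n
    proof -
      have "G n \<in> insert {} F" using rG by blast
      then have "open (G n)" using F(1) V by auto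
      then show ?thesis by simp
    qed
    then have "range G \<subseteq> sets borel" by blast
    then have "disjointed G n \<in> sets borel" for n
      using sets.range_disjointed_sets[of G borel] by blast
    then have D: "D n \<in> sets borel" for n using A U(1) by (auto simp: D_def)
    have dD: "disjoint_family D"
      using disjoint_family_disjointed[of G] by (auto simp: disjoint_family_on_def D_def)
    have "U \<subseteq> (\<Union>n. G n)" using rG F(3) V by auto
    then have UD: "(\<Union>n. D n) = A \<inter> U"
      using UN_disjointed_eq[of G] by (auto simp: D_def)
    have cmp: "emeasure M (D n) \<le> ennreal K * emeasure N (D n) \<and> emeasure N (D n) \<le> ennreal K * emeasure M (D n)" for n
    proof (cases "D n = {}")
      case False
      have "D n \<subseteq> G n \<inter> U" using disjointed_subset[of G n] by (auto simp: D_def)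
      moreover have "G n \<in> insert {} F" using rG by blast
      ultimately have "G n \<in> V ` U" using F(1) False by auto
      then obtain p where "p \<in> U" "D n \<subseteq> V p \<inter> U" using \<open>D n \<subseteq> G n \<inter> U\<close> by auto
      then show ?thesis using V D by blast
    qed auto
    have split: "emeasure L A = (\<Sum>n. emeasure L (D n))" if L: "sets L = sets borel" "emeasure L (- U) = 0" for L
    proof -
      have "emeasure L A = emeasure L (A \<inter> U) + emeasure L (A - U)"
        using A U(1) L by (subst plus_emeasure) (auto intro!: arg_cong2[where f = emeasure])
      moreover have "emeasure L (A - U) \<le> emeasure L (- U)"
        using U(1) L by (intro emeasure_mono) auto
      ultimately have "emeasure L A = emeasure L (\<Union>n. D n)" using L UD by simp
      also have "\<dots> = (\<Sum>n. emeasure L (D n))"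
        using D dD L by (intro suminf_emeasure[symmetric]) auto
      finally show ?thesis .
    qed
    note sM = split[OF sets(1) U(2)] and sN = split[OF sets(2) U(3)]
    show ?thesis
      unfolding sM sN using cmp by (auto simp flip: ennreal_suminf_cmult intro!: suminf_le)
  qed
  show "emeasure M A = emeasure N A"
    by (rule antisym[OF ennreal_le_of_le_mult ennreal_le_of_le_mult]) (use * in blast)+
qed

text \<open>An open set is a countable union of compact sets, so relatively closed subsets have Borel images;
  injectivity carries this through complements.\<close>

lemma borel_injective_image:
  fixes f :: "'a::euclidean_space \<Rightarrow> 'b::t2_space"
  assumes U: "open U" and f: "continuous_on U f" "inj_on f U" and E: "E \<in> sets borel" "E \<subseteq> U"
  shows "f ` E \<in> sets borel"
proof -
  have comp: "f ` (U \<inter> C) \<in> sets borel" if C: "closed C" for C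
  proof -
    obtain K where K: "\<And>n::nat. compact (K n)" "(\<Union>n. K n) = U"
    proof -
      from open_Union_compact_subsets[OF U] obtain D where
        "\<And>n. compact (D n)" "\<And>n. D n \<subseteq> U" "\<And>n. D n \<subseteq> interior (D (Suc n))" "\<Union> (range D) = U"
        by metis
      then show ?thesis using that by blast
    qed
    have "f ` (U \<inter> C) = (\<Union>n. f ` (K n \<inter> C))" using K(2) by blast
    moreover have "compact (f ` (K n \<inter> C))" for n
    proof (rule compact_continuous_image)
      show "continuous_on (K n \<inter> C) f"
        by (rule continuous_on_subset[OF f(1)]) (use K(2) in auto)
      show "compact (K n \<inter> C)" using K(1) C by blast
    qed
    moreover have "(\<Union>n. f ` (K n \<inter> C)) \<in> sets borel"
      by (rule sets.countable_UN) (use calculation(2) in \<open>auto intro: borel_closed compact_imp_closed\<close>)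
    ultimately show ?thesis by simp
  qed
  have "E \<in> sigma_sets UNIV (Collect closed)"
    using E(1) by (simp add: borel_eq_closed sets_measure_of_conv)
  then have "f ` (U \<inter> E) \<in> sets borel"
  proof induction
    case (Basic a) then show ?case using comp by auto
  next
    case (Compl a)
    have "f ` (U \<inter> (UNIV - a)) = f ` (U \<inter> UNIV) - f ` (U \<inter> a)"
      using f(2) by (auto simp: inj_on_def)
    then show ?case using Compl comp[of UNIV] by (metis closed_UNIV sets.Diff)
  next
    case (Union a)
    have "f ` (U \<inter> \<Union> (range a)) = (\<Union>i. f ` (U \<inter> a i))" by blast
    then show ?case using Union by auto
  qed auto
  moreover have "U \<inter> E = E" using E(2) by blast
  ultimately show ?thesis by simp
qed

text \<open>Near \<open>p\<close> the parametrisation differs from the diagonal map with entries \<open>\<alpha> p\<close> and \<open>\<beta> p\<close> by a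
  bi-Lipschitz map with constants close to 1. So the image measure and the measure with density
  \<open>\<alpha> \<beta>\<close> are locally comparable with a factor close to 1, hence equal.\<close>

theorem area_formula_orthogonal_coordinates:
  fixes X :: "real \<times> real \<Rightarrow> 'a::metric_space" and \<alpha> \<beta> :: "real \<times> real \<Rightarrow> real"
  assumes U: "open U" and inj: "inj_on X U"
    and cont: "continuous_on U \<alpha>" "continuous_on U \<beta>"
    and pos: "\<And>p. p \<in> U \<Longrightarrow> 0 < \<alpha> p" "\<And>p. p \<in> U \<Longrightarrow> 0 < \<beta> p"
    and metric: "\<And>p K. p \<in> U \<Longrightarrow> 1 < K \<Longrightarrow> \<exists>V. open V \<and> p \<in> V \<and> (\<forall>x\<in>V \<inter> U. \<forall>y\<in>V \<inter> U.
       (let l = sqrt ((\<alpha> p * (fst x - fst y))\<^sup>2 + (\<beta> p * (snd x - snd y))\<^sup>2) in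
         dist (X x) (X y) \<le> K * l \<and> l \<le> K * dist (X x) (X y)))"
    and E: "E \<in> sets borel" "E \<subseteq> U"
  shows "X ` E \<in> sets borel"
    and "emeasure area_measure (X ` E) = (\<integral>\<^sup>+x\<in>E. ennreal (\<alpha> x * \<beta> x) \<partial>lborel)"
proof -
  define c where "c = hausdorff2 unit_square"
  have c0: "c \<noteq> 0" using hausdorff2_unit_square_ge by (auto simp: c_def)
  have ct: "c \<noteq> top" using hausdorff2_unit_square_le by (auto simp: c_def top_unique)
  have contX: "continuous_on U X"
    unfolding continuous_on_eq_continuous_at[OF U]
  proof
    fix p assume p: "p \<in> U"
    from metric[OF p, of 2] obtain V where V: "open V" "p \<in> V"
      "\<And>x y. x \<in> V \<inter> U \<Longrightarrow> y \<in> V \<inter> U \<Longrightarrow> dist (X x) (X y) \<le>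
        2 * sqrt ((\<alpha> p * (fst x - fst y))\<^sup>2 + (\<beta> p * (snd x - snd y))\<^sup>2)"
      unfolding Let_def by (metis one_less_numeral_iff semiring_norm(76))
    have "((\<lambda>x. dist (X x) (X p)) \<longlongrightarrow> 0) (at p)"
    proof (rule Lim_null_comparison)
      show "\<forall>\<^sub>F x in at p. norm (dist (X x) (X p)) \<le>
          2 * sqrt ((\<alpha> p * (fst x - fst p))\<^sup>2 + (\<beta> p * (snd x - snd p))\<^sup>2)"
        unfolding eventually_at_topological
        using V p U by (intro exI[of _ "V \<inter> U"]) auto
      have "((\<lambda>x. 2 * sqrt ((\<alpha> p * (fst x - fst p))\<^sup>2 + (\<beta> p * (snd x - snd p))\<^sup>2)) \<longlongrightarrow>
         2 * sqrt ((\<alpha> p * (fst p - fst p))\<^sup>2 + (\<beta> p * (snd p - snd p))\<^sup>2)) (at p)"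
        by (intro tendsto_intros)
      then show "((\<lambda>x. 2 * sqrt ((\<alpha> p * (fst x - fst p))\<^sup>2 + (\<beta> p * (snd x - snd p))\<^sup>2)) \<longlongrightarrow> 0) (at p)"
        by simp
    qed
    then show "isCont X p" unfolding isCont_def using tendsto_dist_iff by blast
  qed
  have im: "X ` B \<in> sets borel" if "B \<in> sets borel" "B \<subseteq> U" for B
    using borel_injective_image[OF U contX inj that] .
  then show "X ` E \<in> sets borel" using E .
  have cab: "continuous_on U (\<lambda>x. \<alpha> x * \<beta> x)" by (intro continuous_intros cont)
  define J where "J x = (if x \<in> U then ennreal (\<alpha> x * \<beta> x) else 0)" for x
  have J[measurable]: "J \<in> borel_measurable borel"
  proof -
    have "(\<lambda>x. indicator U x *\<^sub>R (\<alpha> x * \<beta> x)) \<in> borel_measurable borel"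
      using U cab by (intro borel_measurable_continuous_on_indicator) auto
    then have "(\<lambda>x. ennreal (indicator U x *\<^sub>R (\<alpha> x * \<beta> x))) \<in> borel_measurable borel"
      by measurable
    also have "(\<lambda>x. ennreal (indicator U x *\<^sub>R (\<alpha> x * \<beta> x))) = J"
      by (auto simp: J_def indicator_def)
    finally show ?thesis .
  qed
  define N where "N = density lborel J"
  define M where "M = measure_of UNIV (sets borel) (\<lambda>A. emeasure area_measure (X ` (A \<inter> U)))"
  have ms: "measure_space UNIV (sets borel) (\<lambda>A. emeasure area_measure (X ` (A \<inter> U)))"
    unfolding measure_space_def
  proof (intro conjI)
    show "sigma_algebra UNIV (sets (borel :: (real \<times> real) measure))"
      using sets.sigma_algebra_axioms[of "borel :: (real \<times> real) measure"] by simp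
    show "countably_additive (sets borel) (\<lambda>A. emeasure area_measure (X ` (A \<inter> U)))"
    proof (rule countably_additiveI)
      fix A :: "nat \<Rightarrow> (real \<times> real) set"
      assume A: "range A \<subseteq> sets borel" "disjoint_family A"
      have "(\<Sum>i. emeasure area_measure (X ` (A i \<inter> U))) = emeasure area_measure (\<Union>i. X ` (A i \<inter> U))"
      proof (rule suminf_emeasure)
        show "range (\<lambda>i. X ` (A i \<inter> U)) \<subseteq> sets area_measure"
          using A(1) U by (auto intro!: im)
        show "disjoint_family (\<lambda>i. X ` (A i \<inter> U))"
          unfolding disjoint_family_on_def
        proof (intro ballI impI)
          fix m n :: nat assume "m \<noteq> n"
          then have "A m \<inter> A n = {}" using A(2) by (auto simp: disjoint_family_on_def)
          then have "(A m \<inter> U) \<inter> (A n \<inter> U) = {}" by blast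
          then show "X ` (A m \<inter> U) \<inter> X ` (A n \<inter> U) = {}"
            using inj_on_image_Int[OF inj, of "A m \<inter> U" "A n \<inter> U"] by simp
        qed
      qed
      also have "(\<Union>i. X ` (A i \<inter> U)) = X ` ((\<Union>i. A i) \<inter> U)" by blast
      finally show "(\<Sum>i. emeasure area_measure (X ` (A i \<inter> U))) = emeasure area_measure (X ` ((\<Union>i. A i) \<inter> U))" .
    qed
  qed (simp add: positive_def)
  have sM: "sets M = sets borel"
    unfolding M_def using sets.sigma_sets_eq[of "borel :: (real \<times> real) measure"] by (simp add: sets_measure_of_conv)
  have eM: "emeasure M A = emeasure area_measure (X ` (A \<inter> U))" if "A \<in> sets borel" for A
    using that ms sets.sigma_sets_eq[of "borel :: (real \<times> real) measure"] by (simp add: M_def emeasure_measure_of_conv)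
  have "M = N"
  proof (rule measure_eq_of_locally_comparable[where U = U])
    show "sets M = sets borel" "sets N = sets borel" by (simp_all add: sM N_def)
    show "open U" by fact
    have "- U \<in> sets borel" using U by auto
    moreover have "(\<lambda>x. J x * indicator (- U) x) = (\<lambda>_. 0)" by (auto simp: J_def indicator_def)
    ultimately show "emeasure M (- U) = 0" "emeasure N (- U) = 0"
      by (simp_all add: eM N_def emeasure_density)
    fix K :: real and p assume K: "1 < K" and p: "p \<in> U"
    \<comment> \<open>The metric contributes two factors \<open>k\<close>, the variation of the density a third one.\<close>
    define k where "k = root 3 K"
    have k: "1 < k" "k ^ 3 = K" using K by (simp_all add: k_def)
    from metric[OF p k(1)] obtain V where V: "open V" "p \<in> V"
      "\<And>x y. x \<in> V \<inter> U \<Longrightarrow> y \<in> V \<inter> U \<Longrightarrow> dist (X x) (X y) \<le>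
        k * sqrt ((\<alpha> p * (fst x - fst y))\<^sup>2 + (\<beta> p * (snd x - snd y))\<^sup>2)"
      "\<And>x y. x \<in> V \<inter> U \<Longrightarrow> y \<in> V \<inter> U \<Longrightarrow>
        sqrt ((\<alpha> p * (fst x - fst y))\<^sup>2 + (\<beta> p * (snd x - snd y))\<^sup>2) \<le> k * dist (X x) (X y)"
      unfolding Let_def by blast
    define j where "j = \<alpha> p * \<beta> p"
    have j: "0 < j" using pos p by (simp add: j_def)
    obtain W where W: "open W" "p \<in> W" "\<And>x. x \<in> W \<inter> U \<Longrightarrow> \<alpha> x * \<beta> x \<in> {j / k<..<k * j}"
    proof -
      have "openin (top_of_set U) (U \<inter> (\<lambda>x. \<alpha> x * \<beta> x) -` {j / k<..<k * j})"
        using cab by (intro continuous_openin_preimage_gen) auto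
      then obtain W where "open W" "U \<inter> (\<lambda>x. \<alpha> x * \<beta> x) -` {j / k<..<k * j} = U \<inter> W"
        unfolding openin_open by blast
      moreover have "p \<in> U \<inter> (\<lambda>x. \<alpha> x * \<beta> x) -` {j / k<..<k * j}"
        using j k p by (simp add: j_def[symmetric] field_simps)
      ultimately show ?thesis using that[of W] by blast
    qed
    let ?D = "\<lambda>x. (\<alpha> p * fst x, \<beta> p * snd x)"
    have dD: "dist (?D x) (?D y) = sqrt ((\<alpha> p * (fst x - fst y))\<^sup>2 + (\<beta> p * (snd x - snd y))\<^sup>2)" for x y
      by (simp add: dist_prod_def dist_real_def right_diff_distrib)
    have main: "emeasure M B \<le> ennreal K * emeasure N B \<and> emeasure N B \<le> ennreal K * emeasure M B"
      if B: "B \<in> sets borel" "B \<subseteq> (V \<inter> W) \<inter> U" for B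
    proof -
      define H where "H = hausdorff2 (X ` B)"
      define l where "l = emeasure lborel B"
      have HD: "hausdorff2 (?D ` B) = c * (ennreal j * l)"
        unfolding c_def j_def l_def
        using hausdorff2_plane[OF emeasure_lborel_diagonal_image(1)[OF pos(1)[OF p] pos(2)[OF p] B(1)]]
        by (simp only: emeasure_lborel_diagonal_image(2)[OF pos(1)[OF p] pos(2)[OF p] B(1)])
      have injD: "inj_on ?D B"
        using pos[OF p] by (auto simp: inj_on_def prod_eq_iff)
      have injX: "inj_on X B" using inj B(2) by (meson inj_on_subset le_infE)
      have "(\<lambda>q. X (inv_into B ?D q)) ` (?D ` B) = X ` B"
        unfolding image_image by (intro image_cong refl) (simp only: inv_into_f_f[OF injD])
      moreover have "hausdorff2 ((\<lambda>q. X (inv_into B ?D q)) ` (?D ` B)) \<le> ennreal (k\<^sup>2) * hausdorff2 (?D ` B)"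
      proof (rule hausdorff2_lipschitz_image)
        fix u v assume "u \<in> ?D ` B" "v \<in> ?D ` B"
        then obtain x y where xy: "x \<in> B" "y \<in> B" "u = ?D x" "v = ?D y" by blast
        have "dist (X (inv_into B ?D u)) (X (inv_into B ?D v)) = dist (X x) (X y)"
          unfolding xy(3,4) inv_into_f_f[OF injD xy(1)] inv_into_f_f[OF injD xy(2)] ..
        also have "\<dots> \<le> k * dist u v" unfolding xy dD using B(2) xy by (intro V(3)) auto
        finally show "dist (X (inv_into B ?D u)) (X (inv_into B ?D v)) \<le> k * dist u v" .
      qed (use k in simp)
      ultimately have 1: "H \<le> ennreal (k\<^sup>2) * (c * (ennreal j * l))" by (simp add: HD H_def)
      have "(\<lambda>q. ?D (inv_into B X q)) ` (X ` B) = ?D ` B"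
        unfolding image_image by (intro image_cong refl) (simp only: inv_into_f_f[OF injX])
      moreover have "hausdorff2 ((\<lambda>q. ?D (inv_into B X q)) ` (X ` B)) \<le> ennreal (k\<^sup>2) * hausdorff2 (X ` B)"
      proof (rule hausdorff2_lipschitz_image)
        fix u v assume "u \<in> X ` B" "v \<in> X ` B"
        then obtain x y where xy: "x \<in> B" "y \<in> B" "u = X x" "v = X y" by blast
        have "dist (?D (inv_into B X u)) (?D (inv_into B X v)) = dist (?D x) (?D y)"
          unfolding xy(3,4) inv_into_f_f[OF injX xy(1)] inv_into_f_f[OF injX xy(2)] ..
        also have "\<dots> \<le> k * dist u v" unfolding xy dD using B(2) xy by (intro V(4)) auto
        finally show "dist (?D (inv_into B X u)) (?D (inv_into B X v)) \<le> k * dist u v" .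
      qed (use k in simp)
      ultimately have 2: "c * (ennreal j * l) \<le> ennreal (k\<^sup>2) * H" by (simp add: HD H_def)
      have MB: "emeasure M B = H / c"
        using B im[of B] by (simp add: eM Int_absorb2 emeasure_area_measure H_def c_def)
      have cc: "c * x / c = x" for x :: ennreal
        using c0 ct by (simp add: mult.commute[of c] mult_divide_eq_ennreal)
      have M1: "emeasure M B \<le> ennreal (k\<^sup>2) * (ennreal j * l)"
      proof -
        have "H / c \<le> (c * (ennreal (k\<^sup>2) * (ennreal j * l))) / c"
          using 1 by (intro divide_right_mono_ennreal) (simp add: mult_ac)
        then show ?thesis by (simp add: MB cc)
      qed
      have M2: "ennreal j * l \<le> ennreal (k\<^sup>2) * emeasure M B"
      proof -
        have "(c * (ennreal j * l)) / c \<le> (ennreal (k\<^sup>2) * H) / c"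
          using 2 by (intro divide_right_mono_ennreal)
        then show ?thesis by (simp add: MB cc ennreal_times_divide)
      qed
      have NB: "emeasure N B = (\<integral>\<^sup>+x\<in>B. J x \<partial>lborel)" using B by (simp add: N_def emeasure_density)
      have const: "(\<integral>\<^sup>+x\<in>B. ennreal r \<partial>lborel) = ennreal r * l" for r
        using B by (simp add: l_def nn_integral_cmult_indicator)
      have N1: "ennreal j * l \<le> ennreal k * emeasure N B"
      proof -
        have "ennreal j * l = (\<integral>\<^sup>+x\<in>B. ennreal j \<partial>lborel)" by (simp add: const)
        also have "\<dots> \<le> (\<integral>\<^sup>+x. ennreal k * (J x * indicator B x) \<partial>lborel)"
        proof (rule nn_integral_mono)
          fix x
          have "ennreal j \<le> ennreal k * J x" if "x \<in> B"
          proof -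
            have "x \<in> W \<inter> U" using that B(2) by blast
            from W(3)[OF this] have "j \<le> k * (\<alpha> x * \<beta> x)" using k by (simp add: field_simps)
            then show ?thesis using \<open>x \<in> W \<inter> U\<close> k pos[of x]
              by (simp add: J_def ennreal_mult[symmetric] ennreal_leI less_imp_le)
          qed
          then show "ennreal j * indicator B x \<le> ennreal k * (J x * indicator B x)"
            by (auto simp: indicator_def)
        qed
        also have "\<dots> = ennreal k * emeasure N B" using B by (simp add: NB nn_integral_cmult)
        finally show ?thesis .
      qed
      have N2: "emeasure N B \<le> ennreal k * (ennreal j * l)"
      proof -
        have "emeasure N B \<le> (\<integral>\<^sup>+x\<in>B. ennreal (k * j) \<partial>lborel)"
          unfolding NB
        proof (rule nn_integral_mono)
          fix x
          have "J x \<le> ennreal (k * j)" if "x \<in> B"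
          proof -
            have "x \<in> W \<inter> U" using that B(2) by blast
            from W(3)[OF this] show ?thesis using \<open>x \<in> W \<inter> U\<close>
              by (simp add: J_def ennreal_leI less_imp_le)
          qed
          then show "J x * indicator B x \<le> ennreal (k * j) * indicator B x"
            by (auto simp: indicator_def)
        qed
        also have "\<dots> = ennreal k * (ennreal j * l)"
          unfolding const using k j by (simp add: ennreal_mult mult.assoc)
        finally show ?thesis .
      qed
      have k3: "ennreal (k\<^sup>2) * (ennreal k * x) = ennreal K * x" "ennreal k * (ennreal (k\<^sup>2) * x) = ennreal K * x" for x
        using k by (simp_all add: ennreal_mult[symmetric] mult.assoc[symmetric] power3_eq_cube power2_eq_square flip: k(2))
      have "emeasure M B \<le> ennreal (k\<^sup>2) * (ennreal k * emeasure N B)"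
        using M1 N1 by (meson mult_left_mono order_trans zero_le)
      moreover have "emeasure N B \<le> ennreal k * (ennreal (k\<^sup>2) * emeasure M B)"
        using M2 N2 by (meson mult_left_mono order_trans zero_le)
      ultimately show ?thesis by (simp add: k3)
    qed
    show "\<exists>V. open V \<and> p \<in> V \<and> (\<forall>E\<in>sets borel. E \<subseteq> V \<inter> U \<longrightarrow>
       emeasure M E \<le> ennreal K * emeasure N E \<and> emeasure N E \<le> ennreal K * emeasure M E)"
      by (rule exI[of _ "V \<inter> W"]) (use V(1,2) W(1,2) main in blast)
  qed
  then have "emeasure area_measure (X ` E) = emeasure N E"
    using eM[OF E(1)] E(2) by (simp add: Int_absorb2)
  also have "\<dots> = (\<integral>\<^sup>+x\<in>E. J x \<partial>lborel)" using E by (simp add: N_def emeasure_density)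
  also have "\<dots> = (\<integral>\<^sup>+x\<in>E. ennreal (\<alpha> x * \<beta> x) \<partial>lborel)"
    using E(2) by (intro nn_integral_cong) (auto simp: J_def indicator_def)
  finally show "emeasure area_measure (X ` E) = (\<integral>\<^sup>+x\<in>E. ennreal (\<alpha> x * \<beta> x) \<partial>lborel)" .
qed

section \<open>Coordinates of revolution\<close>

text \<open>The factor \<open>1 / 2\<close> is that of the Taylor expansions of \<open>cosh\<close> and \<open>cos\<close>, the only cases of use.\<close>

lemma comparable_to_half_square:
  fixes g :: "real \<Rightarrow> real"
  assumes g: "((\<lambda>x. g x / x\<^sup>2) \<longlongrightarrow> 1 / 2) (at 0)" "g 0 = 0" and k: "1 < k"
  obtains r where "0 < r" "\<And>x. \<bar>x\<bar> < r \<Longrightarrow> g x \<le> k * (x\<^sup>2 / 2)" "\<And>x. \<bar>x\<bar> < r \<Longrightarrow> x\<^sup>2 / 2 \<le> k * g x"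
proof -
  have "eventually (\<lambda>x. g x / x\<^sup>2 \<in> {1 / (2 * k)<..<k / 2}) (at 0)"
    using g(1) by (rule topological_tendstoD) (use k in \<open>auto simp: field_simps\<close>)
  then obtain r where r: "0 < r" "\<And>x. x \<noteq> 0 \<Longrightarrow> \<bar>x\<bar> < r \<Longrightarrow> g x / x\<^sup>2 \<in> {1 / (2 * k)<..<k / 2}"
    unfolding eventually_at by (auto simp: dist_real_def)
  show ?thesis
  proof (rule that[OF r(1)])
    fix x :: real assume x: "\<bar>x\<bar> < r"
    show "g x \<le> k * (x\<^sup>2 / 2)"
    proof (cases "x = 0")
      case False
      then have "g x / x\<^sup>2 \<le> k / 2" using r(2)[OF False x] by simp
      then show ?thesis using False by (simp add: field_simps)
    qed (use g in simp)
    show "x\<^sup>2 / 2 \<le> k * g x"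
    proof (cases "x = 0")
      case False
      then have "1 / (2 * k) \<le> g x / x\<^sup>2" using r(2)[OF False x] by simp
      then show ?thesis using False k by (simp add: field_simps)
    qed (use g in simp)
  qed
qed

lemma cosh_half_square_limit: "((\<lambda>x::real. (cosh x - 1) / x\<^sup>2) \<longlongrightarrow> 1 / 2) (at 0)"
  by real_asymp

lemma cos_half_square_limit: "((\<lambda>x::real. (1 - cos x) / x\<^sup>2) \<longlongrightarrow> 1 / 2) (at 0)"
  by real_asymp

lemma half_square_le_cosh: "x\<^sup>2 / 2 \<le> cosh x - 1" for x :: real
proof -
  have "(\<bar>x\<bar> / 2) \<le> sinh (\<bar>x\<bar> / 2)"
    using real_le_x_sinh[of "\<bar>x\<bar> / 2"] by (simp add: sinh_def exp_minus)
  then have "(\<bar>x\<bar> / 2)\<^sup>2 \<le> (sinh (\<bar>x\<bar> / 2))\<^sup>2" by (intro power_mono) auto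
  moreover have "cosh x = 1 + 2 * (sinh (\<bar>x\<bar> / 2))\<^sup>2"
    using cosh_add[of "\<bar>x\<bar> / 2" "\<bar>x\<bar> / 2"] cosh_square_eq[of "\<bar>x\<bar> / 2"]
    by (simp add: power2_eq_square)
  ultimately show ?thesis by (simp add: power_divide)
qed

text \<open>Coordinates \<open>(u, \<phi>)\<close> on a surface of revolution whose profile is an orbit of a one-parameter group
  of isometries: a circle if \<open>G x = 1 - cos x\<close>, a geodesic or an equidistant curve if
  \<open>G x = cosh x - 1\<close>. Then the distance has the closed form \<open>law\<close>. The number \<open>v\<close> is the speed of the
  profile, and \<open>\<rho> u\<close> is the radius of the parallel circle, with metric \<open>v\<^sup>2 du\<^sup>2 + \<rho>\<^sup>2 d\<phi>\<^sup>2\<close>.\<close>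

locale rotation_coordinates =
  fixes X :: "real \<times> real \<Rightarrow> 'a::metric_space" and G \<rho> :: "real \<Rightarrow> real" and v a b :: real
  assumes law: "cosh (dist (X x) (X y)) =
      1 + v\<^sup>2 * G (fst x - fst y) + \<rho> (fst x) * \<rho> (fst y) * (1 - cos (snd x - snd y))"
    and v: "0 < v"
    and G: "continuous_on UNIV G" "((\<lambda>x. G x / x\<^sup>2) \<longlongrightarrow> 1 / 2) (at 0)" "\<And>x. 0 \<le> G x" "G 0 = 0"
    and G_eq_0: "\<And>x. G x = 0 \<Longrightarrow> \<bar>x\<bar> < b - a \<Longrightarrow> x = 0"
    and \<rho>: "continuous_on UNIV \<rho>" "\<And>u. a < u \<Longrightarrow> u < b \<Longrightarrow> 0 < \<rho> u"
begin

lemma continuous_X: "continuous_on UNIV X"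
proof (rule continuous_at_imp_continuous_on, rule ballI)
  fix p
  have "((\<lambda>x. sqrt (2 * (v\<^sup>2 * G (fst x - fst p) + \<rho> (fst x) * \<rho> (fst p) * (1 - cos (snd x - snd p)))))
      \<longlongrightarrow> sqrt (2 * (v\<^sup>2 * G (fst p - fst p) + \<rho> (fst p) * \<rho> (fst p) * (1 - cos (snd p - snd p))))) (at p)"
  proof (intro tendsto_intros)
    show "((\<lambda>x. G (fst x - fst p)) \<longlongrightarrow> G (fst p - fst p)) (at p)"
      by (rule continuous_on_tendsto_compose[OF G(1)]) (intro tendsto_intros, simp, simp)
    show "((\<lambda>x. \<rho> (fst x)) \<longlongrightarrow> \<rho> (fst p)) (at p)"
      by (rule continuous_on_tendsto_compose[OF \<rho>(1)]) (intro tendsto_intros, simp, simp)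
  qed
  then have lim: "((\<lambda>x. sqrt (2 * (v\<^sup>2 * G (fst x - fst p) + \<rho> (fst x) * \<rho> (fst p) * (1 - cos (snd x - snd p)))))
      \<longlongrightarrow> 0) (at p)" by (simp add: G(4))
  have "((\<lambda>x. dist (X x) (X p)) \<longlongrightarrow> 0) (at p)"
  proof (rule Lim_null_comparison[OF _ lim], rule always_eventually, rule allI)
    fix x
    have "(dist (X x) (X p))\<^sup>2 \<le> 2 * (v\<^sup>2 * G (fst x - fst p) + \<rho> (fst x) * \<rho> (fst p) * (1 - cos (snd x - snd p)))"
      using half_square_le_cosh[of "dist (X x) (X p)"] law[of x p] by simp
    then show "norm (dist (X x) (X p)) \<le>
        sqrt (2 * (v\<^sup>2 * G (fst x - fst p) + \<rho> (fst x) * \<rho> (fst p) * (1 - cos (snd x - snd p))))"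
      by (simp add: real_le_rsqrt)
  qed
  then show "isCont X p" unfolding isCont_def using tendsto_dist_iff by blast
qed

lemma measurable_X [measurable]: "X \<in> borel_measurable borel"
  by (rule borel_measurable_continuous_onI[OF continuous_X])

text \<open>The starting angle is free so that the meridian at angle 0, on the edge of one strip, lies inside
  another one.\<close>

definition strip :: "real \<Rightarrow> (real \<times> real) set" where
  "strip \<phi> = {a<..<b} \<times> {\<phi><..<\<phi> + 2 * pi}"

lemma open_strip: "open (strip \<phi>)" unfolding strip_def by (intro open_Times) auto

lemma strip_borel [measurable]: "strip \<phi> \<in> sets borel" using open_strip by simp

lemma inj_on_strip: "inj_on X (strip \<phi>)"
proof (rule inj_onI)
  fix x y assume xy: "x \<in> strip \<phi>" "y \<in> strip \<phi>" "X x = X y"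
  have p: "0 < \<rho> (fst x) * \<rho> (fst y)" using xy \<rho>(2) by (auto simp: strip_def)
  have "v\<^sup>2 * G (fst x - fst y) + \<rho> (fst x) * \<rho> (fst y) * (1 - cos (snd x - snd y)) = 0"
    using law[of x y] xy(3) by simp
  moreover have "0 \<le> v\<^sup>2 * G (fst x - fst y)" using G(3) by simp
  moreover have "0 \<le> \<rho> (fst x) * \<rho> (fst y) * (1 - cos (snd x - snd y))"
    using p by simp
  ultimately have "v\<^sup>2 * G (fst x - fst y) = 0" "\<rho> (fst x) * \<rho> (fst y) * (1 - cos (snd x - snd y)) = 0"
    by linarith+
  then have 0: "G (fst x - fst y) = 0" "cos (snd x - snd y) = 1" using v p by auto
  then obtain n :: int where n: "snd x - snd y = of_int n * 2 * pi" using cos_one_2pi_int by blast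
  have "\<bar>of_int n * 2 * pi\<bar> < 2 * pi" using xy unfolding n[symmetric] by (auto simp: strip_def)
  then have "\<bar>of_int n :: real\<bar> < 1" by (simp add: abs_mult)
  then have "n = 0" by linarith
  then have "snd x = snd y" using n by simp
  moreover have "fst x = fst y" using G_eq_0[OF 0(1)] xy by (auto simp: strip_def)
  ultimately show "x = y" by (simp add: prod_eq_iff)
qed

text \<open>Each of \<open>G\<close>, \<open>1 - cos\<close>, \<open>cosh - 1\<close> and the product of the two radii costs a factor close to 1.\<close>

lemma metric_near:
  assumes p: "p \<in> strip \<phi>" and K: "1 < K"
  shows "\<exists>V. open V \<and> p \<in> V \<and> (\<forall>x\<in>V \<inter> strip \<phi>. \<forall>y\<in>V \<inter> strip \<phi>.
       (let l = sqrt ((v * (fst x - fst y))\<^sup>2 + (\<rho> (fst p) * (snd x - snd y))\<^sup>2) in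
         dist (X x) (X y) \<le> K * l \<and> l \<le> K * dist (X x) (X y)))"
proof -
  define k where "k = root 3 (K\<^sup>2)"
  have k: "1 < k" "k ^ 3 = K\<^sup>2" using K by (simp_all add: k_def one_less_power)
  define r0 where "r0 = \<rho> (fst p)"
  have r0: "0 < r0" using p \<rho>(2) by (auto simp: r0_def strip_def)
  obtain e1 where e1: "0 < e1" "\<And>x. \<bar>x\<bar> < e1 \<Longrightarrow> G x \<le> k * (x\<^sup>2 / 2)" "\<And>x. \<bar>x\<bar> < e1 \<Longrightarrow> x\<^sup>2 / 2 \<le> k * G x"
    using comparable_to_half_square[OF G(2,4) k(1)] by blast
  obtain e2 where e2: "0 < e2" "\<And>x. \<bar>x\<bar> < e2 \<Longrightarrow> 1 - cos x \<le> k * (x\<^sup>2 / 2)"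
    "\<And>x::real. \<bar>x\<bar> < e2 \<Longrightarrow> x\<^sup>2 / 2 \<le> k * (1 - cos x)"
    using comparable_to_half_square[OF cos_half_square_limit _ k(1)] by auto
  obtain e3 where e3: "0 < e3" "\<And>x. \<bar>x\<bar> < e3 \<Longrightarrow> cosh x - 1 \<le> k * (x\<^sup>2 / 2)"
    "\<And>x::real. \<bar>x\<bar> < e3 \<Longrightarrow> x\<^sup>2 / 2 \<le> k * (cosh x - 1)"
    using comparable_to_half_square[OF cosh_half_square_limit _ k(1)] by auto
  \<comment> \<open>Each of \<open>\<rho>\<close> at two nearby points contributes a factor \<open>sqrt k\<close>.\<close>
  have "isCont \<rho> (fst p)" using \<rho>(1) by (simp add: continuous_on_eq_continuous_at)
  then have "(\<rho> \<longlongrightarrow> r0) (nhds (fst p))"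
    using tendsto_at_iff_tendsto_nhds[of \<rho> "fst p"] by (simp add: isCont_def r0_def)
  then have "eventually (\<lambda>u. \<rho> u \<in> {r0 / sqrt k<..<r0 * sqrt k}) (nhds (fst p))"
    by (rule topological_tendstoD) (use r0 k in \<open>auto simp: field_simps real_less_rsqrt r0_def[symmetric]\<close>)
  then obtain e4 where e4: "0 < e4" "\<And>u. \<bar>u - fst p\<bar> < e4 \<Longrightarrow> \<rho> u \<in> {r0 / sqrt k<..<r0 * sqrt k}"
    unfolding eventually_nhds_metric by (auto simp: dist_real_def)
  define m where "m = (cosh e3 - 1) / (k\<^sup>2 * (v\<^sup>2 + r0\<^sup>2))"
  have ce: "1 < cosh e3" using cosh_real_nonneg_less_iff[of 0 e3] e3(1) by simp
  have m: "0 < m" using ce k v r0 by (auto simp: m_def intro!: divide_pos_pos mult_pos_pos add_pos_pos)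
  define r where "r = Min {e1, e2, e4, 1, m}"
  have r: "0 < r" "r \<le> e1" "r \<le> e2" "r \<le> e4" "r \<le> 1" "r \<le> m"
    using e1(1) e2(1) e4(1) m by (auto simp: r_def)
  define V where "V = {fst p - r / 2<..<fst p + r / 2} \<times> {snd p - r / 2<..<snd p + r / 2}"
  have "dist (X x) (X y) \<le> K * l \<and> l \<le> K * dist (X x) (X y)"
    if xy: "x \<in> V" "y \<in> V" and l: "l = sqrt ((v * (fst x - fst y))\<^sup>2 + (r0 * (snd x - snd y))\<^sup>2)" for x y l
  proof -
    define du dp d R where "du = fst x - fst y" and "dp = snd x - snd y" and "d = dist (X x) (X y)"
      and "R = \<rho> (fst x) * \<rho> (fst y)"
    have small: "\<bar>du\<bar> < r" "\<bar>dp\<bar> < r" using xy by (auto simp: V_def du_def dp_def abs_less_iff)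
    have "\<bar>fst x - fst p\<bar> < e4" "\<bar>fst y - fst p\<bar> < e4" using xy r by (auto simp: V_def abs_less_iff)
    then have bd: "r0 / sqrt k \<le> \<rho> (fst x)" "\<rho> (fst x) \<le> r0 * sqrt k" "r0 / sqrt k \<le> \<rho> (fst y)" "\<rho> (fst y) \<le> r0 * sqrt k"
      using e4(2) by force+
    have Rle: "R \<le> k * r0\<^sup>2"
    proof -
      have "R \<le> (r0 * sqrt k) * (r0 * sqrt k)"
        unfolding R_def using bd r0 k by (intro mult_mono) (auto intro: order_trans[rotated, OF bd(3)])
      also have "\<dots> = k * r0\<^sup>2" using k by (simp add: power2_eq_square mult_ac)
      finally show ?thesis .
    qed
    have Rge: "r0\<^sup>2 \<le> k * R"
    proof -
      have "(r0 / sqrt k) * (r0 / sqrt k) \<le> R"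
        unfolding R_def using bd r0 k by (intro mult_mono) (auto intro: order_trans[rotated, OF bd(1)])
      moreover have "(r0 / sqrt k) * (r0 / sqrt k) = r0\<^sup>2 / k" using k by (simp add: power2_eq_square)
      ultimately show ?thesis using k by (simp add: field_simps)
    qed
    have R0: "0 \<le> R" using Rge k by (smt (verit) mult_nonneg_nonpos2 mult.commute zero_le_power2 r0 zero_less_power)
    define P where "P = v\<^sup>2 * G du + R * (1 - cos dp)"
    have P: "cosh d = 1 + P" using law[of x y] by (simp add: P_def d_def du_def dp_def R_def)
    have l2: "l\<^sup>2 = v\<^sup>2 * du\<^sup>2 + r0\<^sup>2 * dp\<^sup>2" by (simp add: l du_def dp_def power_mult_distrib)
    have P_le: "P \<le> k\<^sup>2 * (l\<^sup>2 / 2)"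
    proof -
      have "v\<^sup>2 * G du \<le> v\<^sup>2 * (k * (du\<^sup>2 / 2))" using e1(2) small r by (intro mult_left_mono) auto
      also have "\<dots> \<le> v\<^sup>2 * (k\<^sup>2 * (du\<^sup>2 / 2))"
        using k by (intro mult_left_mono mult_right_mono) (auto simp: power2_eq_square)
      finally have "v\<^sup>2 * G du \<le> v\<^sup>2 * (k\<^sup>2 * (du\<^sup>2 / 2))" .
      moreover have "R * (1 - cos dp) \<le> (k * r0\<^sup>2) * (k * (dp\<^sup>2 / 2))"
        using e2(2) small r Rle k by (intro mult_mono) auto
      moreover have "k\<^sup>2 * (l\<^sup>2 / 2) = v\<^sup>2 * (k\<^sup>2 * (du\<^sup>2 / 2)) + (k * r0\<^sup>2) * (k * (dp\<^sup>2 / 2))"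
        unfolding l2 by (simp add: power2_eq_square field_simps)
      ultimately show ?thesis unfolding P_def by linarith
    qed
    have P_ge: "l\<^sup>2 / 2 \<le> k\<^sup>2 * P"
    proof -
      have "v\<^sup>2 * (du\<^sup>2 / 2) \<le> v\<^sup>2 * (k * G du)" using e1(3) small r by (intro mult_left_mono) auto
      also have "\<dots> \<le> v\<^sup>2 * (k\<^sup>2 * G du)"
        using k G(3) by (intro mult_left_mono mult_right_mono) (auto simp: power2_eq_square)
      finally have "v\<^sup>2 * (du\<^sup>2 / 2) \<le> v\<^sup>2 * (k\<^sup>2 * G du)" .
      moreover have "r0\<^sup>2 * (dp\<^sup>2 / 2) \<le> (k * R) * (k * (1 - cos dp))"
        using e2(3) small r Rge k R0 by (intro mult_mono) auto
      moreover have "k\<^sup>2 * P = v\<^sup>2 * (k\<^sup>2 * G du) + (k * R) * (k * (1 - cos dp))"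
        by (simp add: P_def power2_eq_square algebra_simps)
      moreover have "l\<^sup>2 / 2 = v\<^sup>2 * (du\<^sup>2 / 2) + r0\<^sup>2 * (dp\<^sup>2 / 2)"
        unfolding l2 by (simp add: add_divide_distrib)
      ultimately show ?thesis by linarith
    qed
    have "d < e3"
    proof (rule ccontr)
      assume "\<not> d < e3"
      then have "cosh e3 \<le> cosh d" using e3(1) by (subst cosh_real_nonneg_le_iff) (auto simp: d_def)
      then have "cosh e3 - 1 \<le> k\<^sup>2 * (l\<^sup>2 / 2)" using P P_le by simp
      also have "\<dots> \<le> k\<^sup>2 * ((v\<^sup>2 + r0\<^sup>2) * r / 2)"
      proof -
        have sq: "q\<^sup>2 \<le> r" if "\<bar>q\<bar> < r" for q
        proof -
          have "\<bar>q\<bar>\<^sup>2 \<le> r * 1" unfolding power2_eq_square using that r by (intro mult_mono) auto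
          then show ?thesis by simp
        qed
        have "l\<^sup>2 \<le> v\<^sup>2 * r + r0\<^sup>2 * r" unfolding l2 using sq small by (intro add_mono mult_left_mono) auto
        then show ?thesis using k by (intro mult_left_mono) (auto simp: algebra_simps)
      qed
      also have "\<dots> \<le> k\<^sup>2 * ((v\<^sup>2 + r0\<^sup>2) * m / 2)" using r by (intro mult_left_mono divide_right_mono) auto
      also have "\<dots> = (k\<^sup>2 * (v\<^sup>2 + r0\<^sup>2)) * m / 2" by simp
      also have "\<dots> = (cosh e3 - 1) / 2"
      proof -
        have "0 < k\<^sup>2 * (v\<^sup>2 + r0\<^sup>2)" using k v r0 by (intro mult_pos_pos add_pos_pos) auto
        then have "(k\<^sup>2 * (v\<^sup>2 + r0\<^sup>2)) * m = cosh e3 - 1"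
          unfolding m_def by (metis less_irrefl nonzero_mult_div_cancel_left times_divide_eq_right)
        then show ?thesis by simp
      qed
      finally show False using ce by simp
    qed
    then have e: "\<bar>d\<bar> < e3" by (simp add: d_def)
    have "K\<^sup>2 = k * k\<^sup>2" unfolding k(2)[symmetric] by (simp add: power2_eq_square power3_eq_cube)
    then have k2: "K\<^sup>2 * x = k * (k\<^sup>2 * x)" for x by simp
    have "d\<^sup>2 / 2 \<le> k * P" using e3(3)[OF e] P by simp
    also have "\<dots> \<le> k * (k\<^sup>2 * (l\<^sup>2 / 2))" using P_le k by (intro mult_left_mono) auto
    finally have "d\<^sup>2 \<le> (K * l)\<^sup>2" by (simp add: k2[symmetric] power_mult_distrib)
    moreover have "l\<^sup>2 / 2 \<le> k\<^sup>2 * (k * (d\<^sup>2 / 2))"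
      using order_trans[OF P_ge mult_left_mono[of P "k * (d\<^sup>2 / 2)" "k\<^sup>2"]] e3(2)[OF e] P by simp
    then have "l\<^sup>2 \<le> K\<^sup>2 * d\<^sup>2" unfolding k2 by (simp add: mult_ac)
    then have "l\<^sup>2 \<le> (K * d)\<^sup>2" by (simp add: power_mult_distrib)
    moreover have "0 \<le> l" "0 \<le> d" by (auto simp: l d_def)
    ultimately show ?thesis using K by (auto simp: d_def intro!: power2_le_imp_le)
  qed
  moreover have "open V" "p \<in> V" using r by (auto simp: V_def mem_Times_iff intro!: open_Times)
  ultimately show ?thesis unfolding Let_def r0_def by blast
qed

lemma emeasure_image:
  assumes E: "E \<in> sets borel" "E \<subseteq> strip \<phi>"
  shows "X ` E \<in> sets borel"
    and "emeasure area_measure (X ` E) = (\<integral>\<^sup>+x\<in>E. ennreal (v * \<rho> (fst x)) \<partial>lborel)"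
proof -
  have c: "continuous_on (strip \<phi>) (\<lambda>x. \<rho> (fst x))"
    by (rule continuous_on_compose2[OF \<rho>(1)]) (auto intro!: continuous_intros)
  have p: "0 < \<rho> (fst x)" if "x \<in> strip \<phi>" for x using that \<rho>(2) by (auto simp: strip_def)
  note * = area_formula_orthogonal_coordinates[where U = "strip \<phi>" and X = X
    and \<alpha> = "\<lambda>_. v" and \<beta> = "\<lambda>x. \<rho> (fst x)", OF open_strip inj_on_strip continuous_on_const c v p metric_near E]
  show "X ` E \<in> sets borel" by (rule *(1))
  show "emeasure area_measure (X ` E) = (\<integral>\<^sup>+x\<in>E. ennreal (v * \<rho> (fst x)) \<partial>lborel)" by (rule *(2))
qed

lemma measurable_\<rho> [measurable]: "\<rho> \<in> borel_measurable borel"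
  by (rule borel_measurable_continuous_onI[OF \<rho>(1)])

lemma nn_integral_image:
  assumes E[measurable]: "E \<in> sets borel" and sub: "E \<subseteq> strip \<phi>" and f[measurable]: "f \<in> borel_measurable borel"
  shows "(\<integral>\<^sup>+y\<in>X ` E. f y \<partial>area_measure) = (\<integral>\<^sup>+x\<in>E. f (X x) * ennreal (v * \<rho> (fst x)) \<partial>lborel)"
proof -
  note [measurable] = emeasure_image(1)[OF E sub]
  have m: "(\<lambda>x. ennreal (v * \<rho> (fst x)) * indicator E x) \<in> borel_measurable lborel"
  proof -
    have f: "fst \<in> borel_measurable (borel :: (real \<times> real) measure)"
      by (intro borel_measurable_continuous_onI continuous_intros)
    have "(\<lambda>x. \<rho> (fst x)) \<in> borel_measurable (borel :: (real \<times> real) measure)"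
      using measurable_compose[OF f measurable_\<rho>] .
    moreover have "(indicator E :: real \<times> real \<Rightarrow> ennreal) \<in> borel_measurable borel"
      using E by (rule borel_measurable_indicator)
    ultimately show ?thesis
      unfolding measurable_lborel1 measurable_lborel2 by (intro borel_measurable_times_ennreal measurable_compose[OF _ measurable_ennreal] borel_measurable_times borel_measurable_const)
  qed
  have "density area_measure (indicator (X ` E)) =
      distr (density lborel (\<lambda>x. ennreal (v * \<rho> (fst x)) * indicator E x)) borel X" (is "?L = ?R")
  proof (rule measure_eqI)
    fix B assume "B \<in> sets ?L"
    then have B[measurable]: "B \<in> sets borel" by simp
    have XB: "E \<inter> X -` B \<in> sets borel" using measurable_sets[OF measurable_X B] by simp
    have eq: "X ` E \<inter> B = X ` (E \<inter> X -` B)" by blast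
    have "emeasure ?L B = emeasure area_measure (X ` E \<inter> B)"
      by (simp add: emeasure_density nn_integral_indicator flip: indicator_inter_arith)
    also have "\<dots> = (\<integral>\<^sup>+x\<in>E \<inter> X -` B. ennreal (v * \<rho> (fst x)) \<partial>lborel)"
      unfolding eq using sub by (intro emeasure_image(2)[OF XB]) auto
    also have "\<dots> = emeasure ?R B"
    proof -
      have [measurable]: "X -` B \<in> sets borel" using measurable_sets[OF measurable_X B] by simp
      have "emeasure ?R B = emeasure (density lborel (\<lambda>x. ennreal (v * \<rho> (fst x)) * indicator E x)) (X -` B)"
        by (subst emeasure_distr) auto
      also have "\<dots> = (\<integral>\<^sup>+x. ennreal (v * \<rho> (fst x)) * indicator E x * indicator (X -` B) x \<partial>lborel)"
        by (rule emeasure_density[OF m]) measurable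
      finally show ?thesis by (simp add: indicator_inter_arith mult.assoc)
    qed
    finally show "emeasure ?L B = emeasure ?R B" .
  qed simp
  then have "(\<integral>\<^sup>+y. f y \<partial>?L) = (\<integral>\<^sup>+y. f y \<partial>?R)" by simp
  moreover have "(\<integral>\<^sup>+y. f y \<partial>?L) = (\<integral>\<^sup>+y\<in>X ` E. f y \<partial>area_measure)"
    by (subst nn_integral_density) (auto simp: mult.commute)
  moreover have "(\<integral>\<^sup>+y. f y \<partial>?R) = (\<integral>\<^sup>+x. f (X x) \<partial>density lborel (\<lambda>x. ennreal (v * \<rho> (fst x)) * indicator E x))"
    by (rule nn_integral_distr) auto
  moreover have "\<dots> = (\<integral>\<^sup>+x. ennreal (v * \<rho> (fst x)) * indicator E x * f (X x) \<partial>lborel)"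
    by (rule nn_integral_density[OF m]) (simp add: measurable_compose[OF measurable_X f])
  ultimately show ?thesis by (simp add: mult_ac)
qed

lemma nn_integral_strip:
  assumes [measurable]: "g \<in> borel_measurable borel"
  shows "(\<integral>\<^sup>+x\<in>strip \<phi>. g (fst x) \<partial>lborel) = ennreal (2 * pi) * (\<integral>\<^sup>+u\<in>{a<..<b}. g u \<partial>lborel)"
proof -
  have "(\<integral>\<^sup>+x\<in>strip \<phi>. g (fst x) \<partial>lborel) =
    (\<integral>\<^sup>+x. g (fst x) * indicator {a<..<b} (fst x) * indicator {\<phi><..<\<phi> + 2 * pi} (snd x) \<partial>(lborel \<Otimes>\<^sub>M lborel))"
    unfolding lborel_prod by (intro nn_integral_cong) (auto simp: strip_def indicator_def)
  also have "\<dots> = (\<integral>\<^sup>+u. (\<integral>\<^sup>+w. g u * indicator {a<..<b} u * indicator {\<phi><..<\<phi> + 2 * pi} w \<partial>lborel) \<partial>lborel)"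
    by (subst lborel.nn_integral_fst[symmetric]) auto
  also have "\<dots> = (\<integral>\<^sup>+u. ennreal (2 * pi) * (g u * indicator {a<..<b} u) \<partial>lborel)"
    by (intro nn_integral_cong) (simp add: nn_integral_cmult_indicator mult.commute)
  also have "\<dots> = ennreal (2 * pi) * (\<integral>\<^sup>+u\<in>{a<..<b}. g u \<partial>lborel)"
    by (rule nn_integral_cmult) measurable
  finally show ?thesis .
qed

lemma AE_not_endpoints: "AE u in lborel. indicator {a<..<b} u = (indicator {a..b} u :: ennreal)"
  using AE_lborel_singleton[of a] AE_lborel_singleton[of b] by eventually_elim (auto simp: indicator_def)

lemma area_strip:
  assumes ab: "a \<le> b" and F: "\<And>u. (F has_real_derivative \<rho> u) (at u)"
  shows "emeasure area_measure (X ` strip \<phi>) = ennreal (2 * pi * v * (F b - F a))"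
proof -
  have \<rho>0: "0 \<le> \<rho> u" if u: "a \<le> u" "u \<le> b" "a < b" for u
  proof -
    have "u \<in> closure {a<..<b}" using u by simp
    moreover have "closed {u. 0 \<le> \<rho> u}" by (intro closed_Collect_le \<rho>(1) continuous_intros)
    then have "closure {a<..<b} \<subseteq> {u. 0 \<le> \<rho> u}" using \<rho>(2) by (intro closure_minimal) (auto intro: less_imp_le)
    ultimately show ?thesis by auto
  qed
  have "emeasure area_measure (X ` strip \<phi>) = ennreal (2 * pi) * (\<integral>\<^sup>+u\<in>{a<..<b}. ennreal (v * \<rho> u) \<partial>lborel)"
    unfolding emeasure_image(2)[OF strip_borel order_refl] by (rule nn_integral_strip) measurable
  also have "(\<integral>\<^sup>+u\<in>{a<..<b}. ennreal (v * \<rho> u) \<partial>lborel) = (\<integral>\<^sup>+u\<in>{a..b}. ennreal (v * \<rho> u) \<partial>lborel)"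
    using AE_not_endpoints by (intro nn_integral_cong_AE) (auto elim!: eventually_mono)
  also have "\<dots> = ennreal (v * F b - v * F a)"
  proof (cases "a = b")
    case False
    then show ?thesis using \<rho>0 ab v F
      by (intro nn_integral_FTC_Icc[where F = "\<lambda>u. v * F u"])
         (auto intro!: derivative_eq_intros DERIV_subset[OF F])
  qed (simp add: nn_integral_cmult_indicator)
  finally show ?thesis using ab v
    by (simp add: ennreal_mult'[symmetric] algebra_simps)
qed

lemma area_null: "E \<in> sets borel \<Longrightarrow> E \<subseteq> strip \<phi> \<Longrightarrow> emeasure lborel E = 0 \<Longrightarrow> X ` E \<in> null_sets area_measure"
  using emeasure_image[of E \<phi>]
  by (auto simp: null_sets_def nn_integral_null_set)

end

section \<open>Linear algebra and convexity in hyperbolic space\<close>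

definition cx :: "mspace \<Rightarrow> real" where "cx u = fst u $ 1"
definition cy :: "mspace \<Rightarrow> real" where "cy u = fst u $ 2"
definition cz :: "mspace \<Rightarrow> real" where "cz u = fst u $ 3"
definition ct :: "mspace \<Rightarrow> real" where "ct u = snd u"
definition mvec :: "real \<Rightarrow> real \<Rightarrow> real \<Rightarrow> real \<Rightarrow> mspace" where "mvec x y z t = (vector [x, y, z], t)"
text \<open>Distance from the axis of revolution, as a norm on pairs so that it inherits the triangle
  inequality.\<close>

definition rad :: "mspace \<Rightarrow> real" where "rad u = norm (cx u, cy u)"

lemma coord_mvec [simp]: "cx (mvec x y z t) = x" "cy (mvec x y z t) = y" "cz (mvec x y z t) = z" "ct (mvec x y z t) = t"
  by (simp_all add: cx_def cy_def cz_def ct_def mvec_def)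

lemma coord_linear [simp]:
  "cx (u + v) = cx u + cx v" "cy (u + v) = cy u + cy v" "cz (u + v) = cz u + cz v" "ct (u + v) = ct u + ct v"
  "cx (u - v) = cx u - cx v" "cy (u - v) = cy u - cy v" "cz (u - v) = cz u - cz v" "ct (u - v) = ct u - ct v"
  "cx (c *\<^sub>R u) = c * cx u" "cy (c *\<^sub>R u) = c * cy u" "cz (c *\<^sub>R u) = c * cz u" "ct (c *\<^sub>R u) = c * ct u"
  by (simp_all add: cx_def cy_def cz_def ct_def)

lemma coord_minus [simp]: "cx (- u) = - cx u" "cy (- u) = - cy u" "cz (- u) = - cz u" "ct (- u) = - ct u"
  by (simp_all add: cx_def cy_def cz_def ct_def)

lemma mspace_eqI: "cx u = cx v \<Longrightarrow> cy u = cy v \<Longrightarrow> cz u = cz v \<Longrightarrow> ct u = ct v \<Longrightarrow> u = v"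
  by (simp add: cx_def cy_def cz_def ct_def prod_eq_iff vec_eq_iff forall_3)

lemma mink_coord: "mink u v = cx u * cx v + cy u * cy v + cz u * cz v - ct u * ct v"
  by (simp add: mink_def inner_vec_def sum_3 cx_def cy_def cz_def ct_def)

lemma bounded_linear_coord: "bounded_linear cx" "bounded_linear cy" "bounded_linear cz" "bounded_linear ct"
  unfolding cx_def[abs_def] cy_def[abs_def] cz_def[abs_def] ct_def[abs_def]
  by (auto intro!: bounded_linear_fst bounded_linear_snd bounded_linear_vec_nth bounded_linear_compose[OF bounded_linear_vec_nth])

lemmas continuous_on_coord [continuous_intros] =
  bounded_linear.continuous_on[OF bounded_linear_coord(1)] bounded_linear.continuous_on[OF bounded_linear_coord(2)]
  bounded_linear.continuous_on[OF bounded_linear_coord(3)] bounded_linear.continuous_on[OF bounded_linear_coord(4)]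

lemma continuous_on_rad [continuous_intros]: "continuous_on S f \<Longrightarrow> continuous_on S (\<lambda>x. rad (f x))"
  unfolding rad_def by (intro continuous_intros)

lemma rad_nonneg [simp]: "0 \<le> rad u" by (simp add: rad_def)

lemma rad_square: "(rad u)\<^sup>2 = (cx u)\<^sup>2 + (cy u)\<^sup>2"
  by (simp add: rad_def norm_Pair)

lemma rad_sublinear:
  assumes "0 \<le> l" "0 \<le> m"
  shows "rad (l *\<^sub>R u + m *\<^sub>R v) \<le> l * rad u + m * rad v"
proof -
  have "rad (l *\<^sub>R u + m *\<^sub>R v) = norm (l *\<^sub>R (cx u, cy u) + m *\<^sub>R (cx v, cy v))" by (simp add: rad_def)
  also have "\<dots> \<le> norm (l *\<^sub>R (cx u, cy u)) + norm (m *\<^sub>R (cx v, cy v))" by (rule norm_triangle_ineq)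
  also have "\<dots> = l * rad u + m * rad v"
    using assms by (simp only: norm_scaleR abs_of_nonneg rad_def)
  finally show ?thesis .
qed

lemma rad_inner_le: "cx u * cx v + cy u * cy v \<le> rad u * rad v"
  using norm_cauchy_schwarz[of "(cx u, cy u)" "(cx v, cy v)"] by (simp add: rad_def inner_prod_def)

lemma Rep_hyp3_coord: "(cx (Rep_hyp3 p))\<^sup>2 + (cy (Rep_hyp3 p))\<^sup>2 + (cz (Rep_hyp3 p))\<^sup>2 + 1 = (ct (Rep_hyp3 p))\<^sup>2"
  using Rep_hyp3_mink[of p] by (simp add: mink_coord power2_eq_square)

lemma Rep_hyp3_ct_pos: "0 < ct (Rep_hyp3 p)" using Rep_hyp3_pos[of p] by (simp add: ct_def)

lemma Rep_hyp3_rad: "(rad (Rep_hyp3 p))\<^sup>2 + (cz (Rep_hyp3 p))\<^sup>2 + 1 = (ct (Rep_hyp3 p))\<^sup>2"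
  using Rep_hyp3_coord[of p] by (simp add: rad_square)

lemma Rep_Abs_hyp3:
  assumes "mink u u = - 1" "0 < ct u" shows "Rep_hyp3 (Abs_hyp3 u) = u"
  using assms by (intro Abs_hyp3_inverse) (simp add: ct_def)

lemma cosh_dist_hyp3: "cosh (dist p q) = - mink (Rep_hyp3 p) (Rep_hyp3 q)"
  using minus_mink_ge_1[of p q] by (simp add: dist_hyp3_def)

lemma mink_le: "mink (Rep_hyp3 p) (Rep_hyp3 q) \<le> - 1"
  using minus_mink_ge_1[of p q] by simp

text \<open>The Minkowski form is positive definite on tangent spaces, and comparable there with the Euclidean
  norm. This is what makes the embedding into Minkowski space continuous for the hyperbolic distance.\<close>

lemma mink_orthogonal_bound:
  assumes "mink w (Rep_hyp3 p) = 0"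
  shows "norm w \<le> 2 * ct (Rep_hyp3 p) * sqrt (mink w w)"
proof -
  define y where "y = Rep_hyp3 p"
  have y: "fst y \<bullet> fst y = (snd y)\<^sup>2 - 1" "snd y > 0"
    using Rep_hyp3_mink[of p] Rep_hyp3_pos[of p] unfolding y_def mink_def by (auto simp: power2_eq_square)
  have "fst w \<bullet> fst y = snd w * snd y" using assms unfolding y_def mink_def by simp
  then have "(snd w)\<^sup>2 * (snd y)\<^sup>2 \<le> (fst w \<bullet> fst w) * ((snd y)\<^sup>2 - 1)"
    using Cauchy_Schwarz_ineq[of "fst w" "fst y"] y(1) by (simp add: power_mult_distrib)
  then have *: "fst w \<bullet> fst w \<le> (snd y)\<^sup>2 * mink w w"
    unfolding mink_def by (simp add: algebra_simps power2_eq_square)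
  have pos: "0 \<le> mink w w" using assms by (rule mink_orthogonal_pos)
  have "(snd w)\<^sup>2 = fst w \<bullet> fst w - mink w w" by (simp add: mink_def power2_eq_square)
  then have "(norm w)\<^sup>2 \<le> 2 * ((snd y)\<^sup>2 * mink w w)"
  proof -
    have "(norm w)\<^sup>2 = fst w \<bullet> fst w + (snd w)\<^sup>2" by (simp add: norm_prod_def power2_norm_eq_inner)
    then show ?thesis using * pos \<open>(snd w)\<^sup>2 = fst w \<bullet> fst w - mink w w\<close> by linarith
  qed
  also have "\<dots> \<le> (2 * ct (Rep_hyp3 p) * sqrt (mink w w))\<^sup>2"
    using pos by (simp add: power_mult_distrib ct_def y_def)
  finally show ?thesis
    by (rule power2_le_imp_le) (use pos Rep_hyp3_ct_pos[of p] in simp)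
qed

lemma continuous_Rep_hyp3: "continuous_on UNIV Rep_hyp3"
proof (rule continuous_at_imp_continuous_on, rule ballI)
  fix p :: hyp3
  let ?d = "\<lambda>q. dist q p"
  have "norm (Rep_hyp3 q - Rep_hyp3 p) \<le>
      2 * ct (Rep_hyp3 p) * sqrt ((cosh (?d q))\<^sup>2 - 1) + \<bar>cosh (?d q) - 1\<bar> * norm (Rep_hyp3 p)" for q
  proof -
    define w where "w = Rep_hyp3 q - cosh (?d q) *\<^sub>R Rep_hyp3 p"
    have "mink w (Rep_hyp3 p) = 0" by (simp add: w_def mink_simps(2-7) cosh_dist_hyp3)
    moreover have "mink w w = (cosh (?d q))\<^sup>2 - 1"
      by (simp add: w_def mink_simps(2-7) cosh_dist_hyp3 mink_simps(1)[of "Rep_hyp3 p" "Rep_hyp3 q"] power2_eq_square)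
    ultimately have "norm w \<le> 2 * ct (Rep_hyp3 p) * sqrt ((cosh (?d q))\<^sup>2 - 1)"
      using mink_orthogonal_bound[of w p] by simp
    moreover have "Rep_hyp3 q - Rep_hyp3 p = w + (cosh (?d q) - 1) *\<^sub>R Rep_hyp3 p"
      by (simp add: w_def algebra_simps)
    ultimately show ?thesis
      using norm_triangle_ineq[of w "(cosh (?d q) - 1) *\<^sub>R Rep_hyp3 p"] by simp
  qed
  then have "\<forall>\<^sub>F q in at p. norm (Rep_hyp3 q - Rep_hyp3 p) \<le>
      2 * ct (Rep_hyp3 p) * sqrt ((cosh (?d q))\<^sup>2 - 1) + \<bar>cosh (?d q) - 1\<bar> * norm (Rep_hyp3 p)"
    by (intro always_eventually allI)
  moreover have "((\<lambda>q. 2 * ct (Rep_hyp3 p) * sqrt ((cosh (?d q))\<^sup>2 - 1) + \<bar>cosh (?d q) - 1\<bar> * norm (Rep_hyp3 p)) \<longlongrightarrow>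
      2 * ct (Rep_hyp3 p) * sqrt ((cosh (?d p))\<^sup>2 - 1) + \<bar>cosh (?d p) - 1\<bar> * norm (Rep_hyp3 p)) (at p)"
    by (intro tendsto_intros)
  then have "((\<lambda>q. 2 * ct (Rep_hyp3 p) * sqrt ((cosh (?d q))\<^sup>2 - 1) + \<bar>cosh (?d q) - 1\<bar> * norm (Rep_hyp3 p)) \<longlongrightarrow> 0) (at p)"
    by simp
  ultimately have "((\<lambda>q. Rep_hyp3 q - Rep_hyp3 p) \<longlongrightarrow> 0) (at p)"
    by (rule Lim_null_comparison)
  then show "isCont Rep_hyp3 p" unfolding isCont_def by (simp add: LIM_zero_iff)
qed

lemmas continuous_on_Rep_hyp3 [continuous_intros] =
  continuous_on_compose2[OF continuous_Rep_hyp3 _ subset_UNIV]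

text \<open>The coefficients sum to at most one because \<open>sinh\<close> is superadditive.\<close>

lemma geodesic_segment_combination:
  assumes "x \<in> geodesic_segment p q"
  obtains l m where "0 \<le> l" "0 \<le> m" "l + m \<le> 1" "Rep_hyp3 x = l *\<^sub>R Rep_hyp3 p + m *\<^sub>R Rep_hyp3 q"
proof (cases "p = q")
  case True
  then have "x = p" using assms by (simp add: geodesic_segment_def dist_commute)
  then show ?thesis using that[of 1 0] by simp
next
  case False
  define d1 d2 where "d1 = dist p x" and "d2 = dist x q"
  have d: "dist p q = d1 + d2" "0 \<le> d1" "0 \<le> d2" "0 < d1 + d2"
    using assms False by (auto simp: geodesic_segment_def d1_def d2_def)
  define D where "D = sinh (d1 + d2)"
  have D: "0 < D" using d by (simp add: D_def)
  define l m where "l = sinh d2 / D" and "m = sinh d1 / D"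
  have lm: "0 \<le> l" "0 \<le> m" using d D by (auto simp: l_def m_def)
  have "sinh d1 * 1 \<le> sinh d1 * cosh d2" "1 * sinh d2 \<le> cosh d1 * sinh d2"
    using d by (intro mult_mono; simp add: cosh_real_ge_1)+
  then have "sinh d1 + sinh d2 \<le> D" by (simp add: D_def sinh_add)
  then have le1: "l + m \<le> 1" using D by (simp add: l_def m_def field_simps)
  define y where "y = l *\<^sub>R Rep_hyp3 p + m *\<^sub>R Rep_hyp3 q"
  have pq: "mink (Rep_hyp3 p) (Rep_hyp3 q) = - cosh (d1 + d2)" using cosh_dist_hyp3[of p q] d by simp
  have px: "mink (Rep_hyp3 p) (Rep_hyp3 x) = - cosh d1" using cosh_dist_hyp3[of p x] by (simp add: d1_def)
  have xq: "mink (Rep_hyp3 q) (Rep_hyp3 x) = - cosh d2"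
    using cosh_dist_hyp3[of x q] by (simp add: d2_def mink_simps(1)[of "Rep_hyp3 q"])
  have lD: "l * D = sinh d2" "m * D = sinh d1" using D by (auto simp: l_def m_def)
  have yx: "mink y (Rep_hyp3 x) = - 1"
  proof -
    have "D * mink y (Rep_hyp3 x) = - (sinh d2 * cosh d1 + sinh d1 * cosh d2)"
      using lD by (simp add: y_def mink_simps(2-7) px xq algebra_simps)
        (simp add: mult.assoc[symmetric] mult.commute[of D] lD)
    also have "\<dots> = - D" by (simp add: D_def sinh_add)
    finally have "D * mink y (Rep_hyp3 x) = D * (- 1)" by simp
    then show ?thesis using D by (simp only: mult_cancel_left) simp
  qed
  have yy: "mink y y = - 1"
  proof -
    have yy0: "mink y y = - (l\<^sup>2 + m\<^sup>2 + 2 * l * m * cosh (d1 + d2))"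
      by (simp add: y_def mink_simps(2-7) mink_simps(1)[of "Rep_hyp3 q" "Rep_hyp3 p"] pq power2_eq_square algebra_simps)
    have "D\<^sup>2 * mink y y = - ((l * D)\<^sup>2 + (m * D)\<^sup>2 + 2 * (l * D) * (m * D) * cosh (d1 + d2))"
      unfolding yy0 by (simp add: power2_eq_square algebra_simps)
    also have "\<dots> = - D\<^sup>2"
    proof -
      have c: "(cosh d1)\<^sup>2 = 1 + (sinh d1)\<^sup>2" "(cosh d2)\<^sup>2 = 1 + (sinh d2)\<^sup>2"
        by (simp_all add: cosh_square_eq)
      have "D\<^sup>2 = (sinh d1)\<^sup>2 * (cosh d2)\<^sup>2 + 2 * sinh d1 * cosh d2 * cosh d1 * sinh d2 + (cosh d1)\<^sup>2 * (sinh d2)\<^sup>2"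
        by (simp add: D_def sinh_add power2_eq_square algebra_simps)
      then show ?thesis unfolding lD c cosh_add by (simp add: power2_eq_square algebra_simps)
    qed
    finally have "D\<^sup>2 * mink y y = D\<^sup>2 * (- 1)" by simp
    then show ?thesis using D by (simp only: mult_cancel_left) simp
  qed
  have "Rep_hyp3 x - y = 0"
  proof (rule mink_orthogonal_pos)
    show "mink (Rep_hyp3 x - y) (Rep_hyp3 x) = 0" by (simp add: mink_simps(2-7) yx)
    show "mink (Rep_hyp3 x - y) (Rep_hyp3 x - y) = 0"
      by (simp add: mink_simps(2-7) yx yy mink_simps(1)[of "Rep_hyp3 x" y])
  qed
  then show ?thesis using that[OF lm le1] by (simp add: y_def)
qed

text \<open>The sublevel bound \<open>c\<close> has to be nonnegative because the coefficients of a point of a geodesic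
  segment sum to at most 1, not to 1.\<close>

lemma geodesically_convex_sublevel:
  assumes F: "\<And>l m u v. 0 \<le> l \<Longrightarrow> 0 \<le> m \<Longrightarrow> F (l *\<^sub>R u + m *\<^sub>R v) \<le> l * F u + m * F v" and c: "0 \<le> c"
  shows "geodesically_convex {p. F (Rep_hyp3 p) \<le> c}"
  unfolding geodesically_convex_def
proof (intro ballI subsetI)
  fix p q x assume p: "p \<in> {p. F (Rep_hyp3 p) \<le> c}" and q: "q \<in> {p. F (Rep_hyp3 p) \<le> c}" and x: "x \<in> geodesic_segment p q"
  obtain l m where lm: "0 \<le> l" "0 \<le> m" "l + m \<le> 1" "Rep_hyp3 x = l *\<^sub>R Rep_hyp3 p + m *\<^sub>R Rep_hyp3 q"
    using geodesic_segment_combination[OF x] by blast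
  have "F (Rep_hyp3 x) \<le> l * F (Rep_hyp3 p) + m * F (Rep_hyp3 q)" unfolding lm(4) by (rule F[OF lm(1,2)])
  also have "\<dots> \<le> l * c + m * c" using p q lm by (intro add_mono mult_left_mono) auto
  also have "\<dots> = (l + m) * c" by (simp add: distrib_right)
  also have "\<dots> \<le> 1 * c" using lm c by (intro mult_right_mono)
  finally show "x \<in> {p. F (Rep_hyp3 p) \<le> c}" by simp
qed

lemma geodesically_convex_Int:
  "geodesically_convex A \<Longrightarrow> geodesically_convex B \<Longrightarrow> geodesically_convex (A \<inter> B)"
  unfolding geodesically_convex_def by blast

lemma geodesically_convex_INT:
  "(\<And>i. i \<in> I \<Longrightarrow> geodesically_convex (A i)) \<Longrightarrow> geodesically_convex (\<Inter>i\<in>I. A i)"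
  unfolding geodesically_convex_def by (intro ballI INT_greatest) (meson INT_D)

text \<open>The geodesic that leaves \<open>p\<close> in the direction \<open>n\<close> leaves \<open>\<Omega>\<close> at once.\<close>

lemma outward_normal_not_interior:
  assumes n: "outward_unit_normal \<Omega> p n"
  shows "p \<notin> interior \<Omega>"
proof
  assume "p \<in> interior \<Omega>"
  then obtain e where e: "0 < e" "ball p e \<subseteq> \<Omega>" using mem_interior by blast
  define h where "h = e / 2"
  have h: "0 < h" "h < e" using e by (auto simp: h_def)
  have n': "mink n n = 1" "mink n (Rep_hyp3 p) = 0" "\<And>x. x \<in> \<Omega> \<Longrightarrow> mink n (Rep_hyp3 x) \<le> 0"
    using n by (auto simp: outward_unit_normal_def)
  define u where "u = cosh h *\<^sub>R Rep_hyp3 p + sinh h *\<^sub>R n"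
  have uu: "mink u u = - 1"
    by (simp add: u_def mink_simps(2-7) n' mink_simps(1)[of "Rep_hyp3 p" n])
      (simp add: cosh_square_eq power2_eq_square[symmetric] algebra_simps)
  have up: "mink u (Rep_hyp3 p) = - cosh h" by (simp add: u_def mink_simps(2-7) n')
  have pos: "0 < ct u"
  proof (rule ccontr)
    assume neg: "\<not> 0 < ct u"
    have "ct u \<noteq> 0" 
    proof
      assume "ct u = 0"
      then have "cx u * cx u + cy u * cy u + cz u * cz u = - 1" using uu by (simp add: mink_coord)
      moreover have "0 \<le> cx u * cx u + cy u * cy u + cz u * cz u" by simp
      ultimately show False by linarith
    qed
    define q where "q = Abs_hyp3 (- u)"
    have "Rep_hyp3 q = - u" unfolding q_def
      by (rule Rep_Abs_hyp3) (use uu neg \<open>ct u \<noteq> 0\<close> in \<open>simp_all add: mink_coord\<close>)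
    then have "mink (Rep_hyp3 q) (Rep_hyp3 p) = cosh h" using up by (simp add: mink_coord)
    then show False using mink_le[of q p] cosh_real_ge_1[of h] by linarith
  qed
  define q where "q = Abs_hyp3 u"
  have q: "Rep_hyp3 q = u" unfolding q_def using uu pos by (rule Rep_Abs_hyp3)
  have "cosh (dist q p) = cosh h" using cosh_dist_hyp3[of q p] up q by simp
  then have "arcosh (cosh (dist q p)) = arcosh (cosh h)" by simp
  then have "dist q p = h" using h by (simp add: arcosh_cosh_real)
  then have "q \<in> \<Omega>" using e h by (auto simp: dist_commute)
  then have "mink n u \<le> 0" using n'(3) q by metis
  moreover have "mink n u = sinh h" by (simp add: u_def mink_simps(2-7) n')
  ultimately show False using h by simp
qed

section \<open>The body and its supporting planes\<close>

lemma polar_angle_first_octant: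
  fixes a b :: real
  assumes "0 < a" "a < b"
  obtains \<theta> where "0 < \<theta>" "\<theta> < pi / 4" "a = sqrt (a\<^sup>2 + b\<^sup>2) * sin \<theta>" "b = sqrt (a\<^sup>2 + b\<^sup>2) * cos \<theta>"
proof -
  define \<sigma> where "\<sigma> = sqrt (a\<^sup>2 + b\<^sup>2)"
  have \<sigma>: "0 < \<sigma>" "\<sigma>\<^sup>2 = a\<^sup>2 + b\<^sup>2" using assms by (auto simp: \<sigma>_def intro!: add_pos_pos)
  have "(b / \<sigma>)\<^sup>2 + (a / \<sigma>)\<^sup>2 = \<sigma>\<^sup>2 / \<sigma>\<^sup>2"
    by (simp add: power_divide add_divide_distrib[symmetric] \<sigma>(2) add.commute)
  then have "(b / \<sigma>)\<^sup>2 + (a / \<sigma>)\<^sup>2 = 1" using \<sigma>(1) by simp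
  then obtain t where t: "0 \<le> t" "t \<le> pi / 2" "b / \<sigma> = cos t" "a / \<sigma> = sin t"
    using sincos_total_pi_half[of "b / \<sigma>" "a / \<sigma>"] assms \<sigma> by auto
  have ab: "a = \<sigma> * sin t" "b = \<sigma> * cos t" using t \<sigma> by (auto simp: field_simps)
  have "t < pi / 4"
  proof (rule ccontr)
    assume "\<not> t < pi / 4"
    then have "cos t \<le> cos (pi / 4)" "sin (pi / 4) \<le> sin t"
      using t by (auto intro!: cos_monotone_0_pi_le sin_monotone_2pi_le)
    then have "cos t \<le> sin t" by (simp add: sin_45 cos_45)
    then have "b \<le> a" unfolding ab using \<sigma> by simp
    then show False using assms by simp
  qed
  moreover have "t \<noteq> 0" using ab(1) assms(1) by (metis less_irrefl mult_zero_right sin_zero)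
  then have "0 < t" using t(1) by simp
  ultimately show ?thesis using that[of t] ab unfolding \<sigma>_def by blast
qed

lemma rotate_eighth:
  fixes a b \<theta> :: real
  shows "a * sin \<theta> + b * cos \<theta> =
    (a + b) / sqrt 2 * cos (pi / 4 - \<theta>) - (a - b) / sqrt 2 * sin (pi / 4 - \<theta>)"
proof -
  have "sqrt 2 * sqrt 2 = (2::real)" by simp
  then show ?thesis
    unfolding cos_diff sin_diff sin_45 cos_45 by (simp add: field_simps)
qed

text \<open>The numbers \<open>C\<close>, \<open>s0\<close> are cosh and sinh of the radius of the truncated ball, and \<open>k\<close>, \<open>s\<close> those of
  the distance \<open>\<delta>\<close> of the parallel body; \<open>q\<close> abbreviates a root that occurs throughout. The cutting
  plane is \<open>z = 0\<close>, and the cap below it is removed.\<close>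

locale cap_body =
  fixes C s0 q s k :: real
  assumes pos: "0 < C" "0 < s0" "0 < q" "0 < s" "0 < k"
    and C2: "C\<^sup>2 = 1 + s0\<^sup>2" and q2: "q\<^sup>2 = 1 + C\<^sup>2" and k2: "k\<^sup>2 = 1 + s\<^sup>2"
begin

text \<open>The edge is the circle of radius \<open>r0\<close> at height \<open>z = 0\<close> and time \<open>c0\<close>; the centre of the ball is the
  point \<open>(0, 0, h1, h2)\<close>. The values make the exterior angle along the edge equal to \<open>\<pi>/4\<close>. Finally
  \<open>C1\<close>, \<open>S1\<close> are cosh and sinh of the radius of the ball enlarged by \<open>\<delta>\<close>.\<close>

definition "r0 = s0 / q"
definition "c0 = sqrt 2 * C / q"
definition "h1 = s0 / sqrt 2"
definition "h2 = q / sqrt 2"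
definition "C1 = C * k + s0 * s"
definition "S1 = s0 * k + C * s"

lemma par_pos [simp]: "0 < r0" "0 < c0" "0 < h1" "0 < h2" "0 < C1" "0 < S1"
  "0 < C" "0 < s0" "0 < q" "0 < s" "0 < k"
  using pos by (simp_all add: r0_def c0_def h1_def h2_def C1_def S1_def add_pos_pos)

lemma par_nonneg [simp]: "0 \<le> r0" "0 \<le> c0" "0 \<le> h1" "0 \<le> h2" "0 \<le> C1" "0 \<le> S1"
  "0 \<le> C" "0 \<le> s0" "0 \<le> q" "0 \<le> s" "0 \<le> k"
  using par_pos by (simp_all add: less_imp_le del: par_pos)

lemma par_nonzero [simp]: "r0 \<noteq> 0" "c0 \<noteq> 0" "h1 \<noteq> 0" "h2 \<noteq> 0" "C1 \<noteq> 0" "S1 \<noteq> 0"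
  "C \<noteq> 0" "s0 \<noteq> 0" "q \<noteq> 0" "s \<noteq> 0" "k \<noteq> 0"
  using par_pos by (simp_all add: less_imp_neq[symmetric] del: par_pos)

lemma c02: "c0\<^sup>2 = 1 + r0\<^sup>2"
proof -
  have "c0\<^sup>2 - r0\<^sup>2 = (2 * C\<^sup>2 - s0\<^sup>2) / q\<^sup>2"
    by (simp add: c0_def r0_def power_divide power_mult_distrib diff_divide_distrib)
  also have "\<dots> = 1" using C2 q2 pos by (simp add: field_simps) (smt (verit) zero_le_power2)
  finally show ?thesis by simp
qed

lemma h22: "h2\<^sup>2 = 1 + h1\<^sup>2"
  using C2 q2 by (simp add: h1_def h2_def power_divide field_simps)

lemma C12: "C1\<^sup>2 = 1 + S1\<^sup>2"
proof -
  have "C1\<^sup>2 - S1\<^sup>2 = (C\<^sup>2 - s0\<^sup>2) * (k\<^sup>2 - s\<^sup>2)"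
    by (simp add: C1_def S1_def power2_eq_square algebra_simps)
  then show ?thesis by (simp add: C2 k2)
qed

lemma c0h2: "c0 * h2 = C" and r0h2: "r0 * h2 = h1" and Cr0: "C * r0 = h1 * c0"
  by (simp_all add: c0_def h2_def r0_def h1_def)

lemma h2_eq: "C * c0 - h1 * r0 = h2"
proof -
  have "sqrt 2 * sqrt 2 = (2::real)" by simp
  then have "C * c0 - h1 * r0 = (2 * C\<^sup>2 - s0\<^sup>2) / (sqrt 2 * q)"
    by (simp add: c0_def h1_def r0_def power2_eq_square field_simps)
  also have "2 * C\<^sup>2 - s0\<^sup>2 = q\<^sup>2" using C2 q2 by simp
  finally show ?thesis by (simp add: h2_def power2_eq_square)
qed

text \<open>In the half-plane of a given angle around the axis let \<open>e\<close> be the point of the edge. The three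
  functions \<open>aa\<close>, \<open>bb\<close>, \<open>ee\<close> are the Minkowski coordinates of a point with respect to the frame formed
  by the unit vector at \<open>e\<close> in the cutting plane away from the axis, the downward normal of the cutting
  plane, and \<open>e\<close> itself. In particular \<open>ee\<close> is the cosh of the distance from the edge. The function
  \<open>tau\<close> is the cosh of the distance from the centre.\<close>

definition aa :: "mspace \<Rightarrow> real" where "aa u = rad u * c0 - ct u * r0"
definition bb :: "mspace \<Rightarrow> real" where "bb u = - cz u"
definition ee :: "mspace \<Rightarrow> real" where "ee u = ct u * c0 - rad u * r0"
definition tau :: "mspace \<Rightarrow> real" where "tau u = ct u * h2 - cz u * h1"

text \<open>The ray from the centre through the edge leaves it in the direction \<open>(1, 1) / sqrt 2\<close> of the frame.
  This is where the exterior angle \<open>\<pi>/4\<close> enters.\<close>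

lemma tau_eq: "tau u = C * ee u + h1 * (aa u + bb u)"
proof -
  have "C * ee u + h1 * (aa u + bb u) = ct u * (C * c0 - h1 * r0) - rad u * (C * r0 - h1 * c0) - cz u * h1"
    by (simp add: ee_def aa_def bb_def algebra_simps)
  then show ?thesis by (simp add: h2_eq Cr0 tau_def)
qed

lemma rad_eq: "rad u = c0 * aa u + r0 * ee u"
proof -
  have "c0 * aa u + r0 * ee u = rad u * (c0\<^sup>2 - r0\<^sup>2)"
    by (simp add: aa_def ee_def power2_eq_square algebra_simps)
  then show ?thesis by (simp add: c02)
qed

lemma ct_eq: "ct u = c0 * ee u + r0 * aa u"
proof -
  have "c0 * ee u + r0 * aa u = ct u * (c0\<^sup>2 - r0\<^sup>2)"
    by (simp add: aa_def ee_def power2_eq_square algebra_simps)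
  then show ?thesis by (simp add: c02)
qed

lemma ee2: "(ee (Rep_hyp3 p))\<^sup>2 = 1 + (aa (Rep_hyp3 p))\<^sup>2 + (bb (Rep_hyp3 p))\<^sup>2"
proof -
  let ?u = "Rep_hyp3 p"
  have "(ee ?u)\<^sup>2 - (aa ?u)\<^sup>2 = ((ct ?u)\<^sup>2 - (rad ?u)\<^sup>2) * (c0\<^sup>2 - r0\<^sup>2)"
    by (simp add: aa_def ee_def power2_eq_square algebra_simps)
  then show ?thesis using Rep_hyp3_rad[of p] by (simp add: c02 bb_def)
qed

lemma ee_pos: "0 < ee (Rep_hyp3 p)"
proof -
  let ?u = "Rep_hyp3 p"
  have "(rad ?u)\<^sup>2 < (ct ?u)\<^sup>2" using Rep_hyp3_rad[of p] by (smt (verit) zero_le_power2)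
  then have "rad ?u < ct ?u" using Rep_hyp3_ct_pos[of p] by (simp add: power2_less_imp_less)
  moreover have "r0\<^sup>2 < c0\<^sup>2" using c02 by simp
  then have "r0 < c0" by (simp add: power2_less_imp_less)
  ultimately have "rad ?u * r0 < ct ?u * c0"
    using Rep_hyp3_ct_pos[of p] by (intro mult_strict_mono) auto
  then show ?thesis by (simp add: ee_def)
qed

text \<open>For each angle \<open>\<theta>\<close> the second condition says that the point is within distance \<open>\<delta>\<close> of the
  half-spaces that touch the truncated ball along the edge with normal \<open>\<theta>\<close>; the angles run from the
  normal of the cutting plane to the normal of the ball.\<close>

definition body :: "hyp3 set" where
  "body = {p. tau (Rep_hyp3 p) \<le> C1 \<and> (\<forall>\<theta>\<in>{0..pi/4}. aa (Rep_hyp3 p) * sin \<theta> + bb (Rep_hyp3 p) * cos \<theta> \<le> s)}"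

definition sphere_part :: "mspace \<Rightarrow> bool" where "sphere_part u \<longleftrightarrow> bb u \<le> aa u \<and> tau u = C1"
definition tube_part :: "mspace \<Rightarrow> bool" where "tube_part u \<longleftrightarrow> 0 < aa u \<and> aa u < bb u \<and> (aa u)\<^sup>2 + (bb u)\<^sup>2 = s\<^sup>2"
definition flat_part :: "mspace \<Rightarrow> bool" where "flat_part u \<longleftrightarrow> aa u \<le> 0 \<and> aa u < bb u \<and> bb u = s"

definition surface :: "hyp3 set" where
  "surface = {p. sphere_part (Rep_hyp3 p) \<or> tube_part (Rep_hyp3 p) \<or> flat_part (Rep_hyp3 p)}"

lemma rotated_sum_square:
  fixes a b :: real
  shows "((a + b) / sqrt 2)\<^sup>2 + ((a - b) / sqrt 2)\<^sup>2 = a\<^sup>2 + b\<^sup>2"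
  by (simp add: power_divide power2_eq_square field_simps)

lemma h1_mult: "h1 * x = s0 * (x / sqrt 2)" by (simp add: h1_def)

lemma tau_less:
  assumes "(aa u)\<^sup>2 + (bb u)\<^sup>2 < s\<^sup>2" "u = Rep_hyp3 p"
  shows "tau u < C1"
proof -
  have "(ee u)\<^sup>2 < k\<^sup>2" using ee2[of p] assms k2 by simp
  then have "ee u < k" by (rule power2_less_imp_less) simp
  moreover have "((aa u + bb u) / sqrt 2)\<^sup>2 < s\<^sup>2"
    using rotated_sum_square[of "aa u" "bb u"] assms(1) by (smt (verit) zero_le_power2)
  then have "(aa u + bb u) / sqrt 2 < s" by (rule power2_less_imp_less) simp
  ultimately show ?thesis unfolding tau_eq C1_def h1_mult
    by (intro add_strict_mono mult_strict_left_mono) auto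
qed

lemma tau_ge:
  assumes "s \<le> (aa u + bb u) / sqrt 2" "u = Rep_hyp3 p"
  shows "C1 \<le> tau u" "s < (aa u + bb u) / sqrt 2 \<Longrightarrow> C1 < tau u"
proof -
  have "s\<^sup>2 \<le> ((aa u + bb u) / sqrt 2)\<^sup>2" using assms by (intro power_mono) auto
  then have "s\<^sup>2 \<le> (aa u)\<^sup>2 + (bb u)\<^sup>2"
    using rotated_sum_square[of "aa u" "bb u"] by (smt (verit) zero_le_power2)
  then have "k\<^sup>2 \<le> (ee u)\<^sup>2" using ee2[of p] assms k2 by simp
  then have k: "k \<le> ee u" by (rule power2_le_imp_le) (use ee_pos[of p] assms in simp)
  show "C1 \<le> tau u" unfolding tau_eq C1_def h1_mult
    using k assms by (intro add_mono mult_left_mono) auto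
  show "C1 < tau u" if "s < (aa u + bb u) / sqrt 2" unfolding tau_eq C1_def h1_mult
    using k that by (intro add_le_less_mono mult_left_mono mult_strict_left_mono) auto
qed

text \<open>The foot of the perpendicular to the cutting plane lies in the disk, hence in the ball, and at
  distance at most \<open>\<delta>\<close>. The inequality is strict because the perpendicular is radial only on the axis,
  where the disk is inside the ball.\<close>

lemma tau_less_flat:
  assumes "aa u \<le> 0" "0 < bb u" "bb u \<le> s" "u = Rep_hyp3 p"
  shows "tau u < C1"
proof -
  have "rad u * c0 \<le> ct u * r0" using assms by (simp add: aa_def)
  then have "(rad u * c0)\<^sup>2 \<le> (ct u * r0)\<^sup>2" by (intro power_mono) auto
  then have "((ct u)\<^sup>2 - (bb u)\<^sup>2 - 1) * c0\<^sup>2 \<le> (ct u)\<^sup>2 * (c0\<^sup>2 - 1)"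
    using Rep_hyp3_rad[of p] c02 assms(4) by (simp add: power_mult_distrib bb_def)
      (smt (verit) add_diff_cancel_right')
  then have "(ct u)\<^sup>2 \<le> (1 + (bb u)\<^sup>2) * c0\<^sup>2" by (simp add: algebra_simps)
  also have "\<dots> \<le> k\<^sup>2 * c0\<^sup>2" unfolding k2 using assms by (intro mult_right_mono add_left_mono power_mono) auto
  finally have "(ct u)\<^sup>2 \<le> (k * c0)\<^sup>2" by (simp add: power_mult_distrib)
  then have "ct u \<le> k * c0" by (rule power2_le_imp_le) simp
  then have "ct u * h2 \<le> (k * c0) * h2" by (intro mult_right_mono) auto
  also have "\<dots> = (c0 * h2) * k" by simp
  also have "\<dots> = C * k" unfolding c0h2 ..
  finally have "ct u * h2 \<le> C * k" .
  moreover have "bb u * h1 \<le> s * h1" using assms by (intro mult_right_mono) auto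
  moreover have "s * h1 < s0 * s"
  proof -
    have "1 < sqrt (2::real)" by simp
    then show ?thesis by (simp add: h1_def field_simps)
  qed
  ultimately show ?thesis unfolding tau_def C1_def bb_def by linarith
qed

text \<open>Such points lie above the cutting plane and inside the cone from the centre over the disk that is
  cut out, hence in the ball.\<close>

lemma tau_less_inner:
  assumes ab: "aa u \<le> bb u" "bb u \<le> 0" and u: "u = Rep_hyp3 p"
  shows "tau u < C1"
proof -
  define A B E where "A = - aa u" and "B = - bb u" and "E = ee u"
  have AB: "0 \<le> B" "B \<le> A" using ab by (auto simp: A_def B_def)
  have E: "0 < E" "E\<^sup>2 = 1 + A\<^sup>2 + B\<^sup>2" using ee_pos[of p] ee2[of p] u by (simp_all add: E_def A_def B_def)
  have E1: "1 \<le> E" by (rule power2_le_imp_le) (use E in auto)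
  have "0 \<le> c0 * aa u + r0 * ee u" using rad_eq[of u] rad_nonneg[of u] by simp
  then have A_le: "c0 * A \<le> r0 * E" by (simp add: A_def E_def)
  have "(E - 1) * (E + 1) = A\<^sup>2 + B\<^sup>2" using E by (simp add: power2_eq_square algebra_simps)
  also have "\<dots> \<le> A * (A + B)"
  proof -
    have "B * B \<le> A * B" using AB by (intro mult_right_mono) auto
    then show ?thesis by (simp add: power2_eq_square algebra_simps)
  qed
  finally have "c0 * ((E - 1) * (E + 1)) \<le> c0 * (A * (A + B))" by (intro mult_left_mono) auto
  also have "\<dots> \<le> (r0 * E) * (A + B)"
    using mult_right_mono[OF A_le, of "A + B"] AB by (simp add: mult_ac)
  also have "\<dots> \<le> (r0 * (E + 1)) * (A + B)" using AB by (intro mult_right_mono mult_left_mono) auto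
  finally have "(c0 * (E - 1)) * (E + 1) \<le> (r0 * (A + B)) * (E + 1)" by (simp add: mult_ac)
  then have "c0 * (E - 1) \<le> r0 * (A + B)" using E1 by (simp add: mult_le_cancel_right)
  then have "C * (c0 * (E - 1)) \<le> C * (r0 * (A + B))" by (intro mult_left_mono) auto
  also have "\<dots> = c0 * (h1 * (A + B))" by (simp add: mult.assoc[symmetric] Cr0)
  finally have "c0 * (C * (E - 1)) \<le> c0 * (h1 * (A + B))" by (simp add: mult_ac)
  then have "C * (E - 1) \<le> h1 * (A + B)" by simp
  then have "tau u \<le> C" by (simp add: tau_eq A_def B_def E_def algebra_simps)
  also have "C < C1"
  proof -
    have "1 \<le> k" by (rule power2_le_imp_le) (auto simp: k2)
    then have "C * 1 \<le> C * k" by (intro mult_left_mono) auto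
    moreover have "0 < s0 * s" by simp
    ultimately show ?thesis unfolding C1_def by linarith
  qed
  finally show ?thesis .
qed

text \<open>On the side of the sphere the constraint with angle \<open>\<pi>/4\<close> implies all the others.\<close>

lemma sum_le_of_upper:
  assumes "bb u \<le> aa u" "\<theta> \<in> {0..pi/4}"
  shows "aa u * sin \<theta> + bb u * cos \<theta> \<le> (aa u + bb u) / sqrt 2 * cos (pi / 4 - \<theta>)"
proof -
  have "0 \<le> sin (pi / 4 - \<theta>)" using assms by (intro sin_ge_zero) auto
  then have "0 \<le> (aa u - bb u) / sqrt 2 * sin (pi / 4 - \<theta>)" using assms(1) by simp
  then show ?thesis unfolding rotate_eighth by simp
qed

lemma cos_pos_octant:
  assumes "\<theta> \<in> {0..pi/4}"
  shows "0 < cos (pi / 4 - \<theta>)" "0 < cos \<theta>" "0 \<le> sin \<theta>"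
proof -
  have \<theta>: "0 \<le> \<theta>" "\<theta> \<le> pi / 4" using assms by auto
  show "0 < cos (pi / 4 - \<theta>)" "0 < cos \<theta>" using \<theta> pi_gt_zero by (intro cos_gt_zero_pi; linarith)+
  show "0 \<le> sin \<theta>" using \<theta> pi_gt_zero by (intro sin_ge_zero; linarith)
qed

lemma cauchy_2d: "a * sin \<theta> + b * cos \<theta> \<le> sqrt (a\<^sup>2 + b\<^sup>2)" for a b \<theta> :: real
proof -
  have "(a * sin \<theta> + b * cos \<theta>)\<^sup>2 + (a * cos \<theta> - b * sin \<theta>)\<^sup>2 = (a\<^sup>2 + b\<^sup>2) * ((sin \<theta>)\<^sup>2 + (cos \<theta>)\<^sup>2)"
    by algebra
  then have "(a * sin \<theta> + b * cos \<theta>)\<^sup>2 + (a * cos \<theta> - b * sin \<theta>)\<^sup>2 = a\<^sup>2 + b\<^sup>2" by simp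
  moreover have "0 \<le> (a * cos \<theta> - b * sin \<theta>)\<^sup>2" by simp
  ultimately have "(a * sin \<theta> + b * cos \<theta>)\<^sup>2 \<le> a\<^sup>2 + b\<^sup>2" by linarith
  then show ?thesis by (rule real_le_rsqrt)
qed

text \<open>On each part one constraint is active, and the others have to be checked there.\<close>

lemma surface_subset_body: "surface \<subseteq> body"
proof
  fix p assume p: "p \<in> surface"
  define u where "u = Rep_hyp3 p"
  consider (sphere) "sphere_part u" | (tube) "tube_part u" | (flat) "flat_part u"
    using p by (auto simp: surface_def u_def)
  then have "tau u \<le> C1 \<and> (\<forall>\<theta>\<in>{0..pi/4}. aa u * sin \<theta> + bb u * cos \<theta> \<le> s)"
  proof cases
    case sphere
    then have S: "bb u \<le> aa u" "tau u = C1" by (auto simp: sphere_part_def)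
    have v: "(aa u + bb u) / sqrt 2 \<le> s"
      using tau_ge(2)[of u p] S by (cases "(aa u + bb u) / sqrt 2 \<le> s") (auto simp: u_def)
    have "aa u * sin \<theta> + bb u * cos \<theta> \<le> s" if \<theta>: "\<theta> \<in> {0..pi/4}" for \<theta>
    proof -
      note sum_le_of_upper[OF S(1) \<theta>]
      also have "(aa u + bb u) / sqrt 2 * cos (pi / 4 - \<theta>) \<le> s * 1"
        using v cos_pos_octant(1)[OF \<theta>] by (intro mult_mono) auto
      finally show ?thesis by simp
    qed
    with S show ?thesis by simp
  next
    case tube
    then have T: "(aa u)\<^sup>2 + (bb u)\<^sup>2 = s\<^sup>2" by (auto simp: tube_part_def)
    have "(ee u)\<^sup>2 = k\<^sup>2" using ee2[of p] T k2 by (simp add: u_def)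
    then have E: "ee u = k" using ee_pos[of p] by (simp add: u_def power2_eq_iff_nonneg less_imp_le)
    have "((aa u + bb u) / sqrt 2)\<^sup>2 \<le> s\<^sup>2"
      using rotated_sum_square[of "aa u" "bb u"] T by (smt (verit) zero_le_power2)
    then have "(aa u + bb u) / sqrt 2 \<le> s" by (rule power2_le_imp_le) simp
    then have "tau u \<le> C1" unfolding tau_eq C1_def h1_mult E by (intro add_left_mono mult_left_mono) auto
    moreover have "aa u * sin \<theta> + bb u * cos \<theta> \<le> s" for \<theta>
      using cauchy_2d[of "aa u" \<theta> "bb u"] T by simp
    ultimately show ?thesis by simp
  next
    case flat
    then have F: "aa u \<le> 0" "bb u = s" by (auto simp: flat_part_def)
    have "aa u * sin \<theta> + bb u * cos \<theta> \<le> s" if \<theta>: "\<theta> \<in> {0..pi/4}" for \<theta>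
    proof -
      have "aa u * sin \<theta> \<le> 0" using F cos_pos_octant(3)[OF \<theta>] by (simp add: mult_nonpos_nonneg)
      moreover have "bb u * cos \<theta> \<le> s * 1" unfolding F by (intro mult_left_mono) auto
      ultimately show ?thesis by simp
    qed
    then show ?thesis using tau_less_flat[of u p] F by (simp add: u_def less_imp_le)
  qed
  then show "p \<in> body" by (simp add: body_def u_def)
qed

text \<open>A point where some constraint is active lies on one of the three parts. The sphere can only be active
  for \<open>aa \<ge> bb\<close>, and in the sector of the tube the constraint in the direction of the point itself
  gives the distance from the edge.\<close>

lemma body_minus_surface:
  assumes p: "p \<in> body" "p \<notin> surface"
  shows "tau (Rep_hyp3 p) < C1" "\<And>\<theta>. \<theta> \<in> {0..pi/4} \<Longrightarrow> aa (Rep_hyp3 p) * sin \<theta> + bb (Rep_hyp3 p) * cos \<theta> < s"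
proof -
  define u where "u = Rep_hyp3 p"
  have B: "tau u \<le> C1" "\<And>\<theta>. \<theta> \<in> {0..pi/4} \<Longrightarrow> aa u * sin \<theta> + bb u * cos \<theta> \<le> s"
    using p by (auto simp: body_def u_def)
  have N: "\<not> sphere_part u" "\<not> tube_part u" "\<not> flat_part u" using p by (auto simp: surface_def u_def)
  have b_le: "bb u \<le> s" using B(2)[of 0] by simp
  have tube: "(aa u)\<^sup>2 + (bb u)\<^sup>2 < s\<^sup>2" if ab: "0 < aa u" "aa u < bb u"
  proof -
    define \<sigma> where "\<sigma> = sqrt ((aa u)\<^sup>2 + (bb u)\<^sup>2)"
    obtain \<theta> where t: "0 < \<theta>" "\<theta> < pi / 4" "aa u = \<sigma> * sin \<theta>" "bb u = \<sigma> * cos \<theta>"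
      using polar_angle_first_octant[OF ab] unfolding \<sigma>_def by blast
    have "aa u * sin \<theta> + bb u * cos \<theta> = \<sigma> * ((sin \<theta>)\<^sup>2 + (cos \<theta>)\<^sup>2)"
      unfolding t(3,4) by algebra
    then have "\<sigma> \<le> s" using B(2)[of \<theta>] t(1,2) by simp
    then have "\<sigma>\<^sup>2 \<le> s\<^sup>2" by (rule power_mono) (simp add: \<sigma>_def)
    then have "(aa u)\<^sup>2 + (bb u)\<^sup>2 \<le> s\<^sup>2" by (simp add: \<sigma>_def)
    then show ?thesis using N(2) ab by (simp add: tube_part_def)
  qed
  have "tau u \<noteq> C1"
  proof
    assume eq: "tau u = C1"
    then have ab: "aa u < bb u" using N(1) by (auto simp: sphere_part_def)
    consider "0 < aa u" | "aa u \<le> 0" "0 < bb u" | "bb u \<le> 0" by linarith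
    then show False
    proof cases
      case 1 then show False using tau_less[OF tube u_def] ab eq by simp
    next
      case 2 then show False using tau_less_flat[OF _ _ b_le u_def] eq by simp
    next
      case 3 then show False using tau_less_inner[OF less_imp_le[OF ab] _ u_def] eq by simp
    qed
  qed
  then show t: "tau (Rep_hyp3 p) < C1" using B by (simp add: u_def)
  fix \<theta> :: real assume \<theta>: "\<theta> \<in> {0..pi/4}"
  have "aa u * sin \<theta> + bb u * cos \<theta> \<noteq> s"
  proof
    assume eq: "aa u * sin \<theta> + bb u * cos \<theta> = s"
    consider "bb u \<le> aa u" | "aa u < bb u" "0 < aa u" | "aa u < bb u" "aa u \<le> 0" by linarith
    then show False
    proof cases
      case 1
      define v where "v = (aa u + bb u) / sqrt 2"
      have "s \<le> v * cos (pi / 4 - \<theta>)" using sum_le_of_upper[OF 1 \<theta>] eq by (simp add: v_def)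
      moreover have "0 < v" using calculation cos_pos_octant(1)[OF \<theta>] pos(4)
        by (metis less_le_trans zero_less_mult_pos2)
      then have "v * cos (pi / 4 - \<theta>) \<le> v * 1" by (intro mult_left_mono) auto
      ultimately have "s \<le> v" by simp
      then show False using tau_ge(1)[OF _ u_def] t by (simp add: v_def u_def)
    next
      case 2
      have "sqrt ((aa u)\<^sup>2 + (bb u)\<^sup>2) < sqrt (s\<^sup>2)" using tube[OF 2(2,1)] by (rule real_sqrt_less_mono)
      then show False using cauchy_2d[of "aa u" \<theta> "bb u"] eq by simp
    next
      case 3
      have "aa u * sin \<theta> \<le> 0" using 3 cos_pos_octant(3)[OF \<theta>] by (simp add: mult_nonpos_nonneg)
      then have sb: "s \<le> bb u * cos \<theta>" using eq by simp
      then have "0 < bb u" using cos_pos_octant(2)[OF \<theta>] pos(4) by (metis less_le_trans zero_less_mult_pos2)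
      then have "bb u * cos \<theta> \<le> bb u * 1" by (intro mult_left_mono) auto
      then have "bb u = s" using sb b_le by simp
      then show False using N(3) 3 by (simp add: flat_part_def)
    qed
  qed
  then show "aa (Rep_hyp3 p) * sin \<theta> + bb (Rep_hyp3 p) * cos \<theta> < s" using B(2)[OF \<theta>] by (simp add: u_def)
qed

definition centre :: mspace where "centre = mvec 0 0 h1 h2"
text \<open>The nearest point of the edge circle, for \<open>u\<close> off the axis.\<close>

definition edge_point :: "mspace \<Rightarrow> mspace" where
  "edge_point u = mvec (r0 * (cx u / rad u)) (r0 * (cy u / rad u)) 0 c0"

text \<open>If the constraint \<open>mink x n \<le> c\<close> is active at \<open>u\<close>, then \<open>n + c u\<close> is orthogonal to \<open>u\<close> and has
  nonpositive product with all points of the body. The normal of the tube is written through its centre line instead, since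
  this form is easier to differentiate.\<close>

definition nuS :: "mspace \<Rightarrow> mspace" where "nuS u = (1 / S1) *\<^sub>R (C1 *\<^sub>R u - centre)"
definition nuT :: "mspace \<Rightarrow> mspace" where "nuT u = (1 / s) *\<^sub>R (k *\<^sub>R u - edge_point u)"
definition nuP :: "mspace \<Rightarrow> mspace" where "nuP u = (1 / k) *\<^sub>R (mvec 0 0 (- 1) 0 + s *\<^sub>R u)"
definition nu :: "mspace \<Rightarrow> mspace" where
  "nu u = (if bb u \<le> aa u then nuS u else if 0 < aa u then nuT u else nuP u)"

lemma mink_centre: "mink centre u = - tau u" by (simp add: mink_coord centre_def tau_def)

lemma tau_centre: "tau centre = 1"
  using h22 by (simp add: tau_def centre_def power2_eq_square)

lemma mink_centre_centre: "mink centre centre = - 1"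
  by (simp add: mink_centre tau_centre)

lemma mink_edge: "rad u \<noteq> 0 \<Longrightarrow> mink (edge_point u) u = - ee u"
proof -
  assume r: "rad u \<noteq> 0"
  have "mink (edge_point u) u = r0 * ((rad u)\<^sup>2 / rad u) - c0 * ct u"
    unfolding rad_square by (simp add: mink_coord edge_point_def power2_eq_square add_divide_distrib algebra_simps)
  then show ?thesis using r by (simp add: power2_eq_square ee_def mult_ac)
qed

lemma mink_edge_edge: "rad u \<noteq> 0 \<Longrightarrow> mink (edge_point u) (edge_point u) = - 1"
proof -
  assume r: "rad u \<noteq> 0"
  have "mink (edge_point u) (edge_point u) = r0\<^sup>2 * (((cx u)\<^sup>2 + (cy u)\<^sup>2) / (rad u)\<^sup>2) - c0\<^sup>2"
    by (simp add: mink_coord edge_point_def power2_eq_square add_divide_distrib algebra_simps)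
  also have "\<dots> = - 1" unfolding rad_square[symmetric] using r c02 by simp
  finally show ?thesis .
qed

lemma outward_nuS:
  assumes "sphere_part (Rep_hyp3 p)"
  shows "outward_unit_normal body p (nuS (Rep_hyp3 p))"
proof -
  let ?u = "Rep_hyp3 p"
  have t: "tau ?u = C1" using assms by (simp add: sphere_part_def)
  have "S1\<^sup>2 * mink (nuS ?u) (nuS ?u) = - C1\<^sup>2 + 2 * C1 * tau ?u - 1"
    by (simp add: nuS_def mink_simps(2-7) mink_centre mink_simps(1)[of ?u centre] tau_centre
        power2_eq_square field_simps)
  also have "\<dots> = S1\<^sup>2 * 1" using C12 by (simp add: t power2_eq_square)
  finally have "mink (nuS ?u) (nuS ?u) = 1" by (simp only: mult_cancel_left) simp
  moreover have "mink (nuS ?u) ?u = 0" by (simp add: nuS_def mink_simps(2-7) mink_centre t)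
  moreover have "mink (nuS ?u) (Rep_hyp3 x) \<le> 0" if "x \<in> body" for x
  proof -
    have "C1 * mink ?u (Rep_hyp3 x) \<le> C1 * (- 1)" by (intro mult_left_mono mink_le) auto
    moreover have "tau (Rep_hyp3 x) \<le> C1" using that by (simp add: body_def)
    ultimately show ?thesis by (simp add: nuS_def mink_simps(2-7) mink_centre divide_le_0_iff)
  qed
  ultimately show ?thesis by (simp add: outward_unit_normal_def)
qed

lemma tube_facts:
  assumes "tube_part (Rep_hyp3 p)"
  shows "ee (Rep_hyp3 p) = k" "0 < rad (Rep_hyp3 p)"
proof -
  let ?u = "Rep_hyp3 p"
  have "(ee ?u)\<^sup>2 = k\<^sup>2" using ee2[of p] assms k2 by (simp add: tube_part_def)
  then show "ee ?u = k" using ee_pos[of p] by (simp add: power2_eq_iff_nonneg less_imp_le)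
  then show "0 < rad ?u" unfolding rad_eq using assms by (simp add: tube_part_def add_pos_pos)
qed

lemma outward_nuT:
  assumes T: "tube_part (Rep_hyp3 p)"
  shows "outward_unit_normal body p (nuT (Rep_hyp3 p))"
proof -
  define u where "u = Rep_hyp3 p"
  have t: "0 < aa u" "aa u < bb u" "(aa u)\<^sup>2 + (bb u)\<^sup>2 = s\<^sup>2" using T by (auto simp: tube_part_def u_def)
  have E: "ee u = k" and r: "0 < rad u" using tube_facts[OF T] by (simp_all add: u_def)
  note r' = less_imp_neq[OF r, symmetric]
  have uu: "mink u u = - 1" by (simp add: u_def)
  have "s\<^sup>2 * mink (nuT u) (nuT u) = - k\<^sup>2 + 2 * k * ee u - 1"
    by (simp add: nuT_def mink_simps(2-7) mink_edge[OF r'] mink_simps(1)[of u "edge_point u"] mink_edge_edge[OF r']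
        uu power2_eq_square field_simps)
  also have "\<dots> = s\<^sup>2 * 1" using k2 by (simp add: E power2_eq_square)
  finally have "mink (nuT u) (nuT u) = 1" by (simp only: mult_cancel_left) simp
  moreover have "mink (nuT u) u = 0" by (simp add: nuT_def mink_simps(2-7) mink_edge[OF r'] E uu)
  moreover have "mink (nuT u) (Rep_hyp3 x) \<le> 0" if x: "x \<in> body" for x
  proof -
    define y where "y = Rep_hyp3 x"
    obtain \<theta> where th: "0 < \<theta>" "\<theta> < pi / 4" "aa u = s * sin \<theta>" "bb u = s * cos \<theta>"
      using polar_angle_first_octant[OF t(1,2)] unfolding t(3) by auto
    define i where "i = (cx u * cx y + cy u * cy y) / rad u"
    have i: "i \<le> rad y" using rad_inner_le[of u y] r by (simp add: i_def divide_le_eq mult.commute)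
    \<comment> \<open>\<open>k (k u - e) = (u - k e) + s\<^sup>2 u\<close>, and \<open>u - k e\<close> is \<open>s\<close> times the normal of the totally
      geodesic plane whose equidistant surface bounds the body at \<open>u\<close>.\<close>
    have "mink (u - k *\<^sub>R edge_point u) y = (rad u - k * r0) * i + cz u * cz y - (ct u - k * c0) * ct y"
      using r by (simp add: mink_coord edge_point_def i_def field_simps)
    also have "rad u - k * r0 = c0 * aa u" using rad_eq[of u] E by simp
    also have "ct u - k * c0 = r0 * aa u" using ct_eq[of u] E by (simp add: mult.commute)
    also have "c0 * aa u * i + cz u * cz y - r0 * aa u * ct y \<le> c0 * aa u * rad y + cz u * cz y - r0 * aa u * ct y"
      using i t by (simp add: mult_left_mono)
    also have "\<dots> = s * (aa y * sin \<theta> + bb y * cos \<theta>)"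
    proof -
      have "cz u = - (s * cos \<theta>)" using th(4) by (simp add: bb_def)
      then show ?thesis by (simp add: th(3) aa_def[of y] bb_def algebra_simps)
    qed
    also have "\<dots> \<le> s * s" using x th by (intro mult_left_mono) (auto simp: body_def y_def)
    finally have 1: "mink (u - k *\<^sub>R edge_point u) y \<le> s * s" .
    have "s\<^sup>2 * mink u y \<le> s\<^sup>2 * (- 1)" by (intro mult_left_mono) (auto simp: u_def y_def mink_le)
    then have "mink (u - k *\<^sub>R edge_point u) y + s\<^sup>2 * mink u y \<le> 0" using 1 by (simp add: power2_eq_square)
    moreover have "mink (u - k *\<^sub>R edge_point u) y + s\<^sup>2 * mink u y = (k * s) * mink (nuT u) y"
    proof -
      have "(k * s) * mink (nuT u) y = k\<^sup>2 * mink u y - k * mink (edge_point u) y"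
        by (simp add: nuT_def mink_simps(2-7) power2_eq_square algebra_simps)
      then show ?thesis unfolding k2 by (simp add: mink_simps(2-7) algebra_simps)
    qed
    ultimately have "(k * s) * mink (nuT u) y \<le> 0" by simp
    moreover have "0 < k * s" by simp
    ultimately have "mink (nuT u) y \<le> 0" by (metis linorder_not_less mult_pos_pos)
    then show ?thesis by (simp add: y_def)
  qed
  ultimately show ?thesis by (simp add: outward_unit_normal_def u_def)
qed

lemma outward_nuP:
  assumes "flat_part (Rep_hyp3 p)"
  shows "outward_unit_normal body p (nuP (Rep_hyp3 p))"
proof -
  let ?u = "Rep_hyp3 p" and ?n = "mvec 0 0 (- 1) 0"
  have b: "bb ?u = s" using assms by (simp add: flat_part_def)
  have n: "mink ?n (Rep_hyp3 x) = bb (Rep_hyp3 x)" "mink (Rep_hyp3 x) ?n = bb (Rep_hyp3 x)" "mink ?n ?n = 1" for x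
    by (simp_all add: mink_coord bb_def)
  have "k\<^sup>2 * mink (nuP ?u) (nuP ?u) = 1 + 2 * s * bb ?u - s\<^sup>2"
    by (simp add: nuP_def mink_simps(2-7) n power2_eq_square field_simps)
  also have "\<dots> = k\<^sup>2 * 1" using k2 by (simp add: b power2_eq_square)
  finally have "mink (nuP ?u) (nuP ?u) = 1" by (simp only: mult_cancel_left) simp
  moreover have "mink (nuP ?u) ?u = 0" by (simp add: nuP_def mink_simps(2-7) n b)
  moreover have "mink (nuP ?u) (Rep_hyp3 x) \<le> 0" if x: "x \<in> body" for x
  proof -
    have "s * mink ?u (Rep_hyp3 x) \<le> s * (- 1)" by (intro mult_left_mono mink_le) auto
    moreover have "bb (Rep_hyp3 x) \<le> s" using x by (auto simp: body_def dest: bspec[of _ _ 0])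
    ultimately show ?thesis by (simp add: nuP_def mink_simps(2-7) n divide_le_0_iff)
  qed
  ultimately show ?thesis by (simp add: outward_unit_normal_def)
qed

lemma outward_nu: "p \<in> surface \<Longrightarrow> outward_unit_normal body p (nu (Rep_hyp3 p))"
  using outward_nuS[of p] outward_nuT[of p] outward_nuP[of p]
  by (auto simp: surface_def nu_def sphere_part_def tube_part_def flat_part_def)

lemma continuous_on_aa [continuous_intros]: "continuous_on S f \<Longrightarrow> continuous_on S (\<lambda>x. aa (f x))"
  and continuous_on_bb [continuous_intros]: "continuous_on S f \<Longrightarrow> continuous_on S (\<lambda>x. bb (f x))"
  and continuous_on_tau [continuous_intros]: "continuous_on S f \<Longrightarrow> continuous_on S (\<lambda>x. tau (f x))"
  unfolding aa_def bb_def tau_def by (intro continuous_intros; assumption)+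

lemma closed_body: "closed body"
proof -
  have "body = {p. tau (Rep_hyp3 p) \<le> C1} \<inter>
      (\<Inter>\<theta>\<in>{0..pi/4}. {p. aa (Rep_hyp3 p) * sin \<theta> + bb (Rep_hyp3 p) * cos \<theta> \<le> s})"
    by (auto simp: body_def)
  also have "closed \<dots>"
    by (intro closed_Int closed_INT ballI closed_Collect_le continuous_intros)
  finally show ?thesis .
qed

text \<open>The angles form a compact set, so strict inequalities hold with a uniform margin.\<close>

lemma open_strict:
  assumes p: "tau (Rep_hyp3 p) < C1" "\<And>\<theta>. \<theta> \<in> {0..pi/4} \<Longrightarrow> aa (Rep_hyp3 p) * sin \<theta> + bb (Rep_hyp3 p) * cos \<theta> < s"
  shows "p \<in> interior body"
proof -
  have "compact ((\<lambda>\<theta>. aa (Rep_hyp3 p) * sin \<theta> + bb (Rep_hyp3 p) * cos \<theta>) ` {0..pi/4})" (is "compact ?I")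
    by (intro compact_continuous_image continuous_intros) auto
  then obtain m where m: "m \<in> ?I" "\<And>x. x \<in> ?I \<Longrightarrow> x \<le> m"
    using compact_attains_sup[of ?I] by auto
  define d where "d = (s - m) / 2"
  have "m < s" using m(1) p(2) by auto
  then have d: "0 < d" "m + 2 * d = s" by (auto simp: d_def field_simps)
  define V where "V = {x. tau (Rep_hyp3 x) < C1} \<inter> {x. \<bar>aa (Rep_hyp3 x) - aa (Rep_hyp3 p)\<bar> < d} \<inter>
    {x. \<bar>bb (Rep_hyp3 x) - bb (Rep_hyp3 p)\<bar> < d}"
  have "open V" unfolding V_def by (intro open_Int open_Collect_less continuous_intros)
  moreover have "p \<in> V" using p d by (simp add: V_def)
  moreover have "V \<subseteq> body"
  proof
    fix x assume x: "x \<in> V"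
    have "aa (Rep_hyp3 x) * sin \<theta> + bb (Rep_hyp3 x) * cos \<theta> \<le> s" if \<theta>: "\<theta> \<in> {0..pi/4}" for \<theta>
    proof -
      have "(aa (Rep_hyp3 x) - aa (Rep_hyp3 p)) * sin \<theta> \<le> d * 1"
        using x cos_pos_octant(3)[OF \<theta>] d by (intro mult_mono) (auto simp: V_def)
      moreover have "(bb (Rep_hyp3 x) - bb (Rep_hyp3 p)) * cos \<theta> \<le> d * 1"
        using x cos_pos_octant(2)[OF \<theta>] d by (intro mult_mono) (auto simp: V_def)
      moreover have "aa (Rep_hyp3 p) * sin \<theta> + bb (Rep_hyp3 p) * cos \<theta> \<le> m" using m(2) \<theta> by blast
      ultimately show ?thesis using d by (simp add: algebra_simps)
    qed
    then show "x \<in> body" using x by (simp add: body_def V_def)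
  qed
  ultimately show ?thesis by (rule interiorI)
qed

text \<open>Outward normals exist along the surface, hence none of its points is interior.\<close>

lemma frontier_body: "frontier body = surface"
proof -
  have "p \<in> interior body \<longleftrightarrow> p \<notin> surface" if "p \<in> body" for p
    using open_strict[of p] body_minus_surface[OF that] outward_normal_not_interior[OF outward_nu, of p] by blast
  moreover have "interior body \<subseteq> body" by (rule interior_subset)
  ultimately show ?thesis
    using surface_subset_body closed_body by (auto simp: frontier_def)
qed

lemma centre_in_interior: "Abs_hyp3 centre \<in> interior body"
proof -
  have R: "Rep_hyp3 (Abs_hyp3 centre) = centre"
    by (rule Rep_Abs_hyp3) (rule mink_centre_centre, simp add: centre_def)
  have "1 < C1"
  proof (rule power2_less_imp_less)
    show "1\<^sup>2 < C1\<^sup>2" unfolding C12 by simp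
  qed simp
  moreover have ab: "aa centre < 0" "bb centre < 0" by (simp_all add: aa_def bb_def centre_def rad_def zero_prod_def[symmetric])
  have "aa centre * sin \<theta> + bb centre * cos \<theta> < s" if \<theta>: "\<theta> \<in> {0..pi/4}" for \<theta>
  proof -
    have "aa centre * sin \<theta> \<le> 0" "bb centre * cos \<theta> \<le> 0"
      using ab cos_pos_octant[OF \<theta>] by (simp_all add: mult_nonpos_nonneg less_imp_le)
    then show ?thesis using pos(4) by linarith
  qed
  ultimately show ?thesis by (intro open_strict) (simp_all add: R tau_centre)
qed

lemma convex_body_body: "convex_body body"
  unfolding convex_body_def
proof (intro conjI)
  show "body \<noteq> {}" using centre_in_interior interior_subset by blast
  show "closed body" by (rule closed_body)
  have R: "Rep_hyp3 (Abs_hyp3 centre) = centre"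
    by (rule Rep_Abs_hyp3) (rule mink_centre_centre, simp add: centre_def)
  show "bounded body"
    unfolding bounded_def
  proof (intro exI ballI)
    fix x assume x: "x \<in> body"
    have "cosh (dist (Abs_hyp3 centre) x) = tau (Rep_hyp3 x)" by (simp add: cosh_dist_hyp3 R mink_centre)
    then have "cosh (dist (Abs_hyp3 centre) x) \<le> C1" using x by (simp add: body_def)
    moreover have "(dist (Abs_hyp3 centre) x)\<^sup>2 / 2 \<le> cosh (dist (Abs_hyp3 centre) x) - 1"
      by (rule half_square_le_cosh)
    ultimately have "(dist (Abs_hyp3 centre) x)\<^sup>2 \<le> 2 * C1" by simp
    then show "dist (Abs_hyp3 centre) x \<le> sqrt (2 * C1)" by (rule real_le_rsqrt)
  qed
  have "body = {p. tau (Rep_hyp3 p) \<le> C1} \<inter>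
      (\<Inter>\<theta>\<in>{0..pi/4}. {p. aa (Rep_hyp3 p) * sin \<theta> + bb (Rep_hyp3 p) * cos \<theta> \<le> s})"
    by (auto simp: body_def)
  also have "geodesically_convex \<dots>"
  proof (intro geodesically_convex_Int geodesically_convex_INT)
    show "geodesically_convex {p. tau (Rep_hyp3 p) \<le> C1}"
      by (rule geodesically_convex_sublevel) (auto simp: tau_def algebra_simps)
    fix \<theta> :: real assume \<theta>: "\<theta> \<in> {0..pi/4}"
    show "geodesically_convex {p. aa (Rep_hyp3 p) * sin \<theta> + bb (Rep_hyp3 p) * cos \<theta> \<le> s}"
    proof (rule geodesically_convex_sublevel)
      fix l m :: real and u v assume lm: "0 \<le> l" "0 \<le> m"
      have "rad (l *\<^sub>R u + m *\<^sub>R v) * (c0 * sin \<theta>) \<le> (l * rad u + m * rad v) * (c0 * sin \<theta>)"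
        using cos_pos_octant(3)[OF \<theta>] by (intro mult_right_mono rad_sublinear lm) auto
      then show "aa (l *\<^sub>R u + m *\<^sub>R v) * sin \<theta> + bb (l *\<^sub>R u + m *\<^sub>R v) * cos \<theta>
        \<le> l * (aa u * sin \<theta> + bb u * cos \<theta>) + m * (aa v * sin \<theta> + bb v * cos \<theta>)"
        by (simp add: aa_def bb_def algebra_simps)
    qed simp
  qed
  finally show "geodesically_convex body" .
qed

end

section \<open>Regularity of the boundary\<close>

definition loc_lipschitz :: "'a::metric_space \<Rightarrow> ('a \<Rightarrow> 'b::metric_space) \<Rightarrow> bool" where
  "loc_lipschitz p g \<longleftrightarrow> (\<exists>U L. open U \<and> p \<in> U \<and> L-lipschitz_on U g)"

lemma loc_lipschitzI: "open U \<Longrightarrow> p \<in> U \<Longrightarrow> L-lipschitz_on U g \<Longrightarrow> loc_lipschitz p g"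
  unfolding loc_lipschitz_def by blast

lemma loc_lipschitz_const: "loc_lipschitz p (\<lambda>_. c)"
  by (rule loc_lipschitzI[of UNIV _ 0]) (auto intro: lipschitz_intros)

lemma loc_lipschitz_add:
  fixes f g :: "'a::metric_space \<Rightarrow> 'b::real_normed_vector"
  assumes "loc_lipschitz p f" "loc_lipschitz p g" shows "loc_lipschitz p (\<lambda>x. f x + g x)"
proof -
  obtain U V L M where *: "open U" "p \<in> U" "L-lipschitz_on U f" "open V" "p \<in> V" "M-lipschitz_on V g"
    using assms unfolding loc_lipschitz_def by blast
  have "(L + M)-lipschitz_on (U \<inter> V) (\<lambda>x. f x + g x)"
    by (intro lipschitz_on_add lipschitz_on_subset[OF *(3)] lipschitz_on_subset[OF *(6)]) auto
  then show ?thesis using * by (intro loc_lipschitzI[of "U \<inter> V"]) auto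
qed

lemma loc_lipschitz_scaleR:
  fixes f :: "'a::metric_space \<Rightarrow> real" and g :: "'a \<Rightarrow> 'b::real_normed_vector"
  assumes "loc_lipschitz p f" "loc_lipschitz p g" shows "loc_lipschitz p (\<lambda>x. f x *\<^sub>R g x)"
proof -
  obtain U V L M where *: "open U" "p \<in> U" "L-lipschitz_on U f" "open V" "p \<in> V" "M-lipschitz_on V g"
    using assms unfolding loc_lipschitz_def by blast
  define W where "W = U \<inter> V \<inter> ball p 1"
  have LM: "0 \<le> L" "0 \<le> M" using * lipschitz_on_nonneg by blast+
  define A B where "A = \<bar>f p\<bar> + L" and "B = norm (g p) + M"
  have AB: "\<bar>f x\<bar> \<le> A" "norm (g x) \<le> B" if x: "x \<in> W" for x
  proof -
    have d: "dist x p \<le> 1" using x by (simp add: W_def dist_commute less_imp_le)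
    have "dist (f x) (f p) \<le> L * 1"
      using lipschitz_onD[OF *(3), of x p] * x d LM mult_left_mono[OF d LM(1)] by (simp add: W_def)
    then show "\<bar>f x\<bar> \<le> A" by (simp add: A_def dist_real_def)
    have "dist (g x) (g p) \<le> M * 1"
      using lipschitz_onD[OF *(6), of x p] * x d LM mult_left_mono[OF d LM(2)] by (simp add: W_def)
    then show "norm (g x) \<le> B" using norm_triangle_sub[of "g x" "g p"] by (simp add: B_def dist_norm)
  qed
  have "(A * M + L * B)-lipschitz_on W (\<lambda>x. f x *\<^sub>R g x)"
  proof (rule lipschitz_onI)
    fix x y assume xy: "x \<in> W" "y \<in> W"
    have "f x *\<^sub>R g x - f y *\<^sub>R g y = f x *\<^sub>R (g x - g y) + (f x - f y) *\<^sub>R g y" by (simp add: algebra_simps)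
    then have "dist (f x *\<^sub>R g x) (f y *\<^sub>R g y) \<le> \<bar>f x\<bar> * dist (g x) (g y) + dist (f x) (f y) * norm (g y)"
      by (metis dist_norm dist_real_def norm_scaleR norm_triangle_ineq)
    also have "\<dots> \<le> A * (M * dist x y) + (L * dist x y) * B"
    proof (intro add_mono mult_mono)
      have xy': "x \<in> U" "y \<in> U" "x \<in> V" "y \<in> V" using xy by (simp_all add: W_def)
      show "dist (g x) (g y) \<le> M * dist x y" by (rule lipschitz_onD[OF *(6) xy'(3,4)])
      show "dist (f x) (f y) \<le> L * dist x y" by (rule lipschitz_onD[OF *(3) xy'(1,2)])
    qed (use AB[OF xy(1)] AB[OF xy(2)] LM in \<open>simp_all add: A_def\<close>)
    finally show "dist (f x *\<^sub>R g x) (f y *\<^sub>R g y) \<le> (A * M + L * B) * dist x y" by (simp add: algebra_simps)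
  qed (use LM in \<open>auto simp: A_def B_def intro!: add_nonneg_nonneg mult_nonneg_nonneg\<close>)
  then show ?thesis using * by (intro loc_lipschitzI[of W]) (auto simp: W_def)
qed

lemma loc_lipschitz_compose:
  assumes f: "loc_lipschitz p f" and g: "loc_lipschitz (f p) g" shows "loc_lipschitz p (\<lambda>x. g (f x))"
proof -
  obtain U V L M where *: "open U" "p \<in> U" "L-lipschitz_on U f" "open V" "f p \<in> V" "M-lipschitz_on V g"
    using assms unfolding loc_lipschitz_def by blast
  have "open (U \<inter> f -` V)"
    using * lipschitz_on_continuous_on[OF *(3)] by (metis continuous_open_preimage)
  moreover have "(M * L)-lipschitz_on (U \<inter> f -` V) (\<lambda>x. g (f x))"
    by (rule lipschitz_on_compose2[OF lipschitz_on_subset[OF *(3)] lipschitz_on_subset[OF *(6)]]) auto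
  ultimately show ?thesis using * by (intro loc_lipschitzI[of "U \<inter> f -` V"]) auto
qed

lemma loc_lipschitz_has_derivative:
  fixes f :: "'a::real_normed_vector \<Rightarrow> 'b::real_normed_vector"
  assumes f: "\<forall>\<^sub>F x in nhds p. (f has_derivative blinfun_apply (f' x)) (at x)" and f': "loc_lipschitz p f'"
  shows "loc_lipschitz p f"
proof -
  obtain U where U: "open U" "p \<in> U" "\<And>x. x \<in> U \<Longrightarrow> (f has_derivative blinfun_apply (f' x)) (at x)"
    using f unfolding eventually_nhds by blast
  obtain V L where V: "open V" "p \<in> V" "L-lipschitz_on V f'" using f' unfolding loc_lipschitz_def by blast
  obtain r where r: "0 < r" "ball p r \<subseteq> U \<inter> V" using U V by (metis IntI open_Int open_contains_ball)
  have L: "0 \<le> L" using V lipschitz_on_nonneg by blast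
  define B where "B = norm (f' p) + L * r"
  have b: "onorm (blinfun_apply (f' x)) \<le> B" if x: "x \<in> ball p r" for x
  proof -
    have "dist (f' x) (f' p) \<le> L * dist x p" using lipschitz_onD[OF V(3), of x p] x r V by auto
    also have "\<dots> \<le> L * r" using x L by (intro mult_left_mono) (auto simp: dist_commute)
    finally show ?thesis using norm_triangle_sub[of "f' x" "f' p"]
      by (simp add: B_def dist_norm norm_blinfun.rep_eq[symmetric])
  qed
  have "B-lipschitz_on (ball p r) f"
  proof (rule bounded_derivative_imp_lipschitz)
    show "(f has_derivative blinfun_apply (f' x)) (at x within ball p r)" if "x \<in> ball p r" for x
    proof -
      have "x \<in> U" using r(2) that by blast
      from U(3)[OF this] show ?thesis by (rule has_derivative_at_withinI)
    qed
    show "convex (ball p r)" by (rule convex_ball)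
    show "onorm (blinfun_apply (f' x)) \<le> B" if "x \<in> ball p r" for x by (rule b[OF that])
    show "0 \<le> B" using L r(1) by (simp add: B_def)
  qed
  then show ?thesis using r(1) by (intro loc_lipschitzI[of "ball p r"]) auto
qed

text \<open>The class of functions with locally Lipschitz derivative is closed under sums, products and
  composition, so that membership of the defining functions below can be read off their form.\<close>

definition C11_at :: "('a::real_normed_vector \<Rightarrow> real) \<Rightarrow> 'a \<Rightarrow> bool" where
  "C11_at f p \<longleftrightarrow> (\<exists>f'. (\<forall>\<^sub>F x in nhds p. (f has_derivative blinfun_apply (f' x)) (at x)) \<and> loc_lipschitz p f')"

lemma C11_at_loc_lipschitz: "C11_at f p \<Longrightarrow> loc_lipschitz p f"
  unfolding C11_at_def using loc_lipschitz_has_derivative by blast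

lemma C11_at_const: "C11_at (\<lambda>_. c) p"
  unfolding C11_at_def by (rule exI[of _ "\<lambda>_. 0"]) (auto intro: loc_lipschitz_const simp: zero_blinfun.rep_eq)

lemma C11_at_linear: "bounded_linear f \<Longrightarrow> C11_at f p"
  unfolding C11_at_def
  by (rule exI[of _ "\<lambda>_. Blinfun f"])
     (auto intro: loc_lipschitz_const bounded_linear.has_derivative simp: bounded_linear_Blinfun_apply bounded_linear_imp_has_derivative)

lemma C11_at_add:
  assumes "C11_at f p" "C11_at g p" shows "C11_at (\<lambda>x. f x + g x) p"
proof -
  obtain f' g' where *: "\<forall>\<^sub>F x in nhds p. (f has_derivative blinfun_apply (f' x)) (at x)" "loc_lipschitz p f'"
    "\<forall>\<^sub>F x in nhds p. (g has_derivative blinfun_apply (g' x)) (at x)" "loc_lipschitz p g'"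
    using assms unfolding C11_at_def by blast
  have "\<forall>\<^sub>F x in nhds p. ((\<lambda>x. f x + g x) has_derivative blinfun_apply (f' x + g' x)) (at x)"
    using *(1,3) by eventually_elim (auto simp: plus_blinfun.rep_eq[abs_def] intro!: derivative_eq_intros)
  then show ?thesis unfolding C11_at_def using loc_lipschitz_add[OF *(2,4)]
    by (intro exI[of _ "\<lambda>x. f' x + g' x"] conjI)
qed

lemma C11_at_mult:
  assumes "C11_at f p" "C11_at g p" shows "C11_at (\<lambda>x. f x * g x) p"
proof -
  obtain f' g' where *: "\<forall>\<^sub>F x in nhds p. (f has_derivative blinfun_apply (f' x)) (at x)" "loc_lipschitz p f'"
    "\<forall>\<^sub>F x in nhds p. (g has_derivative blinfun_apply (g' x)) (at x)" "loc_lipschitz p g'"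
    using assms unfolding C11_at_def by blast
  have "\<forall>\<^sub>F x in nhds p. ((\<lambda>x. f x * g x) has_derivative blinfun_apply (f x *\<^sub>R g' x + g x *\<^sub>R f' x)) (at x)"
    using *(1,3)
    by eventually_elim (auto simp: plus_blinfun.rep_eq scaleR_blinfun.rep_eq mult.commute intro!: derivative_eq_intros)
  moreover have "loc_lipschitz p (\<lambda>x. f x *\<^sub>R g' x + g x *\<^sub>R f' x)"
    using assms * by (intro loc_lipschitz_add loc_lipschitz_scaleR C11_at_loc_lipschitz)
  ultimately show ?thesis unfolding C11_at_def by (intro exI[of _ "\<lambda>x. f x *\<^sub>R g' x + g x *\<^sub>R f' x"] conjI)
qed

lemma C11_at_compose:
  fixes f :: "'a::real_normed_vector \<Rightarrow> real" and h h' :: "real \<Rightarrow> real"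
  assumes f: "C11_at f p" and h: "\<forall>\<^sub>F x in nhds (f p). (h has_real_derivative h' x) (at x)"
    and h': "loc_lipschitz (f p) h'"
  shows "C11_at (\<lambda>x. h (f x)) p"
proof -
  obtain f' where *: "\<forall>\<^sub>F x in nhds p. (f has_derivative blinfun_apply (f' x)) (at x)" "loc_lipschitz p f'"
    using f unfolding C11_at_def by blast
  have lf: "loc_lipschitz p f" by (rule C11_at_loc_lipschitz[OF f])
  have "isCont f p"
    using eventually_nhds_x_imp_x[OF *(1)] by (rule has_derivative_continuous)
  then have "filterlim f (nhds (f p)) (nhds p)"
    by (simp add: isCont_def tendsto_at_iff_tendsto_nhds)
  then have "\<forall>\<^sub>F x in nhds p. (h has_real_derivative h' (f x)) (at (f x))"
    using h by (rule eventually_compose_filterlim[rotated])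
  then have "\<forall>\<^sub>F x in nhds p. ((\<lambda>x. h (f x)) has_derivative blinfun_apply (h' (f x) *\<^sub>R f' x)) (at x)"
    using *(1)
  proof eventually_elim
    case (elim x)
    have "((\<lambda>x. h (f x)) has_derivative (\<lambda>y. h' (f x) * blinfun_apply (f' x) y)) (at x)"
      using has_derivative_compose[OF elim(2), of h "\<lambda>y. h' (f x) * y"] elim(1)
      by (simp add: has_field_derivative_def)
    then show ?case by (simp add: scaleR_blinfun.rep_eq[abs_def])
  qed
  moreover have "loc_lipschitz p (\<lambda>x. h' (f x) *\<^sub>R f' x)"
    by (rule loc_lipschitz_scaleR[OF loc_lipschitz_compose[OF lf h'] *(2)])
  ultimately show ?thesis unfolding C11_at_def by (intro exI[of _ "\<lambda>x. h' (f x) *\<^sub>R f' x"] conjI)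
qed

lemma C11_at_sqrt:
  assumes f: "C11_at f p" and pos: "0 < f p" shows "C11_at (\<lambda>x. sqrt (f x)) p"
proof (rule C11_at_compose[OF f])
  show "\<forall>\<^sub>F x in nhds (f p). (sqrt has_real_derivative inverse (sqrt x) / 2) (at x)"
    using pos by (intro eventually_mono[OF eventually_nhds_in_open[of "{0<..}"]]) (auto intro: DERIV_real_sqrt)
  let ?U = "{f p / 2<..}"
  define B where "B = inverse (sqrt (f p / 2)) * inverse (f p / 2) / 4"
  have "B-lipschitz_on ?U (\<lambda>x. inverse (sqrt x) / 2)"
  proof (rule bounded_derivative_imp_lipschitz)
    fix x assume x: "x \<in> ?U"
    then have x0: "0 < x" using pos by auto
    have "((\<lambda>x. inverse (sqrt x) / 2) has_real_derivative - (inverse (sqrt x) * inverse x / 4)) (at x)"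
      using x0 by (auto intro!: derivative_eq_intros simp: field_simps power2_eq_square)
    then show "((\<lambda>x. inverse (sqrt x) / 2) has_derivative (*) (- (inverse (sqrt x) * inverse x / 4))) (at x within ?U)"
      unfolding has_field_derivative_def by (rule has_derivative_at_withinI)
    have "inverse (sqrt x) * inverse x / 4 \<le> B"
      unfolding B_def using x pos by (intro divide_right_mono mult_mono le_imp_inverse_le) auto
    moreover have "0 \<le> inverse (sqrt x) * inverse x / 4" using x0 by simp
    ultimately have "\<bar>- (inverse (sqrt x) * inverse x / 4)\<bar> \<le> B" by linarith
    then show "onorm ((*) (- (inverse (sqrt x) * inverse x / 4))) \<le> B"
      by (intro onorm_le) (simp only: real_norm_def abs_mult[of "- _"] mult_right_mono[OF _ abs_ge_zero])
  qed (use pos in \<open>auto simp: B_def\<close>)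
  then show "loc_lipschitz (f p) (\<lambda>x. inverse (sqrt x) / 2)"
    using pos by (intro loc_lipschitzI[of ?U]) auto
qed

text \<open>Squares of positive parts are the device for gluing two surfaces along a common tangent plane.\<close>

lemma DERIV_positive_part_square: "((\<lambda>x::real. (max 0 x)\<^sup>2) has_real_derivative 2 * max 0 x) (at x)"
proof -
  consider "x < 0" | "0 < x" | "x = 0" by linarith
  then show ?thesis
  proof cases
    case 1
    have "((\<lambda>x::real. 0) has_real_derivative 0) (at x)" by simp
    then have "((\<lambda>x::real. (max 0 x)\<^sup>2) has_real_derivative 0) (at x)"
      by (rule has_field_derivative_transform_within_open[of _ _ _ "{..<0}"]) (use 1 in auto)
    then show ?thesis using 1 by simp
  next
    case 2
    have "((\<lambda>x::real. x\<^sup>2) has_real_derivative 2 * x) (at x)" by (auto intro!: derivative_eq_intros)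
    then have "((\<lambda>x::real. (max 0 x)\<^sup>2) has_real_derivative 2 * x) (at x)"
      by (rule has_field_derivative_transform_within_open[of _ _ _ "{0<..}"]) (use 2 in auto)
    then show ?thesis using 2 by simp
  next
    case 3
    have "((\<lambda>h. (max 0 (h::real))\<^sup>2 / h) \<longlongrightarrow> 0) (at 0)"
    proof (rule Lim_null_comparison)
      show "\<forall>\<^sub>F h in at 0. norm ((max 0 (h::real))\<^sup>2 / h) \<le> \<bar>h\<bar>"
        by (rule always_eventually) (auto simp: max_def power2_eq_square)
      show "((\<lambda>h::real. \<bar>h\<bar>) \<longlongrightarrow> 0) (at 0)" using tendsto_rabs_zero[OF tendsto_ident_at] .
    qed
    then show ?thesis unfolding 3 by (simp add: DERIV_def)
  qed
qed

lemma C11_at_positive_part_square: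
  assumes f: "C11_at f p" shows "C11_at (\<lambda>x. (max 0 (f x))\<^sup>2) p"
proof (rule C11_at_compose[OF f])
  show "\<forall>\<^sub>F x in nhds (f p). ((\<lambda>x. (max 0 x)\<^sup>2) has_real_derivative 2 * max 0 x) (at x)"
    by (intro always_eventually allI DERIV_positive_part_square)
  have "2-lipschitz_on UNIV (\<lambda>x::real. 2 * max 0 x)"
    by (rule lipschitz_onI) (auto simp: dist_real_def max_def abs_if)
  then show "loc_lipschitz (f p) (\<lambda>x. 2 * max 0 x)" by (intro loc_lipschitzI[of UNIV]) auto
qed

lemma C11_at_cmult: "C11_at f p \<Longrightarrow> C11_at (\<lambda>x. c * f x) p"
  by (intro C11_at_mult C11_at_const)

lemma C11_at_diff: "C11_at f p \<Longrightarrow> C11_at g p \<Longrightarrow> C11_at (\<lambda>x. f x - g x) p"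
  using C11_at_add[OF _ C11_at_cmult, of f p g "- 1"] by simp

lemma C11_at_power2: "C11_at f p \<Longrightarrow> C11_at (\<lambda>x. (f x)\<^sup>2) p"
  unfolding power2_eq_square by (rule C11_at_mult)

lemma C11_at_divide_const: "C11_at f p \<Longrightarrow> C11_at (\<lambda>x. f x / c) p"
  using C11_at_cmult[of f p "inverse c"] by (simp add: field_simps)

lemmas C11_at_coord = bounded_linear_coord[THEN C11_at_linear]

lemma C11_at_rad: assumes "0 < rad p" shows "C11_at rad p"
proof -
  have eq: "rad = (\<lambda>u. sqrt ((cx u)\<^sup>2 + (cy u)\<^sup>2))" by (rule ext) (simp add: rad_def norm_Pair)
  have "0 < (cx p)\<^sup>2 + (cy p)\<^sup>2" using assms rad_square[of p] by (metis zero_less_power)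
  then show ?thesis unfolding eq by (intro C11_at_sqrt C11_at_add C11_at_power2 C11_at_coord)
qed

text \<open>Regularity of a level set is tested along one line, so that the derivative of the defining function
  never has to be written down.\<close>

lemma derivative_along_line:
  fixes f :: "'a::real_normed_vector \<Rightarrow> real"
  assumes f: "(f has_derivative F) (at p)" and g: "\<forall>\<^sub>F t in nhds 0. f (p + t *\<^sub>R v) = g t"
    and D: "(g has_real_derivative D) (at 0)"
  shows "F v = D"
proof -
  have "((\<lambda>t. p + t *\<^sub>R v) has_derivative (\<lambda>t. t *\<^sub>R v)) (at 0)" by (auto intro!: derivative_eq_intros)
  then have "((\<lambda>t. f (p + t *\<^sub>R v)) has_derivative (\<lambda>t. F (t *\<^sub>R v))) (at 0)"
    using has_derivative_compose[of "\<lambda>t. p + t *\<^sub>R v" _ 0 UNIV f F] f by simp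
  then have "((\<lambda>t. f (p + t *\<^sub>R v)) has_real_derivative F v) (at 0)"
    using has_derivative_bounded_linear[OF f] by (simp add: has_field_derivative_def bounded_linear.linear linear_cmul mult.commute[of _ "F v"])
  moreover have "((\<lambda>t. f (p + t *\<^sub>R v)) has_real_derivative D) (at 0)"
    using g D by (subst DERIV_cong_ev[OF refl _ refl]) auto
  ultimately show ?thesis by (rule DERIV_unique)
qed

lemma C11_surfaceI:
  assumes "\<And>p. p \<in> \<Gamma> \<Longrightarrow> \<exists>U f v g D. open U \<and> Rep_hyp3 p \<in> U \<and> C11_at f (Rep_hyp3 p) \<and> mink v (Rep_hyp3 p) = 0 \<and>
     (\<forall>\<^sub>F t in nhds 0. f (Rep_hyp3 p + t *\<^sub>R v) = g t) \<and> (g has_real_derivative D) (at 0) \<and> D \<noteq> 0 \<and>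
     (\<forall>q. Rep_hyp3 q \<in> U \<longrightarrow> (q \<in> \<Gamma> \<longleftrightarrow> f (Rep_hyp3 q) = 0))"
  shows "C11_surface \<Gamma>"
  unfolding C11_surface_def
proof
  fix p assume "p \<in> \<Gamma>"
  from assms[OF this] obtain U f v g D where *: "open U" "Rep_hyp3 p \<in> U" "C11_at f (Rep_hyp3 p)" "mink v (Rep_hyp3 p) = 0"
    "\<forall>\<^sub>F t in nhds 0. f (Rep_hyp3 p + t *\<^sub>R v) = g t" "(g has_real_derivative D) (at 0)" "D \<noteq> 0"
    "\<And>q. Rep_hyp3 q \<in> U \<Longrightarrow> (q \<in> \<Gamma> \<longleftrightarrow> f (Rep_hyp3 q) = 0)" by blast
  obtain f' where f': "\<forall>\<^sub>F x in nhds (Rep_hyp3 p). (f has_derivative blinfun_apply (f' x)) (at x)" "loc_lipschitz (Rep_hyp3 p) f'"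
    using *(3) unfolding C11_at_def by blast
  obtain V where V: "open V" "Rep_hyp3 p \<in> V" "\<And>x. x \<in> V \<Longrightarrow> (f has_derivative blinfun_apply (f' x)) (at x)"
    using f'(1) unfolding eventually_nhds by blast
  obtain W L where W: "open W" "Rep_hyp3 p \<in> W" "L-lipschitz_on W f'" using f'(2) unfolding loc_lipschitz_def by blast
  have "blinfun_apply (f' (Rep_hyp3 p)) v = D"
    by (rule derivative_along_line[OF V(3)[OF V(2)] *(5,6)])
  then have v: "blinfun_apply (f' (Rep_hyp3 p)) v \<noteq> 0" using *(7) by simp
  define X where "X = U \<inter> V \<inter> W"
  have X: "open X" "Rep_hyp3 p \<in> X" using * V W by (auto simp: X_def)
  have df: "\<forall>x\<in>X. (f has_derivative blinfun_apply (f' x)) (at x)" using V(3) by (auto simp: X_def)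
  have lip: "L-lipschitz_on X f'" unfolding X_def by (rule lipschitz_on_subset[OF W(3)]) auto
  have zero: "\<forall>q. Rep_hyp3 q \<in> X \<longrightarrow> (q \<in> \<Gamma>) = (f (Rep_hyp3 q) = 0)" using *(8) by (auto simp: X_def)
  show "\<exists>U (f :: mspace \<Rightarrow> real) (f' :: mspace \<Rightarrow> mspace \<Rightarrow>\<^sub>L real) L. open U \<and> Rep_hyp3 p \<in> U \<and> (\<forall>x\<in>U. (f has_derivative blinfun_apply (f' x)) (at x)) \<and>
      L-lipschitz_on U f' \<and> (\<exists>v. mink v (Rep_hyp3 p) = 0 \<and> blinfun_apply (f' (Rep_hyp3 p)) v \<noteq> 0) \<and>
      (\<forall>q. Rep_hyp3 q \<in> U \<longrightarrow> (q \<in> \<Gamma>) = (f (Rep_hyp3 q) = 0))"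
    using X df lip *(4) v zero by blast
qed

context cap_body begin

lemma C11_at_aa: "0 < rad p \<Longrightarrow> C11_at aa p"
  unfolding aa_def[abs_def] using C11_at_diff[OF C11_at_cmult[OF C11_at_rad] C11_at_cmult[OF C11_at_coord(4)], of p c0 r0]
  by (simp add: mult.commute)

lemma bounded_linear_bb: "bounded_linear bb" unfolding bb_def[abs_def]
  by (intro bounded_linear_minus bounded_linear_coord)

lemma bounded_linear_tau: "bounded_linear tau" unfolding tau_def[abs_def]
  by (intro bounded_linear_sub bounded_linear_coord bounded_linear_compose[OF bounded_linear_mult_left])

lemmas C11_at_bb = bounded_linear_bb[THEN C11_at_linear]

text \<open>The functions \<open>aa\<close> and \<open>bb\<close> vanish at the edge point, so along the normal of the tube they are
  only scaled. The line stays in the half-plane of \<open>u\<close> for small \<open>t\<close>, where \<open>rad\<close> is linear.\<close>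

lemma nuT_line:
  assumes r: "0 < rad u"
  shows "\<forall>\<^sub>F t in nhds 0. 0 < 1 + t * (k / s) \<and> aa (u + t *\<^sub>R nuT u) = (1 + t * (k / s)) * aa u \<and>
     bb (u + t *\<^sub>R nuT u) = (1 + t * (k / s)) * bb u"
proof -
  define m where "m = (k - r0 / rad u) / s"
  have c: "cx (nuT u) = m * cx u" "cy (nuT u) = m * cy u"
    by (simp_all add: nuT_def edge_point_def m_def field_simps)
  have "\<forall>\<^sub>F t in nhds (0::real). 0 < 1 + t * m \<and> 0 < 1 + t * (k / s)"
  proof -
    have "open {t::real. 0 < 1 + t * m \<and> 0 < 1 + t * (k / s)}"
      by (intro open_Collect_conj open_Collect_less continuous_intros)
    then show ?thesis using eventually_nhds_in_open[of "{t::real. 0 < 1 + t * m \<and> 0 < 1 + t * (k / s)}" 0] by simp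
  qed
  then show ?thesis
  proof eventually_elim
    case (elim t)
    have "rad (u + t *\<^sub>R nuT u) = norm ((1 + t * m) *\<^sub>R (cx u, cy u))"
      by (simp add: rad_def c algebra_simps)
    also have "\<dots> = (1 + t * m) * rad u" using elim by (simp only: norm_scaleR rad_def) simp
    finally have R: "rad (u + t *\<^sub>R nuT u) = (1 + t * m) * rad u" .
    have "rad (u + t *\<^sub>R nuT u) = rad u + t * (m * rad u)" using R by (simp add: algebra_simps)
    also have "m * rad u = (k * rad u - r0) / s" using r by (simp add: m_def field_simps)
    finally have R': "rad (u + t *\<^sub>R nuT u) = rad u + t * ((k * rad u - r0) / s)" .
    have T: "ct (u + t *\<^sub>R nuT u) = ct u + t * ((k * ct u - c0) / s)"
      by (simp add: nuT_def edge_point_def)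
    have "aa (u + t *\<^sub>R nuT u) = (1 + t * (k / s)) * aa u"
      unfolding aa_def R' T by (simp add: field_simps)
    moreover have "bb (u + t *\<^sub>R nuT u) = (1 + t * (k / s)) * bb u"
      by (simp add: bb_def nuT_def edge_point_def field_simps)
    ultimately show ?case using elim by simp
  qed
qed

lemma nuT_orthogonal: "0 < rad (Rep_hyp3 p) \<Longrightarrow> ee (Rep_hyp3 p) = k \<Longrightarrow> mink (nuT (Rep_hyp3 p)) (Rep_hyp3 p) = 0"
  by (simp add: nuT_def mink_simps(2-7) mink_edge)

lemma rad_pos: "0 \<le> aa (Rep_hyp3 p) \<Longrightarrow> 0 < rad (Rep_hyp3 p)"
  unfolding rad_eq using ee_pos[of p] by (simp add: add_nonneg_pos)

text \<open>Away from the two seams the surface is the level set of \<open>tau\<close>, of \<open>bb\<close>, or of \<open>aa\<^sup>2 + bb\<^sup>2\<close>. Replacing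
  \<open>aa\<close> by its positive part covers the seam between tube and flat part. At the seam between sphere and
  tube the coordinates \<open>v\<close> and \<open>w\<close> along and across the common normal are used. On the hyperboloid the
  sphere is given by \<open>(v - s) (v + K) + C\<^sup>2 w\<^sup>2 = 0\<close> and the tube by \<open>(v - s) (v + s) + w\<^sup>2 = 0\<close>. After
  multiplication by \<open>v + s\<close> and \<open>v + K\<close> these functions agree for \<open>w = 0\<close>, so only the terms with \<open>w\<^sup>2\<close>
  have to be switched.\<close>

lemma C11_surface_surface: "C11_surface surface"
proof (rule C11_surfaceI)
  fix p assume p: "p \<in> surface"
  define u where "u = Rep_hyp3 p"
  have uu: "mink u u = - 1" by (simp add: u_def)
  consider "bb u < aa u" | "aa u < bb u" "aa u < 0" | "aa u < bb u" "0 \<le> aa u" | "aa u = bb u" by linarith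
  then have "\<exists>U f v g D. open U \<and> u \<in> U \<and> C11_at f u \<and> mink v u = 0 \<and>
     (\<forall>\<^sub>F t in nhds 0. f (u + t *\<^sub>R v) = g t) \<and> (g has_real_derivative D) (at 0) \<and> D \<noteq> 0 \<and>
     (\<forall>q. Rep_hyp3 q \<in> U \<longrightarrow> (q \<in> surface \<longleftrightarrow> f (Rep_hyp3 q) = 0))"
  proof cases
    case 1
    then have t: "tau u = C1" using p by (auto simp: surface_def sphere_part_def tube_part_def flat_part_def u_def)
    have "open {w. bb w < aa w}" by (intro open_Collect_less continuous_intros)
    moreover have "C11_at (\<lambda>w. tau w - C1) u"
      by (intro C11_at_diff C11_at_const C11_at_linear bounded_linear_tau)
    moreover have "mink (nuS u) u = 0" by (simp add: nuS_def mink_simps(2-7) mink_centre t uu)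
    moreover have tl: "tau (nuS u) = S1"
    proof -
      have "S1 * tau (nuS u) = C1 * tau u - tau centre" by (simp add: nuS_def tau_def algebra_simps)
      also have "\<dots> = S1 * S1" using C12 by (simp add: t tau_centre power2_eq_square)
      finally show ?thesis by simp
    qed
    have "tau (u + t *\<^sub>R nuS u) - C1 = t * S1" for t
    proof -
      have "tau (u + t *\<^sub>R nuS u) = tau u + t * tau (nuS u)" by (simp add: tau_def algebra_simps)
      then show ?thesis by (simp add: t tl)
    qed
    moreover have "((\<lambda>t. t * S1) has_real_derivative S1) (at 0)" by (auto intro!: derivative_eq_intros)
    moreover have "q \<in> surface \<longleftrightarrow> tau (Rep_hyp3 q) - C1 = 0" if "bb (Rep_hyp3 q) < aa (Rep_hyp3 q)" for q
      using that by (auto simp: surface_def sphere_part_def tube_part_def flat_part_def)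
    ultimately show ?thesis using 1
      by (intro exI[of _ "{w. bb w < aa w}"] exI[of _ "\<lambda>w. tau w - C1"] exI[of _ "nuS u"] exI[of _ "\<lambda>t. t * S1"] exI[of _ S1]) auto
  next
    case 2
    then have t: "bb u = s" using p by (auto simp: surface_def sphere_part_def tube_part_def flat_part_def u_def)
    have "open {w. aa w < bb w \<and> aa w < 0}" by (intro open_Collect_conj open_Collect_less continuous_intros)
    moreover have "C11_at (\<lambda>w. bb w - s) u" by (intro C11_at_diff C11_at_const C11_at_bb)
    moreover have "mink (nuP u) u = 0"
      using t by (simp add: nuP_def mink_simps(2-7) uu) (simp add: mink_coord bb_def)
    moreover have "bb (u + t *\<^sub>R nuP u) - s = t * k" for t
    proof -
      have "bb (u + t *\<^sub>R nuP u) = bb u + t * ((1 + s * bb u) / k)" by (simp add: bb_def nuP_def field_simps)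
      also have "(1 + s * bb u) / k = k" using k2 by (simp add: t power2_eq_square nonzero_divide_eq_eq)
      finally show ?thesis by (simp add: t)
    qed
    moreover have "((\<lambda>t. t * k) has_real_derivative k) (at 0)" by (auto intro!: derivative_eq_intros)
    moreover have "q \<in> surface \<longleftrightarrow> bb (Rep_hyp3 q) - s = 0"
      if "aa (Rep_hyp3 q) < bb (Rep_hyp3 q)" "aa (Rep_hyp3 q) < 0" for q
      using that by (auto simp: surface_def sphere_part_def tube_part_def flat_part_def)
    ultimately show ?thesis using 2
      by (intro exI[of _ "{w. aa w < bb w \<and> aa w < 0}"] exI[of _ "\<lambda>w. bb w - s"] exI[of _ "nuP u"] exI[of _ "\<lambda>t. t * k"] exI[of _ k]) auto
  next
    case 3
    have r: "0 < rad u" using 3 rad_pos by (simp add: u_def)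
    have sq: "(max 0 (aa u))\<^sup>2 + (bb u)\<^sup>2 = s\<^sup>2" "(aa u)\<^sup>2 + (bb u)\<^sup>2 = s\<^sup>2"
      using p 3 by (auto simp: surface_def sphere_part_def tube_part_def flat_part_def u_def)
    have "(ee u)\<^sup>2 = k\<^sup>2" using ee2[of p] sq k2 by (simp add: u_def)
    then have E: "ee u = k" using ee_pos[of p] by (simp add: u_def power2_eq_iff_nonneg less_imp_le)
    define f where "f w = (max 0 (aa w))\<^sup>2 + (bb w)\<^sup>2 - s\<^sup>2" for w
    define U where "U = {w. aa w < bb w \<and> 0 < bb w}"
    define g where "g t = (1 + t * (k / s))\<^sup>2 * s\<^sup>2 - s\<^sup>2" for t
    have "open U" unfolding U_def by (intro open_Collect_conj open_Collect_less continuous_intros)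
    moreover have "u \<in> U" using 3 by (simp add: U_def)
    moreover have "C11_at f u" unfolding f_def[abs_def]
      by (intro C11_at_diff C11_at_add C11_at_const C11_at_positive_part_square C11_at_power2 C11_at_bb C11_at_aa r)
    moreover have "mink (nuT u) u = 0" using nuT_orthogonal[of p] r E by (simp add: u_def)
    moreover have "\<forall>\<^sub>F t in nhds 0. f (u + t *\<^sub>R nuT u) = g t"
      using nuT_line[OF r]
    proof eventually_elim
      case (elim t)
      define c where "c = 1 + t * (k / s)"
      have c: "0 < c" "aa (u + t *\<^sub>R nuT u) = c * aa u" "bb (u + t *\<^sub>R nuT u) = c * bb u"
        using elim unfolding c_def by auto
      have "max 0 (c * aa u) = c * max 0 (aa u)" using c(1) 3 by (simp add: max_def)
      then have "f (u + t *\<^sub>R nuT u) = c\<^sup>2 * ((max 0 (aa u))\<^sup>2 + (bb u)\<^sup>2) - s\<^sup>2"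
        unfolding f_def c(2,3) by (simp add: power_mult_distrib algebra_simps)
      then show ?case by (simp only: sq g_def c_def)
    qed
    moreover have "(g has_real_derivative 2 * k * s) (at 0)" unfolding g_def[abs_def]
      by (auto intro!: derivative_eq_intros simp: power2_eq_square)
    moreover have "q \<in> surface \<longleftrightarrow> f (Rep_hyp3 q) = 0" if "Rep_hyp3 q \<in> U" for q
    proof (cases "0 < aa (Rep_hyp3 q)")
      case True
      then show ?thesis using that by (auto simp: U_def f_def surface_def sphere_part_def tube_part_def flat_part_def)
    next
      case False
      then have "f (Rep_hyp3 q) = (bb (Rep_hyp3 q))\<^sup>2 - s\<^sup>2" by (simp add: f_def max_def)
      moreover have "(bb (Rep_hyp3 q))\<^sup>2 = s\<^sup>2 \<longleftrightarrow> bb (Rep_hyp3 q) = s"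
        using that by (intro power2_eq_iff_nonneg) (auto simp: U_def)
      ultimately show ?thesis using that False
        by (auto simp: U_def surface_def sphere_part_def tube_part_def flat_part_def)
    qed
    moreover have "2 * k * s \<noteq> 0" by simp
    ultimately show ?thesis by blast
  next
    case 4
    define v w where "v x = (aa x + bb x) / sqrt 2" and "w x = (aa x - bb x) / sqrt 2" for x
    have t: "tau u = C1" using p 4 by (auto simp: surface_def sphere_part_def tube_part_def flat_part_def u_def)
    have E2: "(ee (Rep_hyp3 q))\<^sup>2 = 1 + (v (Rep_hyp3 q))\<^sup>2 + (w (Rep_hyp3 q))\<^sup>2" for q
      using ee2[of q] rotated_sum_square[of "aa (Rep_hyp3 q)" "bb (Rep_hyp3 q)"] by (simp add: v_def w_def)
    have T: "tau x = C * ee x + s0 * v x" for x unfolding tau_eq h1_mult v_def ..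
    have w0: "w u = 0" using 4 by (simp add: w_def)
    have ab: "(aa u)\<^sup>2 + (bb u)\<^sup>2 = (v u)\<^sup>2"
      using rotated_sum_square[of "aa u" "bb u"] w0 by (simp add: v_def w_def)
    have b0: "0 < bb u"
      using tau_less_inner[of u p] 4 t by (cases "bb u \<le> 0") (auto simp: u_def)
    then have v0: "0 < v u" using 4 by (simp add: v_def)
    have vs: "v u = s"
    proof (rule ccontr)
      assume ne: "v u \<noteq> s"
      have "\<not> s < v u" using tau_ge(2)[of u p] t by (auto simp: v_def u_def)
      then have "(v u)\<^sup>2 < s\<^sup>2" using ne v0 by (intro power_strict_mono) auto
      then show False using tau_less[of u p] ab t by (simp add: u_def)
    qed
    have "(ee u)\<^sup>2 = k\<^sup>2" using ee2[of p] ab vs k2 by (simp add: u_def)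
    then have E: "ee u = k" using ee_pos[of p] by (simp add: u_def power2_eq_iff_nonneg less_imp_le)
    have r: "0 < rad u" using rad_pos[of p] 4 b0 by (simp add: u_def)
    define K where "K = s + 2 * C1 * s0"
    have K: "0 < K" by (simp add: K_def add_pos_pos)
    define f where "f x = ((v x)\<^sup>2 - s\<^sup>2 + (max 0 (- w x))\<^sup>2) * (v x + K) + C\<^sup>2 * (max 0 (w x))\<^sup>2 * (v x + s)" for x
    define U where "U = {x. 0 < aa x \<and> 0 < bb x \<and> s0 * ((aa x + bb x) / sqrt 2) < C1}"
    define g where "g t = (((1 + t * (k / s)) * s)\<^sup>2 - s\<^sup>2) * ((1 + t * (k / s)) * s + K)" for t
    have "open U" unfolding U_def by (intro open_Collect_conj open_Collect_less continuous_intros) auto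
    moreover have "u \<in> U" using 4 b0 vs by (simp add: U_def v_def[symmetric] C1_def)
    moreover have "C11_at f u" unfolding f_def[abs_def] v_def w_def minus_divide_left minus_diff_eq
      by (intro C11_at_diff C11_at_add C11_at_mult C11_at_const C11_at_positive_part_square C11_at_power2
          C11_at_divide_const C11_at_bb C11_at_aa r)
    moreover have "mink (nuT u) u = 0" using nuT_orthogonal[of p] r E by (simp add: u_def)
    moreover have "\<forall>\<^sub>F t in nhds 0. f (u + t *\<^sub>R nuT u) = g t"
      using nuT_line[OF r]
    proof eventually_elim
      case (elim t)
      define c where "c = 1 + t * (k / s)"
      have c: "aa (u + t *\<^sub>R nuT u) = c * aa u" "bb (u + t *\<^sub>R nuT u) = c * bb u"
        using elim unfolding c_def by auto
      have "v (u + t *\<^sub>R nuT u) = c * v u" unfolding v_def c by (simp add: distrib_left)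
      moreover have "w (u + t *\<^sub>R nuT u) = 0" unfolding w_def c using 4 by simp
      ultimately show ?case unfolding f_def g_def c_def[symmetric] vs by simp
    qed
    moreover have "(g has_real_derivative 2 * k * s * (s + K)) (at 0)" unfolding g_def[abs_def]
      by (auto intro!: derivative_eq_intros simp: power2_eq_square algebra_simps)
    moreover have "2 * k * s * (s + K) \<noteq> 0" using K pos by (simp add: add_pos_pos less_imp_neq[symmetric])
    moreover have "q \<in> surface \<longleftrightarrow> f (Rep_hyp3 q) = 0" if "Rep_hyp3 q \<in> U" for q
    proof -
      define x where "x = Rep_hyp3 q"
      have x: "0 < aa x" "0 < bb x" "s0 * v x < C1" using that by (auto simp: U_def x_def v_def)
      have vx: "0 < v x" using x by (simp add: v_def)
      show ?thesis
      proof (cases "aa x < bb x")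
        case True
        then have "w x < 0" by (simp add: w_def divide_less_0_iff)
        then have "f x = ((v x)\<^sup>2 + (w x)\<^sup>2 - s\<^sup>2) * (v x + K)" by (simp add: f_def max_def algebra_simps)
        also have "(v x)\<^sup>2 + (w x)\<^sup>2 = (aa x)\<^sup>2 + (bb x)\<^sup>2" unfolding v_def w_def by (rule rotated_sum_square)
        finally have "f x = 0 \<longleftrightarrow> (aa x)\<^sup>2 + (bb x)\<^sup>2 = s\<^sup>2" using vx K by simp
        then show ?thesis using True x
          by (auto simp: surface_def sphere_part_def tube_part_def flat_part_def x_def)
      next
        case False
        then have "0 \<le> w x" by (simp add: w_def)
        then have "f x = (v x + s) * ((v x - s) * (v x + K) + C\<^sup>2 * (w x)\<^sup>2)"
          by (simp add: f_def max_def power2_eq_square algebra_simps)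
        \<comment> \<open>On the hyperboloid the second factor is a difference of two squares.\<close>
        also have "(v x - s) * (v x + K) + C\<^sup>2 * (w x)\<^sup>2 = (C * ee x)\<^sup>2 - (C1 - s0 * v x)\<^sup>2"
        proof -
          have "(C1 - s0 * s)\<^sup>2 = C\<^sup>2 * k\<^sup>2" by (simp add: C1_def power_mult_distrib)
          then have "(C1 - s0 * s)\<^sup>2 = C\<^sup>2 + C\<^sup>2 * s\<^sup>2" unfolding k2 by (simp add: algebra_simps)
          then have "C1\<^sup>2 = C\<^sup>2 + C\<^sup>2 * s\<^sup>2 + 2 * C1 * s0 * s - s0\<^sup>2 * s\<^sup>2"
            by (simp add: power2_eq_square algebra_simps)
          then have C1': "C1\<^sup>2 = C\<^sup>2 + s\<^sup>2 + 2 * C1 * s0 * s" by (simp add: C2 algebra_simps)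
          have "(C * ee x)\<^sup>2 - (C1 - s0 * v x)\<^sup>2 =
              C\<^sup>2 * (1 + (v x)\<^sup>2 + (w x)\<^sup>2) - C1\<^sup>2 + 2 * C1 * s0 * v x - s0\<^sup>2 * (v x)\<^sup>2"
            using E2[of q] by (simp add: power_mult_distrib x_def power2_diff algebra_simps)
          then show ?thesis unfolding C1' K_def C2 by (simp add: power2_eq_square algebra_simps)
        qed
        finally have "f x = 0 \<longleftrightarrow> (C * ee x)\<^sup>2 = (C1 - s0 * v x)\<^sup>2" using vx pos by (simp add: add_pos_pos less_imp_neq[symmetric])
        also have "\<dots> \<longleftrightarrow> C * ee x = C1 - s0 * v x"
          using x ee_pos[of q] by (intro power2_eq_iff_nonneg) (auto simp: x_def)
        also have "\<dots> \<longleftrightarrow> tau x = C1" using T[of x] by auto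
        finally show ?thesis using False
          by (auto simp: surface_def sphere_part_def tube_part_def flat_part_def x_def)
      qed
    qed
    ultimately show ?thesis by blast
  qed
  then show "\<exists>U f v g D. open U \<and> Rep_hyp3 p \<in> U \<and> C11_at f (Rep_hyp3 p) \<and> mink v (Rep_hyp3 p) = 0 \<and>
     (\<forall>\<^sub>F t in nhds 0. f (Rep_hyp3 p + t *\<^sub>R v) = g t) \<and> (g has_real_derivative D) (at 0) \<and> D \<noteq> 0 \<and>
     (\<forall>q. Rep_hyp3 q \<in> U \<longrightarrow> (q \<in> surface \<longleftrightarrow> f (Rep_hyp3 q) = 0))"
    unfolding u_def .
qed
end

section \<open>Mean curvature of the boundary\<close>

text \<open>An orthonormal frame of Minkowski space is a basis, since taking products with it is a surjective
  linear map.\<close>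

lemma mink_parseval:
  assumes p: "mink p p = - 1" and n: "mink n n = 1" "mink n p = 0"
    and e: "mink e1 e1 = 1" "mink e2 e2 = 1" "mink e1 e2 = 0" "mink e1 p = 0" "mink e1 n = 0" "mink e2 p = 0" "mink e2 n = 0"
    and u: "mink u p = 0" "mink u n = 0"
  shows "(mink e1 u)\<^sup>2 + (mink e2 u)\<^sup>2 = mink u u"
proof -
  define T where "T x = mvec (mink x p) (mink x n) (mink x e1) (mink x e2)" for x
  have lin: "linear T"
    by (rule linearI; rule mspace_eqI) (simp_all add: T_def mink_simps(2-7))
  note sym = mink_simps(1)[of p n] mink_simps(1)[of p e1] mink_simps(1)[of p e2] mink_simps(1)[of n e1]
    mink_simps(1)[of n e2] mink_simps(1)[of e2 e1]
  have "y \<in> range T" for y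
  proof -
    have "T ((- cx y) *\<^sub>R p + cy y *\<^sub>R n + cz y *\<^sub>R e1 + ct y *\<^sub>R e2) = y"
      by (rule mspace_eqI) (simp_all add: T_def mink_simps(2-7) p n e sym)
    then show ?thesis by (metis rangeI)
  qed
  then have "surj T" by blast
  then have inj: "inj T" using lin linear_surjective_imp_injective by blast
  define w where "w = u - mink e1 u *\<^sub>R e1 - mink e2 u *\<^sub>R e2"
  have "T w = T 0"
    by (rule mspace_eqI)
      (simp_all add: T_def w_def mink_simps(2-7) e u mink_simps(1)[of e2 e1] mink_simps(1)[of u e1] mink_simps(1)[of u e2],
       simp_all add: mink_def)
  then have "w = 0" by (rule injD[OF inj])
  then have "u = mink e1 u *\<^sub>R e1 + mink e2 u *\<^sub>R e2" by (simp add: w_def algebra_simps)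
  then have "mink u u = mink (mink e1 u *\<^sub>R e1 + mink e2 u *\<^sub>R e2) u" by simp
  then show ?thesis by (simp add: mink_simps(2-7) power2_eq_square)
qed

lemma has_derivative_coord [derivative_intros]:
  "(cx has_derivative cx) F" "(cy has_derivative cy) F" "(cz has_derivative cz) F" "(ct has_derivative ct) F"
  by (intro bounded_linear_imp_has_derivative bounded_linear_coord)+

lemma has_derivative_rad:
  assumes "0 < rad u"
  shows "(rad has_derivative (\<lambda>h. (cx u * cx h + cy u * cy h) / rad u)) (at u)"
proof -
  have eq: "rad = (\<lambda>u. sqrt ((cx u)\<^sup>2 + (cy u)\<^sup>2))" by (rule ext) (simp add: rad_def norm_Pair)
  have "0 < (cx u)\<^sup>2 + (cy u)\<^sup>2" using assms rad_square[of u] by (metis zero_less_power)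
  then have 1: "(sqrt has_derivative (*) (inverse (sqrt ((cx u)\<^sup>2 + (cy u)\<^sup>2)) / 2)) (at ((cx u)\<^sup>2 + (cy u)\<^sup>2))"
    using DERIV_real_sqrt by (simp add: has_field_derivative_def)
  have 2: "((\<lambda>u. (cx u)\<^sup>2 + (cy u)\<^sup>2) has_derivative (\<lambda>h. 2 * (cx u * cx h + cy u * cy h))) (at u)"
    by (auto intro!: derivative_eq_intros simp: algebra_simps)
  have "((\<lambda>u. sqrt ((cx u)\<^sup>2 + (cy u)\<^sup>2)) has_derivative
      (\<lambda>h. inverse (sqrt ((cx u)\<^sup>2 + (cy u)\<^sup>2)) / 2 * (2 * (cx u * cx h + cy u * cy h)))) (at u)"
    by (rule has_derivative_compose[OF 2 1])
  also have "(\<lambda>h. inverse (sqrt ((cx u)\<^sup>2 + (cy u)\<^sup>2)) / 2 * (2 * (cx u * cx h + cy u * cy h))) =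
      (\<lambda>h. (cx u * cx h + cy u * cy h) / sqrt ((cx u)\<^sup>2 + (cy u)\<^sup>2))"
  proof
    have "inverse x / 2 * (2 * y) = y / x" for x y :: real
      by (cases "x = 0") (auto simp: field_simps)
    then show "inverse (sqrt ((cx u)\<^sup>2 + (cy u)\<^sup>2)) / 2 * (2 * (cx u * cx h + cy u * cy h)) =
      (cx u * cx h + cy u * cy h) / sqrt ((cx u)\<^sup>2 + (cy u)\<^sup>2)" for h by blast
  qed
  finally have "((\<lambda>u. sqrt ((cx u)\<^sup>2 + (cy u)\<^sup>2)) has_derivative
      (\<lambda>h. (cx u * cx h + cy u * cy h) / sqrt ((cx u)\<^sup>2 + (cy u)\<^sup>2))) (at u)" .
  then show ?thesis unfolding eq .
qed

lemma mvec_eq: "mvec x y z t = x *\<^sub>R mvec 1 0 0 0 + y *\<^sub>R mvec 0 1 0 0 + z *\<^sub>R mvec 0 0 1 0 + t *\<^sub>R mvec 0 0 0 1"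
  by (rule mspace_eqI) simp_all

text \<open>The unit tangent vector of the parallel circle through \<open>u\<close>.\<close>

definition e\<phi> :: "mspace \<Rightarrow> mspace" where "e\<phi> u = mvec (- (cy u / rad u)) (cx u / rad u) 0 0"

context cap_body begin

text \<open>Moving along a parallel circle rotates the nearest point of the edge, scaled by the ratio of the
  radii; the other directions do not move it.\<close>

lemma has_derivative_edge_point:
  assumes r: "0 < rad u"
  shows "(edge_point has_derivative (\<lambda>h. (r0 / rad u * mink h (e\<phi> u)) *\<^sub>R e\<phi> u)) (at u)"
proof -
  let ?D = "\<lambda>h. (r0 * ((cx h * rad u - cx u * ((cx u * cx h + cy u * cy h) / rad u)) / (rad u * rad u))) *\<^sub>R mvec 1 0 0 0
     + (r0 * ((cy h * rad u - cy u * ((cx u * cx h + cy u * cy h) / rad u)) / (rad u * rad u))) *\<^sub>R mvec 0 1 0 0"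
  have "(edge_point has_derivative ?D) (at u)"
  proof -
    have eq: "edge_point = (\<lambda>u. (r0 * (cx u / rad u)) *\<^sub>R mvec 1 0 0 0 + (r0 * (cy u / rad u)) *\<^sub>R mvec 0 1 0 0 + c0 *\<^sub>R mvec 0 0 0 1)"
      unfolding edge_point_def[abs_def] by (rule ext, subst mvec_eq) simp
    show ?thesis unfolding eq using r
      by (auto intro!: derivative_eq_intros has_derivative_rad has_derivative_divide' simp: right_diff_distrib mult.assoc)
  qed
  moreover have "?D = (\<lambda>h. (r0 / rad u * mink h (e\<phi> u)) *\<^sub>R e\<phi> u)"
  proof
    fix h
    have R: "rad u * rad u = cx u * cx u + cy u * cy u" using rad_square[of u] by (simp add: power2_eq_square)
    have 1: "cx h * rad u - cx u * ((cx u * cx h + cy u * cy h) / rad u) = - cy u * (cx u * cy h - cy u * cx h) / rad u"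
      using r R by (simp add: field_simps, (simp add: algebra_simps)?)
    have 2: "cy h * rad u - cy u * ((cx u * cx h + cy u * cy h) / rad u) = cx u * (cx u * cy h - cy u * cx h) / rad u"
      using r R by (simp add: field_simps, (simp add: algebra_simps)?)
    show "?D h = (r0 / rad u * mink h (e\<phi> u)) *\<^sub>R e\<phi> u"
      unfolding 1 2 by (rule mspace_eqI) (use r in \<open>simp_all add: e\<phi>_def mink_coord field_simps\<close>)
  qed
  ultimately show ?thesis by simp
qed

text \<open>The normal field only matters near the point, where one of its three branches applies.\<close>

lemma has_mean_curvatureI:
  assumes p: "p \<in> surface" and N: "(N has_derivative A) (at (Rep_hyp3 p))"
    and W: "open W" "Rep_hyp3 p \<in> W" "\<And>x. x \<in> W \<Longrightarrow> nu x = N x"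
    and tr: "\<And>e1 e2. mink e1 e1 = 1 \<Longrightarrow> mink e2 e2 = 1 \<Longrightarrow> mink e1 e2 = 0 \<Longrightarrow> mink e1 (Rep_hyp3 p) = 0 \<Longrightarrow>
       mink e2 (Rep_hyp3 p) = 0 \<Longrightarrow> mink e1 (nu (Rep_hyp3 p)) = 0 \<Longrightarrow> mink e2 (nu (Rep_hyp3 p)) = 0 \<Longrightarrow>
       h = mink (A e1) e1 + mink (A e2) e2"
  shows "has_mean_curvature body p h"
  unfolding has_mean_curvature_def
proof (intro exI conjI ballI allI impI)
  show "outward_unit_normal body q (nu (Rep_hyp3 q))" if "q \<in> frontier body" for q
    using that outward_nu by (simp add: frontier_body)
  have "(nu has_derivative A) (at (Rep_hyp3 p))"
    by (rule has_derivative_transform_within_open[OF N W(1,2)]) (simp add: W(3))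
  then show "(nu has_derivative A) (at (Rep_hyp3 p) within Rep_hyp3 ` frontier body)"
    by (rule has_derivative_at_withinI)
  fix e1 e2
  assume "mink e1 e1 = 1 \<and> mink e2 e2 = 1 \<and> mink e1 e2 = 0 \<and>
     (\<forall>e\<in>{e1, e2}. mink e (Rep_hyp3 p) = 0 \<and> mink e (nu (Rep_hyp3 p)) = 0)"
  then show "h = mink (A e1) e1 + mink (A e2) e2" by (intro tr) auto
qed

lemma mean_curvature_sphere:
  assumes p: "p \<in> surface" "bb (Rep_hyp3 p) < aa (Rep_hyp3 p)"
  shows "has_mean_curvature body p (2 * C1 / S1)"
proof (rule has_mean_curvatureI[OF p(1), of nuS "\<lambda>h. (C1 / S1) *\<^sub>R h" "{x. bb x < aa x}"])
  show "(nuS has_derivative (\<lambda>h. (C1 / S1) *\<^sub>R h)) (at (Rep_hyp3 p))"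
    unfolding nuS_def[abs_def] by (auto intro!: derivative_eq_intros)
  show "open {x. bb x < aa x}" by (intro open_Collect_less continuous_intros)
qed (use p in \<open>auto simp: nu_def mink_simps(6)\<close>)

lemma mean_curvature_flat:
  assumes p: "p \<in> surface" "aa (Rep_hyp3 p) < bb (Rep_hyp3 p)" "aa (Rep_hyp3 p) < 0"
  shows "has_mean_curvature body p (2 * s / k)"
proof (rule has_mean_curvatureI[OF p(1), of nuP "\<lambda>h. (s / k) *\<^sub>R h" "{x. aa x < bb x \<and> aa x < 0}"])
  show "(nuP has_derivative (\<lambda>h. (s / k) *\<^sub>R h)) (at (Rep_hyp3 p))"
    unfolding nuP_def[abs_def] by (auto intro!: derivative_eq_intros)
  show "open {x. aa x < bb x \<and> aa x < 0}" by (intro open_Collect_conj open_Collect_less continuous_intros)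
qed (use p in \<open>auto simp: nu_def mink_simps(6)\<close>)

text \<open>The shape operator is \<open>k / s\<close> times the identity minus a multiple of the projection onto the direction
  of the parallel circle. Parseval's identity makes the trace of the projection independent of the basis.\<close>

lemma mean_curvature_tube:
  assumes p: "p \<in> surface" "aa (Rep_hyp3 p) < bb (Rep_hyp3 p)" "0 < aa (Rep_hyp3 p)"
  shows "has_mean_curvature body p (2 * k / s - r0 / s * (1 / rad (Rep_hyp3 p)))"
proof -
  define u where "u = Rep_hyp3 p"
  have r: "0 < rad u" using rad_pos[of p] p by (simp add: u_def)
  let ?A = "\<lambda>h. (1 / s) *\<^sub>R (k *\<^sub>R h - (r0 / rad u * mink h (e\<phi> u)) *\<^sub>R e\<phi> u)"
  have R: "rad u * rad u = cx u * cx u + cy u * cy u" using rad_square[of u] by (simp add: power2_eq_square)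
  have "mink (e\<phi> u) (e\<phi> u) = (cx u * cx u + cy u * cy u) / (rad u * rad u)"
    by (simp add: e\<phi>_def mink_coord add_divide_distrib)
  then have e: "mink (e\<phi> u) (e\<phi> u) = 1" using r by (simp add: R[symmetric])
  have e': "mink (e\<phi> u) u = 0" "mink (e\<phi> u) (nuT u) = 0"
    by (simp_all add: e\<phi>_def mink_coord nuT_def edge_point_def algebra_simps)
  show ?thesis
  proof (rule has_mean_curvatureI[OF p(1), of nuT ?A "{x. aa x < bb x \<and> 0 < aa x}"])
    show "(nuT has_derivative ?A) (at (Rep_hyp3 p))"
      unfolding nuT_def[abs_def] u_def[symmetric] by (auto intro!: derivative_eq_intros has_derivative_edge_point r)
    show "open {x. aa x < bb x \<and> 0 < aa x}" by (intro open_Collect_conj open_Collect_less continuous_intros)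
    fix e1 e2
    assume o: "mink e1 e1 = 1" "mink e2 e2 = 1" "mink e1 e2 = 0" "mink e1 (Rep_hyp3 p) = 0" "mink e2 (Rep_hyp3 p) = 0"
      "mink e1 (nu (Rep_hyp3 p)) = 0" "mink e2 (nu (Rep_hyp3 p)) = 0"
    have nu: "nu u = nuT u" using p by (simp add: nu_def u_def)
    have n: "mink (nu u) (nu u) = 1" "mink (nu u) u = 0"
      using outward_nu[OF p(1)] by (simp_all add: outward_unit_normal_def u_def)
    have uu: "mink u u = - 1" by (simp add: u_def)
    have "(mink e1 (e\<phi> u))\<^sup>2 + (mink e2 (e\<phi> u))\<^sup>2 = mink (e\<phi> u) (e\<phi> u)"
      by (rule mink_parseval[OF uu n o(1-3)]) (use o e' nu in \<open>auto simp: u_def\<close>)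
    then have P: "(mink e1 (e\<phi> u))\<^sup>2 + (mink e2 (e\<phi> u))\<^sup>2 = 1" by (simp add: e)
    have "mink (?A e1) e1 + mink (?A e2) e2 =
        (1 / s) * (2 * k - r0 / rad u * ((mink e1 (e\<phi> u))\<^sup>2 + (mink e2 (e\<phi> u))\<^sup>2))"
      using o by (simp add: mink_simps(2-7) mink_simps(1)[of "e\<phi> u"] power2_eq_square algebra_simps)
    then show "2 * k / s - r0 / s * (1 / rad (Rep_hyp3 p)) = mink (?A e1) e1 + mink (?A e2) e2"
      unfolding P by (simp add: u_def field_simps)
  qed (use p in \<open>auto simp: nu_def\<close>)
qed

end

section \<open>Surfaces of revolution\<close>

context rotation_coordinates begin

lemma restrict_interval: "a \<le> c \<Longrightarrow> d \<le> b \<Longrightarrow> rotation_coordinates X G \<rho> v c d"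
  using law v G G_eq_0 \<rho> by unfold_locales auto

lemma periodic: "X (u, \<phi> + 2 * pi) = X (u, \<phi>)"
proof -
  have "cosh (dist (X (u, \<phi> + 2 * pi)) (X (u, \<phi>))) = 1"
    using law[of "(u, \<phi> + 2 * pi)" "(u, \<phi>)"] by (simp add: G(4))
  then have "(dist (X (u, \<phi> + 2 * pi)) (X (u, \<phi>)))\<^sup>2 \<le> 0"
    using half_square_le_cosh[of "dist (X (u, \<phi> + 2 * pi)) (X (u, \<phi>))"] by simp
  then show ?thesis by simp
qed

lemma null_line:
  assumes L: "L \<in> null_sets lborel" "L \<subseteq> strip \<phi>" "L \<in> sets borel"
  shows "X ` L \<in> null_sets area_measure"
  using area_null[of L \<phi>] L by (simp add: null_sets_def)

text \<open>By periodicity the meridian at angle 0 is also the one at angle \<open>2 \<pi>\<close>, which is interior to a shifted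
  strip.\<close>

lemma null_meridian: "X ` ({a<..<b} \<times> {0}) \<in> null_sets area_measure"
proof -
  let ?L = "{a<..<b} \<times> {2 * pi}"
  have "?L \<in> null_sets lborel"
  proof -
    have "emeasure (lborel \<Otimes>\<^sub>M lborel) ({a<..<b} \<times> {2 * pi}) = 0"
      by (subst lborel.emeasure_pair_measure_Times) auto
    then show ?thesis unfolding lborel_prod null_sets_def
      by (auto intro!: borel_closed simp flip: borel_prod)
  qed
  moreover have "?L \<subseteq> strip pi" by (auto simp: strip_def)
  moreover have "?L \<in> sets borel" by (auto simp flip: borel_prod)
  ultimately have "X ` ?L \<in> null_sets area_measure" by (rule null_line)
  moreover have "X ` ({a<..<b} \<times> {0}) = X ` ?L"
    using periodic[of _ 0] by (force simp: image_iff)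
  ultimately show ?thesis by simp
qed

lemma null_circle:
  assumes c: "a < c" "c < b"
  shows "X ` ({c} \<times> {0<..<2 * pi}) \<in> null_sets area_measure"
proof (rule null_line)
  have "emeasure (lborel \<Otimes>\<^sub>M lborel) ({c} \<times> {0<..<2 * pi}) = 0"
    by (subst lborel.emeasure_pair_measure_Times) auto
  then show "{c} \<times> {0<..<2 * pi} \<in> null_sets lborel" unfolding lborel_prod null_sets_def
    by (auto simp flip: borel_prod)
  show "{c} \<times> {0<..<2 * pi} \<subseteq> strip 0" using c by (auto simp: strip_def)
  show "{c} \<times> {0<..<2 * pi} \<in> sets borel" by (auto simp flip: borel_prod)
qed

end

lemma null_singleton: "{x} \<in> null_sets area_measure"
  using emeasure_area_measure[of "{x}"] by (simp add: null_sets_def)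

definition revolve :: "(real \<Rightarrow> real) \<Rightarrow> (real \<Rightarrow> real) \<Rightarrow> (real \<Rightarrow> real) \<Rightarrow> real \<times> real \<Rightarrow> hyp3" where
  "revolve \<rho> z t x = Abs_hyp3 (mvec (\<rho> (fst x) * cos (snd x)) (\<rho> (fst x) * sin (snd x)) (z (fst x)) (t (fst x)))"

text \<open>The law of \<open>rotation_coordinates\<close> reduces to an identity between two points of the profile curve in
  the half-plane of angle 0.\<close>

locale profile =
  fixes \<rho> z t G :: "real \<Rightarrow> real" and v a b :: real
  assumes prof: "\<And>u u'. t u * t u' - z u * z u' - \<rho> u * \<rho> u' = 1 + v\<^sup>2 * G (u - u')"
    and t_pos: "\<And>u. 0 < t u" and v: "0 < v"
    and G: "continuous_on UNIV G" "((\<lambda>x. G x / x\<^sup>2) \<longlongrightarrow> 1 / 2) (at 0)" "\<And>x. 0 \<le> G x" "G 0 = 0"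
    and G_eq_0: "\<And>x. G x = 0 \<Longrightarrow> \<bar>x\<bar> < b - a \<Longrightarrow> x = 0"
    and \<rho>: "continuous_on UNIV \<rho>" "\<And>u. a < u \<Longrightarrow> u < b \<Longrightarrow> 0 < \<rho> u"
begin

lemma Rep_revolve: "Rep_hyp3 (revolve \<rho> z t x) = mvec (\<rho> (fst x) * cos (snd x)) (\<rho> (fst x) * sin (snd x)) (z (fst x)) (t (fst x))"
  unfolding revolve_def
proof (rule Rep_Abs_hyp3)
  have "(t (fst x))\<^sup>2 - (z (fst x))\<^sup>2 - (\<rho> (fst x))\<^sup>2 = 1"
    using prof[of "fst x" "fst x"] G(4) by (simp add: power2_eq_square)
  moreover have "(\<rho> (fst x) * cos (snd x))\<^sup>2 + (\<rho> (fst x) * sin (snd x))\<^sup>2 = (\<rho> (fst x))\<^sup>2 * ((cos (snd x))\<^sup>2 + (sin (snd x))\<^sup>2)"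
    by (simp add: power_mult_distrib algebra_simps del: sin_cos_squared_add2)
  ultimately show "mink (mvec (\<rho> (fst x) * cos (snd x)) (\<rho> (fst x) * sin (snd x)) (z (fst x)) (t (fst x)))
     (mvec (\<rho> (fst x) * cos (snd x)) (\<rho> (fst x) * sin (snd x)) (z (fst x)) (t (fst x))) = - 1"
    by (simp add: mink_coord power2_eq_square)
qed (simp add: t_pos)

sublocale rotation_coordinates "revolve \<rho> z t" G \<rho> v a b
proof
  fix x y
  have "cosh (dist (revolve \<rho> z t x) (revolve \<rho> z t y)) =
      (t (fst x) * t (fst y) - z (fst x) * z (fst y) - \<rho> (fst x) * \<rho> (fst y)) + \<rho> (fst x) * \<rho> (fst y) * (1 - cos (snd x - snd y))"
    by (simp add: cosh_dist_hyp3 Rep_revolve mink_coord cos_diff algebra_simps)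
  then show "cosh (dist (revolve \<rho> z t x) (revolve \<rho> z t y)) =
      1 + v\<^sup>2 * G (fst x - fst y) + \<rho> (fst x) * \<rho> (fst y) * (1 - cos (snd x - snd y))"
    by (simp add: prof)
qed (use v G G_eq_0 \<rho> in auto)

lemma rad_revolve: "rad (Rep_hyp3 (revolve \<rho> z t x)) = \<bar>\<rho> (fst x)\<bar>"
proof -
  have "(rad (Rep_hyp3 (revolve \<rho> z t x)))\<^sup>2 = (\<rho> (fst x))\<^sup>2 * ((cos (snd x))\<^sup>2 + (sin (snd x))\<^sup>2)"
    unfolding rad_square by (simp add: Rep_revolve power_mult_distrib algebra_simps del: sin_cos_squared_add2)
  then have "(rad (Rep_hyp3 (revolve \<rho> z t x)))\<^sup>2 = \<bar>\<rho> (fst x)\<bar>\<^sup>2" by simp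
  then show ?thesis by (rule power2_eq_imp_eq) auto
qed

lemma revolve_eqI:
  assumes "rad (Rep_hyp3 p) = \<rho> u" "cz (Rep_hyp3 p) = z u" "ct (Rep_hyp3 p) = t u"
  obtains \<phi> where "0 \<le> \<phi>" "\<phi> < 2 * pi" "p = revolve \<rho> z t (u, \<phi>)"
proof -
  let ?w = "Rep_hyp3 p"
  obtain \<phi> where \<phi>: "0 \<le> \<phi>" "\<phi> < 2 * pi" "cx ?w = \<rho> u * cos \<phi>" "cy ?w = \<rho> u * sin \<phi>"
  proof (cases "rad ?w = 0")
    case True
    then have "cx ?w = 0" "cy ?w = 0" using rad_square[of ?w] by (auto simp: sum_power2_eq_zero_iff)
    then show ?thesis using that[of 0] True assms(1) by simp
  next
    case False
    have "(cx ?w / rad ?w)\<^sup>2 + (cy ?w / rad ?w)\<^sup>2 = (rad ?w)\<^sup>2 / (rad ?w)\<^sup>2"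
      unfolding power_divide add_divide_distrib[symmetric] rad_square[symmetric] ..
    then have "(cx ?w / rad ?w)\<^sup>2 + (cy ?w / rad ?w)\<^sup>2 = 1" using False by simp
    then obtain \<phi> where "0 \<le> \<phi>" "\<phi> < 2 * pi" "cx ?w / rad ?w = cos \<phi>" "cy ?w / rad ?w = sin \<phi>"
      using sincos_total_2pi by metis
    then show ?thesis using that[of \<phi>] False assms(1) by (simp add: field_simps)
  qed
  have "Rep_hyp3 p = Rep_hyp3 (revolve \<rho> z t (u, \<phi>))"
    by (rule mspace_eqI) (simp_all add: Rep_revolve \<phi> assms)
  then have "p = revolve \<rho> z t (u, \<phi>)" by (simp add: Rep_hyp3_inject)
  then show ?thesis using that \<phi> by blast
qed

end

section \<open>Area and total mean curvature of the body\<close>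

lemma cos_eq_1_imp_0: "1 - cos x = 0 \<Longrightarrow> \<bar>x\<bar> < 2 * pi \<Longrightarrow> x = 0" for x :: real
proof -
  assume "1 - cos x = 0" and x: "\<bar>x\<bar> < 2 * pi"
  then have "cos x = 1" by simp
  then obtain n :: int where n: "x = of_int n * 2 * pi" using cos_one_2pi_int by blast
  then have "\<bar>of_int n :: real\<bar> < 1" using x by (simp add: abs_mult)
  then have "n = 0" by linarith
  then show "x = 0" using n by simp
qed

context cap_body begin

lemma S1_less_C1: "S1 < C1" by (rule power2_less_imp_less) (auto simp: C12)
lemma h1_less_h2: "h1 < h2" by (rule power2_less_imp_less) (auto simp: h22)
lemma r0_less_c0: "r0 < c0" by (rule power2_less_imp_less) (auto simp: c02)
lemma s_less_k: "s < k" by (rule power2_less_imp_less) (auto simp: k2)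

text \<open>The sphere is parametrised by the angle at the centre from the downward axis, the tube by the angle at
  the edge, the equidistant surface by the distance from the axis of the foot point in the cutting
  plane.\<close>

definition "XS = revolve (\<lambda>u. S1 * sin u) (\<lambda>u. C1 * h1 - S1 * h2 * cos u) (\<lambda>u. C1 * h2 - S1 * h1 * cos u)"
definition "XT = revolve (\<lambda>u. k * r0 + s * c0 * sin u) (\<lambda>u. - s * cos u) (\<lambda>u. k * c0 + s * r0 * sin u)"
definition "XP = revolve (\<lambda>u. k * sinh u) (\<lambda>u. - s) (\<lambda>u. k * cosh u)"

text \<open>The parameters at which sphere and flat part meet the tube.\<close>

definition "psi0 = arccos (C / q)"
definition "D0 = arsinh r0"

lemma psi0: "cos psi0 = C / q" "sin psi0 = 1 / q" "0 < psi0" "psi0 < pi"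
proof -
  have "C < q" by (rule power2_less_imp_less) (auto simp: q2)
  then have b: "0 < C / q" "C / q < 1" by auto
  show c: "cos psi0 = C / q" unfolding psi0_def by (rule cos_arccos) (use b in linarith)+
  show p: "0 < psi0" "psi0 < pi" unfolding psi0_def using arccos_lt_bounded[of "C / q"] b by linarith+
  have "(sin psi0)\<^sup>2 = 1 - (C / q)\<^sup>2" using sin_cos_squared_add[of psi0] c by simp
  also have "\<dots> = (q\<^sup>2 - C\<^sup>2) / q\<^sup>2" by (simp add: power_divide diff_divide_distrib)
  also have "q\<^sup>2 - C\<^sup>2 = 1" using q2 by simp
  also have "1 / q\<^sup>2 = (1 / q)\<^sup>2" by (simp add: power_divide)
  finally show "sin psi0 = 1 / q" using sin_gt_zero[OF p] by (simp add: power2_eq_iff_nonneg)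
qed

lemma D0: "sinh D0 = r0" "cosh D0 = c0" "0 < D0"
proof -
  show s: "sinh D0 = r0" by (simp add: D0_def)
  have "(cosh D0)\<^sup>2 = c0\<^sup>2" by (simp add: cosh_square_eq s c02)
  then show "cosh D0 = c0" by (simp add: power2_eq_iff_nonneg)
  show "0 < D0" using s by (metis par_pos(1) sinh_real_pos_iff)
qed

interpretation S: profile "\<lambda>u. S1 * sin u" "\<lambda>u. C1 * h1 - S1 * h2 * cos u" "\<lambda>u. C1 * h2 - S1 * h1 * cos u"
  "\<lambda>x. 1 - cos x" S1 0 pi
proof
  fix u w :: real
  have "(C1 * h2 - S1 * h1 * cos u) * (C1 * h2 - S1 * h1 * cos w) - (C1 * h1 - S1 * h2 * cos u) * (C1 * h1 - S1 * h2 * cos w)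
      = (C1\<^sup>2 - S1\<^sup>2 * (cos u * cos w)) * (h2\<^sup>2 - h1\<^sup>2)" by (simp add: power2_eq_square algebra_simps)
  also have "\<dots> = 1 + S1\<^sup>2 - S1\<^sup>2 * (cos u * cos w)" by (simp add: h22 C12)
  finally show "(C1 * h2 - S1 * h1 * cos u) * (C1 * h2 - S1 * h1 * cos w) - (C1 * h1 - S1 * h2 * cos u) * (C1 * h1 - S1 * h2 * cos w)
      - S1 * sin u * (S1 * sin w) = 1 + S1\<^sup>2 * (1 - cos (u - w))"
    by (simp add: cos_diff power2_eq_square algebra_simps)
  have "S1 * h1 * cos u \<le> S1 * h1 * 1" by (intro mult_left_mono) auto
  also have "\<dots> < C1 * h2" using S1_less_C1 h1_less_h2 by (simp add: mult_strict_mono)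
  finally show "0 < C1 * h2 - S1 * h1 * cos u" by simp
  show "((\<lambda>x. (1 - cos x) / x\<^sup>2) \<longlongrightarrow> 1 / 2) (at (0::real))" by (rule cos_half_square_limit)
  show "0 < S1 * sin u" if "0 < u" "u < pi" using sin_gt_zero[OF that] by simp
  show "u = 0" if "1 - cos u = 0" "\<bar>u\<bar> < pi - 0"
    by (rule cos_eq_1_imp_0) (use that pi_gt_zero in linarith)+
qed (auto intro!: continuous_intros)

interpretation T: profile "\<lambda>u. k * r0 + s * c0 * sin u" "\<lambda>u. - s * cos u" "\<lambda>u. k * c0 + s * r0 * sin u"
  "\<lambda>x. 1 - cos x" s 0 "pi / 4"
proof
  fix u w :: real
  have "(k * c0 + s * r0 * sin u) * (k * c0 + s * r0 * sin w) - (k * r0 + s * c0 * sin u) * (k * r0 + s * c0 * sin w)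
     = (k\<^sup>2 - s\<^sup>2 * (sin u * sin w)) * (c0\<^sup>2 - r0\<^sup>2)" by (simp add: power2_eq_square algebra_simps)
  also have "\<dots> = 1 + s\<^sup>2 - s\<^sup>2 * (sin u * sin w)" by (simp add: c02 k2)
  finally show "(k * c0 + s * r0 * sin u) * (k * c0 + s * r0 * sin w) - - s * cos u * (- s * cos w)
      - (k * r0 + s * c0 * sin u) * (k * r0 + s * c0 * sin w) = 1 + s\<^sup>2 * (1 - cos (u - w))"
    by (simp add: cos_diff power2_eq_square algebra_simps)
  have "s * r0 * (- sin u) \<le> s * r0 * 1" by (intro mult_left_mono) (auto intro: minus_le_iff[THEN iffD1])
  also have "\<dots> < k * c0" using s_less_k r0_less_c0 by (simp add: mult_strict_mono)
  finally show "0 < k * c0 + s * r0 * sin u" by simp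
  show "((\<lambda>x. (1 - cos x) / x\<^sup>2) \<longlongrightarrow> 1 / 2) (at (0::real))" by (rule cos_half_square_limit)
  show "0 < k * r0 + s * c0 * sin u" if "0 < u" "u < pi / 4"
    using sin_gt_zero[of u] that pi_gt_zero by (intro add_pos_pos) auto
  show "u = 0" if "1 - cos u = 0" "\<bar>u\<bar> < pi / 4 - 0"
    by (rule cos_eq_1_imp_0) (use that pi_gt_zero in linarith)+
qed (auto intro!: continuous_intros)

text \<open>The interval is longer than the flat part, so that the seam lies in its interior and is seen to be
  a null set.\<close>

interpretation P: profile "\<lambda>u. k * sinh u" "\<lambda>u. - s" "\<lambda>u. k * cosh u" "\<lambda>x. cosh x - 1" k 0 "D0 + 1"
proof
  fix u w :: real
  have "k * cosh u * (k * cosh w) - - s * - s - k * sinh u * (k * sinh w) =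
      k\<^sup>2 * (cosh u * cosh w - sinh u * sinh w) - s\<^sup>2" by (simp add: power2_eq_square algebra_simps)
  also have "\<dots> = 1 + k\<^sup>2 * (cosh (u - w) - 1)" using k2 by (simp add: cosh_diff algebra_simps)
  finally show "k * cosh u * (k * cosh w) - - s * - s - k * sinh u * (k * sinh w) = 1 + k\<^sup>2 * (cosh (u - w) - 1)" .
  show "((\<lambda>x. (cosh x - 1) / x\<^sup>2) \<longlongrightarrow> 1 / 2) (at (0::real))" by (rule cosh_half_square_limit)
  show "u = 0" if "cosh u - 1 = 0"
    using half_square_le_cosh[of u] that by simp
qed (auto intro!: continuous_intros simp: cosh_real_ge_1 cosh_real_pos)

lemma XS_point:
  assumes "0 \<le> u" "u \<le> pi"
  shows "tau (Rep_hyp3 (XS (u, \<phi>))) = C1"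
    "aa (Rep_hyp3 (XS (u, \<phi>))) - bb (Rep_hyp3 (XS (u, \<phi>))) = sqrt 2 * S1 * sin (u - psi0)"
proof -
  let ?w = "Rep_hyp3 (XS (u, \<phi>))"
  have w: "rad ?w = S1 * sin u" "cz ?w = C1 * h1 - S1 * h2 * cos u" "ct ?w = C1 * h2 - S1 * h1 * cos u"
    using S.rad_revolve[of "(u, \<phi>)"] sin_ge_zero[of u] assms by (simp_all add: XS_def S.Rep_revolve)
  have "tau ?w = C1 * (h2\<^sup>2 - h1\<^sup>2)" by (simp add: tau_def w power2_eq_square algebra_simps)
  then show "tau ?w = C1" by (simp add: h22)
  have h: "h2 * (1 - r0\<^sup>2) = sqrt 2 / q"
  proof -
    have "h2 * (1 - r0\<^sup>2) = (q\<^sup>2 - s0\<^sup>2) / (sqrt 2 * q)"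
      by (simp add: h2_def r0_def power2_eq_square field_simps)
    also have "q\<^sup>2 - s0\<^sup>2 = sqrt 2 * sqrt 2" using q2 C2 by simp
    also have "sqrt 2 * sqrt 2 / (sqrt 2 * q) = sqrt 2 / q" by (rule mult_divide_mult_cancel_left) simp
    finally show ?thesis .
  qed
  have "aa ?w - bb ?w = S1 * (c0 * sin u - (h2 * (1 - r0\<^sup>2)) * cos u) + C1 * (h1 - r0 * h2)"
    unfolding aa_def bb_def w by (simp add: r0h2[symmetric] power2_eq_square algebra_simps)
  also have "\<dots> = S1 * (sqrt 2 * C / q * sin u - sqrt 2 / q * cos u)" unfolding h r0h2 by (simp add: c0_def)
  also have "\<dots> = sqrt 2 * S1 * sin (u - psi0)" by (simp add: sin_diff psi0 algebra_simps)
  finally show "aa ?w - bb ?w = sqrt 2 * S1 * sin (u - psi0)" .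
qed

lemma XT_point:
  assumes "0 \<le> u" "u \<le> pi / 4"
  shows "aa (Rep_hyp3 (XT (u, \<phi>))) = s * sin u" "bb (Rep_hyp3 (XT (u, \<phi>))) = s * cos u"
    "rad (Rep_hyp3 (XT (u, \<phi>))) = k * r0 + s * c0 * sin u"
proof -
  let ?w = "Rep_hyp3 (XT (u, \<phi>))"
  have "0 \<le> sin u" using assms pi_gt_zero by (intro sin_ge_zero) auto
  then show w: "rad ?w = k * r0 + s * c0 * sin u"
    using T.rad_revolve[of "(u, \<phi>)"] by (simp add: XT_def)
  have w': "cz ?w = - s * cos u" "ct ?w = k * c0 + s * r0 * sin u" 
    using T.Rep_revolve[of "(u, \<phi>)"] by (simp_all add: XT_def)
  have "aa ?w = s * sin u * (c0\<^sup>2 - r0\<^sup>2)" unfolding aa_def w w' by (simp add: power2_eq_square algebra_simps)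
  then show "aa ?w = s * sin u" by (simp add: c02)
  show "bb ?w = s * cos u" by (simp add: bb_def w')
qed

lemma XP_point:
  assumes "0 \<le> u"
  shows "aa (Rep_hyp3 (XP (u, \<phi>))) = k * sinh (u - D0)" "bb (Rep_hyp3 (XP (u, \<phi>))) = s"
proof -
  let ?w = "Rep_hyp3 (XP (u, \<phi>))"
  have w: "rad ?w = k * sinh u" using P.rad_revolve[of "(u, \<phi>)"] assms by (simp add: XP_def)
  have w': "cz ?w = - s" "ct ?w = k * cosh u" by (simp_all add: XP_def P.Rep_revolve)
  show "aa ?w = k * sinh (u - D0)" unfolding aa_def w w' by (simp add: sinh_diff D0 algebra_simps)
  show "bb ?w = s" by (simp add: bb_def w')
qed

lemma sphere_part_param:
  assumes "sphere_part (Rep_hyp3 p)"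
  obtains u \<phi> where "psi0 \<le> u" "u \<le> pi" "0 \<le> \<phi>" "\<phi> < 2 * pi" "p = XS (u, \<phi>)"
proof -
  let ?w = "Rep_hyp3 p"
  have w: "tau ?w = C1" "bb ?w \<le> aa ?w" using assms by (auto simp: sphere_part_def)
  define ze where "ze = ct ?w * h1 - cz ?w * h2"
  have "h2 * tau ?w - h1 * ze = ct ?w * (h2\<^sup>2 - h1\<^sup>2)" "h1 * tau ?w - h2 * ze = cz ?w * (h2\<^sup>2 - h1\<^sup>2)"
    by (simp_all add: tau_def ze_def power2_eq_square algebra_simps)
  then have c: "ct ?w = C1 * h2 - h1 * ze" "cz ?w = C1 * h1 - h2 * ze" using w by (simp_all add: h22 mult.commute)
  have "(ct ?w)\<^sup>2 - (cz ?w)\<^sup>2 = (C1\<^sup>2 - ze\<^sup>2) * (h2\<^sup>2 - h1\<^sup>2)" unfolding c by (simp add: power2_eq_square algebra_simps)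
  then have rz: "(rad ?w)\<^sup>2 + ze\<^sup>2 = S1\<^sup>2" using Rep_hyp3_rad[of p] by (simp add: h22 C12)
  then have "(ze / S1)\<^sup>2 + (rad ?w / S1)\<^sup>2 = S1\<^sup>2 / S1\<^sup>2"
    by (simp add: power_divide add_divide_distrib[symmetric] add.commute)
  then have "(ze / S1)\<^sup>2 + (rad ?w / S1)\<^sup>2 = 1" by simp
  then obtain u where u: "0 \<le> u" "u \<le> pi" "ze / S1 = cos u" "rad ?w / S1 = sin u"
    using sincos_total_pi[of "rad ?w / S1" "ze / S1"] by auto
  then have u': "ze = S1 * cos u" "rad ?w = S1 * sin u" by (simp_all add: field_simps)
  obtain \<phi> where \<phi>: "0 \<le> \<phi>" "\<phi> < 2 * pi" "p = XS (u, \<phi>)"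
    unfolding XS_def by (rule S.revolve_eqI[of p u]) (use c u' in \<open>auto simp: mult_ac\<close>)
  have "psi0 \<le> u"
  proof (rule ccontr)
    assume "\<not> psi0 \<le> u"
    then have "0 < sin (psi0 - u)" using u psi0 by (intro sin_gt_zero) auto
    moreover have "sin (u - psi0) = - sin (psi0 - u)" using sin_minus[of "psi0 - u"] by simp
    ultimately have "sin (u - psi0) < 0" by simp
    then have "sqrt 2 * S1 * sin (u - psi0) < 0" by (simp add: mult_pos_neg)
    then show False using XS_point(2)[OF u(1,2), of \<phi>] w \<phi>(3) by simp
  qed
  then show ?thesis using that u \<phi> by blast
qed

lemma tube_part_param:
  assumes "tube_part (Rep_hyp3 p)"
  obtains u \<phi> where "0 < u" "u < pi / 4" "0 \<le> \<phi>" "\<phi> < 2 * pi" "p = XT (u, \<phi>)"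
proof -
  let ?w = "Rep_hyp3 p"
  have w: "0 < aa ?w" "aa ?w < bb ?w" "(aa ?w)\<^sup>2 + (bb ?w)\<^sup>2 = s\<^sup>2" using assms by (auto simp: tube_part_def)
  have E: "ee ?w = k" by (rule tube_facts(1)[OF assms])
  obtain u where u: "0 < u" "u < pi / 4" "aa ?w = s * sin u" "bb ?w = s * cos u"
    using polar_angle_first_octant[OF w(1,2)] unfolding w(3) by auto
  have cz: "cz ?w = - s * cos u" using u(4) by (simp add: bb_def)
  obtain \<phi> where "0 \<le> \<phi>" "\<phi> < 2 * pi" "p = XT (u, \<phi>)"
    unfolding XT_def by (rule T.revolve_eqI[of p u]) (use rad_eq[of ?w] ct_eq[of ?w] u E cz in \<open>auto simp: mult_ac\<close>)
  then show ?thesis using that u by blast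
qed

lemma flat_part_param:
  assumes "flat_part (Rep_hyp3 p)"
  obtains u \<phi> where "0 \<le> u" "u \<le> D0" "0 \<le> \<phi>" "\<phi> < 2 * pi" "p = XP (u, \<phi>)"
proof -
  let ?w = "Rep_hyp3 p"
  have w: "aa ?w \<le> 0" "bb ?w = s" using assms by (auto simp: flat_part_def)
  define u where "u = arsinh (rad ?w / k)"
  have su: "k * sinh u = rad ?w" by (simp add: u_def)
  have "k * 0 \<le> k * sinh u" using su by simp
  then have u0: "0 \<le> u" unfolding mult_le_cancel_left_pos[OF pos(5)] by simp
  have "(k * cosh u)\<^sup>2 = k\<^sup>2 + (k * sinh u)\<^sup>2" by (simp add: power_mult_distrib cosh_square_eq algebra_simps)
  also have "\<dots> = (ct ?w)\<^sup>2"
  proof -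
    have "(cz ?w)\<^sup>2 = s\<^sup>2" using w(2) by (simp add: bb_def flip: power2_minus[of "cz ?w"])
    then show ?thesis unfolding su k2 using Rep_hyp3_rad[of p] by linarith
  qed
  finally have cu: "k * cosh u = ct ?w" using Rep_hyp3_ct_pos[of p] by (simp add: power2_eq_iff_nonneg less_imp_le)
  have cz: "cz ?w = - s" using w by (simp add: bb_def)
  obtain \<phi> where \<phi>: "0 \<le> \<phi>" "\<phi> < 2 * pi" "p = XP (u, \<phi>)"
    unfolding XP_def by (rule P.revolve_eqI[of p u]) (use su cu cz in auto)
  have "k * sinh (u - D0) \<le> k * 0" using XP_point(1)[OF u0, of \<phi>] w \<phi> by simp
  then have "u \<le> D0" unfolding mult_le_cancel_left_pos[OF pos(5)] by simp
  then show ?thesis using that u0 \<phi> by blast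
qed

definition "BS = XS ` ({psi0<..<pi} \<times> {0<..<2 * pi})"
definition "BT = XT ` ({0<..<pi/4} \<times> {0<..<2 * pi})"
definition "BP = XP ` ({0<..<D0} \<times> {0<..<2 * pi})"

lemma BS_part: "p \<in> BS \<Longrightarrow> sphere_part (Rep_hyp3 p) \<and> bb (Rep_hyp3 p) < aa (Rep_hyp3 p)"
proof -
  assume "p \<in> BS"
  then obtain u \<phi> where u: "psi0 < u" "u < pi" "p = XS (u, \<phi>)" by (auto simp: BS_def)
  have u': "0 \<le> u" "u \<le> pi" using u psi0 by auto
  have "0 < sin (u - psi0)" using u psi0 by (intro sin_gt_zero) auto
  then have "0 < aa (Rep_hyp3 p) - bb (Rep_hyp3 p)" using XS_point(2)[OF u', of \<phi>] u(3) by simp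
  moreover have "tau (Rep_hyp3 p) = C1" using XS_point(1)[OF u', of \<phi>] u(3) by simp
  ultimately show ?thesis by (simp add: sphere_part_def)
qed

lemma BT_part: "p \<in> BT \<Longrightarrow> tube_part (Rep_hyp3 p)"
proof -
  assume "p \<in> BT"
  then obtain u \<phi> where u: "0 < u" "u < pi / 4" "p = XT (u, \<phi>)" by (auto simp: BT_def)
  note X = XT_point[of u \<phi>]
  have "sin u < sin (pi / 4)" using u pi_gt_zero by (intro sin_monotone_2pi) auto
  also have "sin (pi / 4) = cos (pi / 4)" by (simp add: sin_45 cos_45)
  also have "\<dots> < cos u" using u pi_gt_zero by (intro cos_monotone_0_pi) auto
  finally have "sin u < cos u" .
  moreover have "0 < sin u" using u pi_gt_zero by (intro sin_gt_zero) auto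
  moreover have "(s * sin u)\<^sup>2 + (s * cos u)\<^sup>2 = s\<^sup>2 * ((sin u)\<^sup>2 + (cos u)\<^sup>2)" by algebra
  ultimately show ?thesis using X u by (simp add: tube_part_def)
qed

lemma BP_part: "p \<in> BP \<Longrightarrow> flat_part (Rep_hyp3 p) \<and> aa (Rep_hyp3 p) < 0"
proof -
  assume "p \<in> BP"
  then obtain u \<phi> where u: "0 < u" "u < D0" "p = XP (u, \<phi>)" by (auto simp: BP_def)
  then have "k * sinh (u - D0) < 0" by (simp add: mult_pos_neg)
  moreover have "k * sinh (u - D0) < s" using calculation pos(4) by linarith
  ultimately show ?thesis using XP_point[of u \<phi>] u by (simp add: flat_part_def)
qed

lemma S_sub: "rotation_coordinates XS (\<lambda>x. 1 - cos x) (\<lambda>u. S1 * sin u) S1 psi0 pi"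
  unfolding XS_def using psi0 by (intro S.restrict_interval) auto

lemma T_coord: "rotation_coordinates XT (\<lambda>x. 1 - cos x) (\<lambda>u. k * r0 + s * c0 * sin u) s 0 (pi / 4)"
  unfolding XT_def by (rule T.rotation_coordinates_axioms)

lemma P_sub: "rotation_coordinates XP (\<lambda>x. cosh x - 1) (\<lambda>u. k * sinh u) k 0 D0"
  unfolding XP_def by (intro P.restrict_interval) auto

lemma pieces_borel: "BS \<in> sets borel" "BT \<in> sets borel" "BP \<in> sets borel"
proof -
  interpret S': rotation_coordinates XS "\<lambda>x. 1 - cos x" "\<lambda>u. S1 * sin u" S1 psi0 pi by (rule S_sub)
  interpret T': rotation_coordinates XT "\<lambda>x. 1 - cos x" "\<lambda>u. k * r0 + s * c0 * sin u" s 0 "pi / 4" by (rule T_coord)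
  interpret P': rotation_coordinates XP "\<lambda>x. cosh x - 1" "\<lambda>u. k * sinh u" k 0 D0 by (rule P_sub)
  show "BS \<in> sets borel" using S'.emeasure_image(1)[OF S'.strip_borel order_refl, of 0] by (simp add: BS_def S'.strip_def)
  show "BT \<in> sets borel" using T'.emeasure_image(1)[OF T'.strip_borel order_refl, of 0] by (simp add: BT_def T'.strip_def)
  show "BP \<in> sets borel" using P'.emeasure_image(1)[OF P'.strip_borel order_refl, of 0] by (simp add: BP_def P'.strip_def)
qed

definition "areaS = 2 * pi * S1\<^sup>2 * (1 + C / q)"
definition "areaT = 2 * pi * s * (k * r0 * (pi / 4) + s * c0 * (1 - sqrt 2 / 2))"
definition "areaP = 2 * pi * k\<^sup>2 * (c0 - 1)"

lemma area_BS: "emeasure area_measure BS = ennreal areaS"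
proof -
  interpret S': rotation_coordinates XS "\<lambda>x. 1 - cos x" "\<lambda>u. S1 * sin u" S1 psi0 pi by (rule S_sub)
  have "emeasure area_measure (XS ` S'.strip 0) = ennreal (2 * pi * S1 * (- S1 * cos pi - - S1 * cos psi0))"
    using psi0 by (intro S'.area_strip) (auto intro!: derivative_eq_intros)
  then show ?thesis by (simp add: BS_def S'.strip_def psi0 areaS_def power2_eq_square algebra_simps)
qed

lemma area_BT: "emeasure area_measure BT = ennreal areaT"
proof -
  interpret T': rotation_coordinates XT "\<lambda>x. 1 - cos x" "\<lambda>u. k * r0 + s * c0 * sin u" s 0 "pi / 4" by (rule T_coord)
  have "emeasure area_measure (XT ` T'.strip 0) =
     ennreal (2 * pi * s * ((k * r0 * (pi / 4) - s * c0 * cos (pi / 4)) - (k * r0 * 0 - s * c0 * cos 0)))"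
    by (intro T'.area_strip) (auto intro!: derivative_eq_intros)
  then show ?thesis by (simp add: BT_def T'.strip_def areaT_def cos_45 algebra_simps)
qed

lemma area_BP: "emeasure area_measure BP = ennreal areaP"
proof -
  interpret P': rotation_coordinates XP "\<lambda>x. cosh x - 1" "\<lambda>u. k * sinh u" k 0 D0 by (rule P_sub)
  have "emeasure area_measure (XP ` P'.strip 0) = ennreal (2 * pi * k * (k * cosh D0 - k * cosh 0))"
    using D0 by (intro P'.area_strip) (auto intro!: derivative_eq_intros)
  then show ?thesis by (simp add: BP_def P'.strip_def D0 areaP_def power2_eq_square algebra_simps)
qed

lemma areas_nonneg: "0 \<le> areaS" "0 \<le> areaT" "0 \<le> areaP"
proof -
  show "0 \<le> areaS" by (simp add: areaS_def)
  have "sqrt 2 \<le> sqrt (2\<^sup>2)" by (rule real_sqrt_le_mono) simp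
  then have "sqrt 2 / 2 \<le> (1::real)" by simp
  then show "0 \<le> areaT" by (simp add: areaT_def)
  have "1 \<le> c0" by (rule power2_le_imp_le) (auto simp: c02)
  then show "0 \<le> areaP" by (simp add: areaP_def)
qed

text \<open>The radius of the parallel circle cancels against the density of area.\<close>

lemma nn_integral_BT:
  "(\<integral>\<^sup>+p\<in>BT. ennreal (1 / rad (Rep_hyp3 p)) \<partial>area_measure) = ennreal (2 * pi * s * (pi / 4))"
proof -
  interpret T': rotation_coordinates XT "\<lambda>x. 1 - cos x" "\<lambda>u. k * r0 + s * c0 * sin u" s 0 "pi / 4" by (rule T_coord)
  have "continuous_on UNIV (\<lambda>p. rad (Rep_hyp3 p))" by (intro continuous_intros)
  then have m: "(\<lambda>p. rad (Rep_hyp3 p)) \<in> borel_measurable borel" by (rule borel_measurable_continuous_onI)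
  have "(\<integral>\<^sup>+p\<in>BT. ennreal (1 / rad (Rep_hyp3 p)) \<partial>area_measure) =
      (\<integral>\<^sup>+x\<in>T'.strip 0. ennreal (1 / rad (Rep_hyp3 (XT x))) * ennreal (s * (k * r0 + s * c0 * sin (fst x))) \<partial>lborel)"
    using T'.nn_integral_image[OF T'.strip_borel order_refl, of "\<lambda>p. ennreal (1 / rad (Rep_hyp3 p))" 0] m
    by (simp add: BT_def T'.strip_def)
  also have "\<dots> = (\<integral>\<^sup>+x\<in>T'.strip 0. ennreal s \<partial>lborel)"
  proof (rule nn_integral_cong)
    fix x :: "real \<times> real"
    have "ennreal (1 / rad (Rep_hyp3 (XT x))) * ennreal (s * (k * r0 + s * c0 * sin (fst x))) = ennreal s"
      if x: "x \<in> T'.strip 0"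
    proof -
      have "0 < fst x" "fst x < pi / 4" using x by (auto simp: T'.strip_def)
      then have "rad (Rep_hyp3 (XT x)) = k * r0 + s * c0 * sin (fst x)" "0 < k * r0 + s * c0 * sin (fst x)"
        using XT_point(3)[of "fst x" "snd x"] T'.\<rho>(2)[of "fst x"] by auto
      then show ?thesis by (simp add: ennreal_mult[symmetric])
    qed
    then show "ennreal (1 / rad (Rep_hyp3 (XT x))) * ennreal (s * (k * r0 + s * c0 * sin (fst x))) * indicator (T'.strip 0) x
        = ennreal s * indicator (T'.strip 0) x" by (auto simp: indicator_def)
  qed
  also have "\<dots> = ennreal (2 * pi) * (\<integral>\<^sup>+u\<in>{0<..<pi/4}. ennreal s \<partial>lborel)"
    by (rule T'.nn_integral_strip[of "\<lambda>_. ennreal s"]) simp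
  also have "(\<integral>\<^sup>+u\<in>{0<..<pi/4}. ennreal s \<partial>lborel) = ennreal s * ennreal (pi / 4)"
    by (simp add: nn_integral_cmult_indicator)
  finally show ?thesis by (simp add: ennreal_mult[symmetric] mult.assoc)
qed

text \<open>What the open pieces miss: the seams, the meridian at angle 0, and the two points on the axis.\<close>

lemma seams_null:
  obtains N where "N \<in> null_sets area_measure" "surface \<subseteq> BS \<union> BT \<union> BP \<union> N"
proof -
  define N where "N = XS ` ({0<..<pi} \<times> {0}) \<union> XS ` ({psi0} \<times> {0<..<2 * pi}) \<union> {XS (pi, 0)} \<union> XT ` ({0<..<pi/4} \<times> {0})
    \<union> XP ` ({0<..<D0+1} \<times> {0}) \<union> XP ` ({D0} \<times> {0<..<2 * pi}) \<union> {XP (0, 0)}"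
  have "N \<in> null_sets area_measure"
    unfolding N_def XS_def XT_def XP_def using psi0 D0
    by (intro null_sets.Un null_singleton S.null_meridian S.null_circle T.null_meridian P.null_meridian P.null_circle) auto
  moreover have "surface \<subseteq> BS \<union> BT \<union> BP \<union> N"
  proof
    fix p assume "p \<in> surface"
    then consider (sphere) "sphere_part (Rep_hyp3 p)" | (tube) "tube_part (Rep_hyp3 p)" | (flat) "flat_part (Rep_hyp3 p)"
      by (auto simp: surface_def)
    then show "p \<in> BS \<union> BT \<union> BP \<union> N"
    proof cases
      case sphere
      then obtain u \<phi> where u: "psi0 \<le> u" "u \<le> pi" "0 \<le> \<phi>" "\<phi> < 2 * pi" "p = XS (u, \<phi>)" by (rule sphere_part_param)
      have pole: "XS (pi, \<phi>) = XS (pi, 0)" by (simp add: XS_def revolve_def)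
      consider "u = pi" | "u < pi" "\<phi> = 0" | "u = psi0" "0 < \<phi>" | "psi0 < u" "u < pi" "0 < \<phi>" using u by linarith
      then show ?thesis using u psi0 pole by cases (auto simp: N_def BS_def)
    next
      case tube
      then obtain u \<phi> where u: "0 < u" "u < pi / 4" "0 \<le> \<phi>" "\<phi> < 2 * pi" "p = XT (u, \<phi>)" by (rule tube_part_param)
      then show ?thesis by (cases "\<phi> = 0") (auto simp: N_def BT_def)
    next
      case flat
      then obtain u \<phi> where u: "0 \<le> u" "u \<le> D0" "0 \<le> \<phi>" "\<phi> < 2 * pi" "p = XP (u, \<phi>)" by (rule flat_part_param)
      have pole: "XP (0, \<phi>) = XP (0, 0)" by (simp add: XP_def revolve_def)
      consider "u = 0" | "0 < u" "\<phi> = 0" | "u = D0" "0 < \<phi>" | "0 < u" "u < D0" "0 < \<phi>" using u by linarith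
      then show ?thesis using u D0 pole by cases (auto simp: N_def BP_def)
    qed
  qed
  ultimately show ?thesis using that by blast
qed

lemma pieces_disjoint: "BS \<inter> BT = {}" "BS \<inter> BP = {}" "BT \<inter> BP = {}"
proof -
  have "False" if "p \<in> BS" "p \<in> BT" for p using BS_part[OF that(1)] BT_part[OF that(2)] by (simp add: tube_part_def)
  then show "BS \<inter> BT = {}" by blast
  have "False" if "p \<in> BS" "p \<in> BP" for p using BS_part[OF that(1)] BP_part[OF that(2)] by (simp add: flat_part_def)
  then show "BS \<inter> BP = {}" by blast
  have "False" if "p \<in> BT" "p \<in> BP" for p using BT_part[OF that(1)] BP_part[OF that(2)] by (simp add: tube_part_def)
  then show "BT \<inter> BP = {}" by blast
qed

lemma pieces_subset: "BS \<union> BT \<union> BP \<subseteq> surface"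
  using BS_part BT_part BP_part by (auto simp: surface_def)

lemma surface_borel: "surface \<in> sets borel"
  using frontier_closed[of body] frontier_body by (metis borel_closed)

lemma area_surface: "emeasure area_measure surface = ennreal (areaS + areaT + areaP)"
proof -
  obtain N where N: "N \<in> null_sets area_measure" "surface \<subseteq> BS \<union> BT \<union> BP \<union> N" by (rule seams_null)
  have B: "BS \<union> BT \<union> BP \<in> sets area_measure" using pieces_borel by auto
  have "emeasure area_measure surface \<le> emeasure area_measure (BS \<union> BT \<union> BP \<union> N)"
    using N B by (intro emeasure_mono) (auto simp: null_sets_def)
  also have "\<dots> = emeasure area_measure (BS \<union> BT \<union> BP)"
    using emeasure_Un_null_set[OF B N(1)] .
  finally have "emeasure area_measure surface = emeasure area_measure (BS \<union> BT \<union> BP)"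
    using emeasure_mono[OF pieces_subset, of area_measure] surface_borel by (simp add: antisym)
  also have "\<dots> = emeasure area_measure (BS \<union> BT) + emeasure area_measure BP"
    using pieces_borel pieces_disjoint by (intro plus_emeasure[symmetric]) auto
  also have "emeasure area_measure (BS \<union> BT) = emeasure area_measure BS + emeasure area_measure BT"
    using pieces_borel pieces_disjoint by (intro plus_emeasure[symmetric]) auto
  finally show ?thesis using areas_nonneg by (simp add: area_BS area_BT area_BP)
qed

lemma surface_area_body: "surface_area body = ennreal (areaS + areaT + areaP)"
  using centre_in_interior by (auto simp: surface_area_def frontier_body area_surface)

definition "total_curv = 2 * C1 / S1 * areaS + (2 * k / s * areaT - r0 / s * (2 * pi * s * (pi / 4))) + 2 * s / k * areaP"

text \<open>The mean curvature is constant on sphere and flat part. On the tube only the inverse radius of the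
  parallel circle varies.\<close>

lemma mean_curvature_integral: "has_mean_curvature_integral body total_curv"
proof -
  obtain N where N: "N \<in> null_sets area_measure" "surface \<subseteq> BS \<union> BT \<union> BP \<union> N" by (rule seams_null)
  define H where "H p = (if bb (Rep_hyp3 p) < aa (Rep_hyp3 p) then 2 * C1 / S1
     else if 0 < aa (Rep_hyp3 p) then 2 * k / s - r0 / s * (1 / rad (Rep_hyp3 p)) else 2 * s / k)" for p
  have HS: "H p = 2 * C1 / S1" if "p \<in> BS" for p using BS_part[OF that] by (simp add: H_def)
  have HT: "H p = 2 * k / s - r0 / s * (1 / rad (Rep_hyp3 p))" if "p \<in> BT" for p
    using BT_part[OF that] by (simp add: H_def tube_part_def)
  have HP: "H p = 2 * s / k" if "p \<in> BP" for p using BP_part[OF that] by (simp add: H_def flat_part_def)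
  have curv: "has_mean_curvature body p (H p)" if p: "p \<in> BS \<union> BT \<union> BP" for p
  proof -
    have ps: "p \<in> surface" using p pieces_subset by blast
    consider "p \<in> BS" | "p \<in> BT" | "p \<in> BP" using p by blast
    then show ?thesis
    proof cases
      case 1 then show ?thesis using mean_curvature_sphere[OF ps] BS_part[OF 1] HS by simp
    next
      case 2 then show ?thesis using mean_curvature_tube[OF ps] BT_part[OF 2] HT by (simp add: tube_part_def)
    next
      case 3 then show ?thesis using mean_curvature_flat[OF ps] BP_part[OF 3] HP by (simp add: flat_part_def)
    qed
  qed
  have AE1: "AE p in restrict_space area_measure surface. has_mean_curvature body p (H p)"
  proof (subst AE_restrict_space_iff)
    show "surface \<inter> space area_measure \<in> sets area_measure" using surface_borel by simp
    show "AE p in area_measure. p \<in> surface \<longrightarrow> has_mean_curvature body p (H p)"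
      using N(1) by (rule AE_I') (use N(2) curv in auto)
  qed
  have const: "has_bochner_integral area_measure (\<lambda>p. indicator B p * c) (a * c)"
    if "B \<in> sets borel" "emeasure area_measure B = ennreal a" "0 \<le> a" for B :: "hyp3 set" and a c :: real
  proof (rule has_bochner_integral_mult_left)
    have "has_bochner_integral area_measure (indicator B :: hyp3 \<Rightarrow> real) (measure area_measure B)"
      by (rule has_bochner_integral_real_indicator) (use that in auto)
    then show "has_bochner_integral area_measure (indicator B) a" using that by (simp add: measure_def)
  qed
  have "has_bochner_integral area_measure (\<lambda>p. indicator BT p * (1 / rad (Rep_hyp3 p))) (2 * pi * s * (pi / 4))"
  proof (rule has_bochner_integral_nn_integral)
    have "continuous_on UNIV (\<lambda>p. rad (Rep_hyp3 p))" by (intro continuous_intros)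
    then have "(\<lambda>p. rad (Rep_hyp3 p)) \<in> borel_measurable borel" by (rule borel_measurable_continuous_onI)
    then show "(\<lambda>p. indicator BT p * (1 / rad (Rep_hyp3 p))) \<in> borel_measurable area_measure"
      using pieces_borel by (simp add: borel_measurable_divide measurable_cong_sets[OF sets_area_measure refl])
    show "(\<integral>\<^sup>+p. ennreal (indicator BT p * (1 / rad (Rep_hyp3 p))) \<partial>area_measure) = ennreal (2 * pi * s * (pi / 4))"
      unfolding nn_integral_BT[symmetric] by (intro nn_integral_cong) (auto simp: indicator_def)
  qed (auto simp: indicator_def)
  then have inv: "has_bochner_integral area_measure (\<lambda>p. r0 / s * (indicator BT p * (1 / rad (Rep_hyp3 p)))) (r0 / s * (2 * pi * s * (pi / 4)))"
    by (rule has_bochner_integral_mult_right)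
  have sum: "has_bochner_integral area_measure
      (\<lambda>p. indicator BS p * (2 * C1 / S1) + (indicator BT p * (2 * k / s) - r0 / s * (indicator BT p * (1 / rad (Rep_hyp3 p))))
        + indicator BP p * (2 * s / k)) (areaS * (2 * C1 / S1) + (areaT * (2 * k / s) - r0 / s * (2 * pi * s * (pi / 4))) + areaP * (2 * s / k))"
    by (intro has_bochner_integral_add has_bochner_integral_diff const inv pieces_borel area_BS area_BT area_BP areas_nonneg)
  have eq: "AE p in area_measure. indicator BS p * (2 * C1 / S1) + (indicator BT p * (2 * k / s) - r0 / s * (indicator BT p * (1 / rad (Rep_hyp3 p))))
        + indicator BP p * (2 * s / k) = indicator surface p *\<^sub>R H p"
  proof -
    have "indicator BS p * (2 * C1 / S1) + (indicator BT p * (2 * k / s) - r0 / s * (indicator BT p * (1 / rad (Rep_hyp3 p))))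
        + indicator BP p * (2 * s / k) = indicator surface p *\<^sub>R H p" if p: "p \<notin> N" for p
    proof -
      consider "p \<in> BS" | "p \<in> BT" | "p \<in> BP" | "p \<notin> surface" using p N(2) by blast
      then show ?thesis
      proof cases
        case 1
        then have "p \<notin> BT" "p \<notin> BP" "p \<in> surface" using pieces_disjoint pieces_subset by auto
        then show ?thesis using 1 HS by simp
      next
        case 2
        then have "p \<notin> BS" "p \<notin> BP" "p \<in> surface" using pieces_disjoint pieces_subset by auto
        then show ?thesis using 2 HT by simp
      next
        case 3
        then have "p \<notin> BT" "p \<notin> BS" "p \<in> surface" using pieces_disjoint pieces_subset by auto
        then show ?thesis using 3 HP by simp
      next
        case 4
        then have "p \<notin> BT" "p \<notin> BS" "p \<notin> BP" using pieces_subset by auto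
        then show ?thesis using 4 by simp
      qed
    qed
    then show ?thesis by (intro AE_I'[OF N(1)]) auto
  qed
  have "has_bochner_integral area_measure (\<lambda>p. indicator surface p *\<^sub>R H p) total_curv"
  proof -
    have "continuous_on UNIV (\<lambda>p. rad (Rep_hyp3 p))" by (intro continuous_intros)
    then have [measurable]: "(\<lambda>p. rad (Rep_hyp3 p)) \<in> borel_measurable borel" by (rule borel_measurable_continuous_onI)
    have "continuous_on UNIV (\<lambda>p. aa (Rep_hyp3 p))" by (intro continuous_intros)
    then have [measurable]: "(\<lambda>p. aa (Rep_hyp3 p)) \<in> borel_measurable borel" by (rule borel_measurable_continuous_onI)
    have "continuous_on UNIV (\<lambda>p. bb (Rep_hyp3 p))" by (intro continuous_intros)
    then have [measurable]: "(\<lambda>p. bb (Rep_hyp3 p)) \<in> borel_measurable borel" by (rule borel_measurable_continuous_onI)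
    have "H \<in> borel_measurable borel" unfolding H_def[abs_def] by measurable
    then have "(\<lambda>p. indicator surface p *\<^sub>R H p) \<in> borel_measurable area_measure"
      using surface_borel by (simp add: measurable_cong_sets[OF sets_area_measure refl])
    then have "has_bochner_integral area_measure (\<lambda>p. indicator surface p *\<^sub>R H p)
        (areaS * (2 * C1 / S1) + (areaT * (2 * k / s) - r0 / s * (2 * pi * s * (pi / 4))) + areaP * (2 * s / k))"
      using sum has_bochner_integral_cong_AE[OF _ _ eq] by (metis (no_types, lifting) borel_measurable_has_bochner_integral)
    then show ?thesis by (simp add: total_curv_def mult.commute)
  qed
  then have "has_bochner_integral (restrict_space area_measure surface) H total_curv"
    using surface_borel by (subst has_bochner_integral_restrict_space) auto
  with AE1 show ?thesis unfolding has_mean_curvature_integral_def frontier_body by blast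
qed

lemma total_mean_curvature: "has_total_mean_curvature body total_curv"
  using mean_curvature_integral C11_surface_surface by (simp add: has_total_mean_curvature_def frontier_body)

text \<open>Area and total mean curvature of the truncated ball, as \<open>(S + 2\<pi>) / 2\<pi>\<close> and \<open>M / 4\<pi>\<close>.\<close>

definition "A0 = s0\<^sup>2 * (1 + C / q) + c0"
definition "B0 = C * s0 * (1 + C / q) + r0 * pi / 8"

lemma edge_terms: "c0 * (1 - sqrt 2 / 2) = c0 - C / q"
  by (simp add: c0_def field_simps)

text \<open>The Steiner formula with \<open>cosh 2\<delta> = k\<^sup>2 + s\<^sup>2\<close> and \<open>sinh 2\<delta> = 2 k s\<close>.\<close>

lemma Steiner_area: "areaS + areaT + areaP + 2 * pi = 2 * pi * (A0 * (k\<^sup>2 + s\<^sup>2) + 2 * B0 * (k * s))"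
proof -
  have *: "(s0 * k + C * s)\<^sup>2 * (1 + X) + s * (2 * k * P + s * (c - X)) + k\<^sup>2 * (c - 1) + 1 =
      (s0\<^sup>2 * (1 + X) + c) * (k\<^sup>2 + s\<^sup>2) + 2 * (C * s0 * (1 + X) + P) * (k * s)" for X P c :: real
    using C2 k2 by algebra
  have "areaS + areaT + areaP + 2 * pi = 2 * pi * ((s0 * k + C * s)\<^sup>2 * (1 + C / q)
      + s * (2 * k * (r0 * pi / 8) + s * (c0 - C / q)) + k\<^sup>2 * (c0 - 1) + 1)"
    unfolding areaS_def areaT_def areaP_def S1_def edge_terms[symmetric] by (simp add: algebra_simps)
  then show ?thesis unfolding * A0_def B0_def .
qed

lemma Steiner_curvature: "total_curv = 4 * pi * (2 * A0 * (k * s) + B0 * (k\<^sup>2 + s\<^sup>2))"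
proof -
  have *: "(C * k + s0 * s) * (s0 * k + C * s) * (1 + X) + k * (2 * k * P + s * (c - X)) - P + k * s * (c - 1) =
      2 * (s0\<^sup>2 * (1 + X) + c) * (k * s) + (C * s0 * (1 + X) + P) * (k\<^sup>2 + s\<^sup>2)" for X P c :: real
    using C2 k2 by algebra
  have S: "2 * C1 / S1 * areaS = 4 * pi * (C1 * S1 * (1 + C / q))"
    by (simp add: areaS_def power2_eq_square)
  have T: "2 * k / s * areaT = 4 * pi * (k * (2 * k * (r0 * pi / 8) + s * (c0 - C / q)))"
    unfolding areaT_def edge_terms[symmetric] by (simp add: algebra_simps)
  have E: "r0 / s * (2 * pi * s * (pi / 4)) = 4 * pi * (r0 * pi / 8)" by simp
  have P: "2 * s / k * areaP = 4 * pi * (k * s * (c0 - 1))" by (simp add: areaP_def power2_eq_square)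
  have "total_curv = 4 * pi * ((C * k + s0 * s) * (s0 * k + C * s) * (1 + C / q)
      + k * (2 * k * (r0 * pi / 8) + s * (c0 - C / q)) - r0 * pi / 8 + k * s * (c0 - 1))"
    unfolding total_curv_def S T E P by (simp add: C1_def S1_def algebra_simps)
  then show ?thesis unfolding * A0_def B0_def .
qed

end

section \<open>Comparison with spheres and disks\<close>

text \<open>The Steiner formula makes \<open>M\<^sup>2 - 4 (S + 2\<pi>)\<^sup>2\<close> independent of the thickness, and the intermediate
  value theorem provides the thickness with area \<open>S\<close>.\<close>

lemma body_beats_sphere:
  fixes C S :: real
  defines "s0 \<equiv> sqrt (C\<^sup>2 - 1)" and "q \<equiv> sqrt (C\<^sup>2 + 1)"
  defines "A \<equiv> s0\<^sup>2 * (1 + C / q) + sqrt 2 * C / q" and "B \<equiv> C * s0 * (1 + C / q) + s0 / q * pi / 8"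
  assumes C: "1 < C" and AB: "B\<^sup>2 + 1 < A\<^sup>2" and S: "2 * pi * (A - 1) < S"
  shows "\<exists>\<Omega> m. convex_body \<Omega> \<and> surface_area \<Omega> = ennreal S \<and> has_total_mean_curvature \<Omega> m \<and> m < M\<^sub>1 S"
proof -
  have "1 < C\<^sup>2" using C by (simp add: one_less_power)
  then have s0: "0 < s0" "C\<^sup>2 = 1 + s0\<^sup>2" by (simp_all add: s0_def)
  have q: "0 < q" "q\<^sup>2 = 1 + C\<^sup>2" by (simp_all add: q_def add_nonneg_pos)
  have A: "0 < A" and B: "0 < B" using C s0 q by (auto simp: A_def B_def intro!: add_pos_pos mult_pos_pos add_nonneg_pos)
  define Y where "Y = (S + 2 * pi) / (2 * pi)"
  have Y: "A < Y" using S by (simp add: Y_def field_simps)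
  define f where "f x = A * cosh x + B * sinh x" for x :: real
  have "Y \<le> f (Y / B)"
  proof -
    have "Y / B \<le> sinh (Y / B)"
      using real_le_x_sinh[of "Y / B"] A B Y by (simp add: sinh_def exp_minus)
    then have "B * (Y / B) \<le> B * sinh (Y / B)" using B by (intro mult_left_mono) auto
    moreover have "0 \<le> A * cosh (Y / B)" using A by (simp add: less_imp_le)
    ultimately show ?thesis using B by (simp add: f_def)
  qed
  moreover have "f 0 \<le> Y" using Y by (simp add: f_def)
  moreover have "continuous_on {0..Y / B} f" unfolding f_def by (intro continuous_intros)
  ultimately obtain x where x: "0 \<le> x" "f x = Y" using IVT'[of f 0 Y "Y / B"] A B Y by auto
  have "x \<noteq> 0" using x Y by (auto simp: f_def)
  then have x0: "0 < x" using x by simp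
  define s k where "s = sinh (x / 2)" and "k = cosh (x / 2)"
  have sk: "0 < s" "0 < k" "k\<^sup>2 = 1 + s\<^sup>2" using x0 by (simp_all add: s_def k_def cosh_square_eq)
  interpret cap_body C s0 q s k using C s0 q sk by unfold_locales auto
  have A0: "A0 = A" and B0: "B0 = B" by (simp_all add: A0_def B0_def A_def B_def c0_def r0_def)
  have cx: "k\<^sup>2 + s\<^sup>2 = cosh x" "2 * (k * s) = sinh x"
    using cosh_double[of "x / 2"] sinh_double[of "x / 2"] by (simp_all add: s_def k_def mult_ac)
  have area: "areaS + areaT + areaP = S"
  proof -
    have "areaS + areaT + areaP + 2 * pi = 2 * pi * (A * (k\<^sup>2 + s\<^sup>2) + B * (2 * (k * s)))"
      using Steiner_area by (simp add: A0 B0 mult_ac)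
    also have "\<dots> = 2 * pi * Y" unfolding cx using x(2) by (simp add: f_def)
    finally show ?thesis by (simp add: Y_def)
  qed
  define m where "m = 4 * pi * (A * sinh x + B * cosh x)"
  have m: "total_curv = m"
    using Steiner_curvature unfolding m_def cx[symmetric] by (simp add: A0 B0 mult_ac)
  have "m\<^sup>2 = 16 * pi\<^sup>2 * (B\<^sup>2 - A\<^sup>2) + 16 * pi\<^sup>2 * (f x)\<^sup>2"
  proof -
    have "(A * sinh x + B * cosh x)\<^sup>2 = (B\<^sup>2 - A\<^sup>2) * ((cosh x)\<^sup>2 - (sinh x)\<^sup>2) + (f x)\<^sup>2"
      by (simp add: f_def power2_eq_square algebra_simps)
    then have "(A * sinh x + B * cosh x)\<^sup>2 = B\<^sup>2 - A\<^sup>2 + (f x)\<^sup>2" by (simp add: cosh_square_eq)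
    moreover have "m\<^sup>2 = 16 * pi\<^sup>2 * (A * sinh x + B * cosh x)\<^sup>2" by (simp add: m_def power_mult_distrib)
    ultimately show ?thesis by (simp add: distrib_left)
  qed
  also have "\<dots> < 16 * pi\<^sup>2 * (- 1) + 16 * pi\<^sup>2 * (f x)\<^sup>2" using AB by (intro add_strict_right_mono mult_strict_left_mono) auto
  also have "16 * pi\<^sup>2 * (f x)\<^sup>2 = 4 * (S + 2 * pi)\<^sup>2"
    unfolding x(2) Y_def by (simp add: power_divide power_mult_distrib)
  also have "16 * pi\<^sup>2 * (- 1) + 4 * (S + 2 * pi)\<^sup>2 = 16 * pi * S + 4 * S\<^sup>2"
    by (simp add: power2_eq_square algebra_simps)
  finally have "m < M\<^sub>1 S" unfolding M\<^sub>1_def by (rule real_less_rsqrt)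
  then show ?thesis
    using convex_body_body surface_area_body total_mean_curvature area m by auto
qed

text \<open>After squaring, the common factor \<open>S\<close> leaves a linear inequality.\<close>

lemma M1_le_M2:
  assumes "0 < S" "S \<le> (8 * pi ^ 3 - 64 * pi) / (16 - pi\<^sup>2)"
  shows "M\<^sub>1 S \<le> M\<^sub>2 S"
proof -
  have "pi\<^sup>2 < 4\<^sup>2" using pi_gt_zero pi_less_4 by (intro power_strict_mono) auto
  then have "S * (16 - pi\<^sup>2) \<le> 8 * pi ^ 3 - 64 * pi" using assms(2) by (simp add: field_simps)
  then have "S * (S * (16 - pi\<^sup>2)) \<le> S * (8 * pi ^ 3 - 64 * pi)" using assms(1) by (intro mult_left_mono) auto
  then have "16 * pi * S + 4 * S\<^sup>2 \<le> 2 * pi ^ 3 * S + pi\<^sup>2 / 4 * S\<^sup>2"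
    by (simp add: power2_eq_square algebra_simps)
  then show ?thesis unfolding M\<^sub>1_def M\<^sub>2_def by (rule real_sqrt_le_mono)
qed

theorem theorem1p2:
  shows "\<exists>S\<^sub>1 S\<^sub>2 :: real. 0 < S\<^sub>1 \<and> 0 < S\<^sub>2 \<and> S\<^sub>1 < S\<^sub>2 \<and>
    (\<forall>S. S\<^sub>1 < S \<and> S < S\<^sub>2 \<longrightarrow>
      (\<exists>\<Omega> m. convex_body \<Omega> \<and> surface_area \<Omega> = ennreal S \<and>
         has_total_mean_curvature \<Omega> m \<and> m < min (M\<^sub>1 S) (M\<^sub>2 S)))"
proof -
  \<comment> \<open>For \<open>C = 1.25\<close> the truncated ball does not beat the sphere, and for \<open>C = 1.28\<close> its area exceeds the
    value where the curves of sphere and disk cross.\<close>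
  define C :: real where "C = 127 / 100"
  define s0 q where "s0 = sqrt (C\<^sup>2 - 1)" and "q = sqrt (C\<^sup>2 + 1)"
  define A B where "A = s0\<^sup>2 * (1 + C / q) + sqrt 2 * C / q" and "B = C * s0 * (1 + C / q) + s0 / q * pi / 8"
  have p: "3.141 < pi" "pi < 3.142" using pi_approx by simp_all
  define i where "i = 1 / q"
  have q2: "q\<^sup>2 = 2.6129" by (simp add: q_def C_def power2_eq_square)
  have q0: "0 < q" unfolding q_def by (rule real_sqrt_gt_zero) (simp add: C_def power2_eq_square)
  have "q < 1.61647" by (rule power2_less_imp_less) (simp_all add: q2, simp add: power2_eq_square)
  moreover have "1.61642 < q" by (rule power2_less_imp_less) (use q0 in \<open>simp_all add: q2\<close>, simp add: power2_eq_square)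
  ultimately have i: "0.61863 < i" "i < 0.61866" using q0 by (simp_all add: i_def field_simps)
  define w where "w = sqrt (2::real)"
  have w: "1.4142 < w" "w < 1.41422" unfolding w_def
    by (rule real_less_rsqrt, simp add: power2_eq_square) (rule real_less_lsqrt, simp_all add: power2_eq_square)
  have s02: "s0\<^sup>2 = 0.6129" by (simp add: s0_def C_def power2_eq_square)
  have A_eq: "A = 0.6129 + i * (0.778383 + 1.27 * w)"
  proof -
    have "A = s0\<^sup>2 + i * (s0\<^sup>2 * C + C * w)"
      by (simp add: A_def i_def w_def add_divide_distrib algebra_simps)
    then show ?thesis by (simp add: s02 C_def)
  qed
  have B_eq: "B = s0 * (1.27 + i * (1.6129 + pi / 8))"
  proof -
    have "B = s0 * (C + i * (C * C + pi / 8))"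
      by (simp add: B_def i_def add_divide_distrib algebra_simps)
    then show ?thesis by (simp add: C_def)
  qed
  have A_lo: "2.2055 < A"
  proof -
    have "0.61863 * (0.778383 + 1.27 * 1.4142) < i * (0.778383 + 1.27 * w)" using i w by (intro mult_strict_mono) auto
    then show ?thesis unfolding A_eq by simp
  qed
  have A_hi: "A < 2.2057"
  proof -
    have "i * (0.778383 + 1.27 * w) < 0.61866 * (0.778383 + 1.27 * 1.41422)" using i w by (intro mult_strict_mono) auto
    then show ?thesis unfolding A_eq by simp
  qed
  have AB: "B\<^sup>2 + 1 < A\<^sup>2"
  proof -
    have "i * (1.6129 + pi / 8) < 0.61866 * (1.6129 + 3.142 / 8)" using i p by (intro mult_strict_mono) auto
    then have "1.27 + i * (1.6129 + pi / 8) < 2.51085" by simp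
    moreover have "0 < 1.27 + i * (1.6129 + pi / 8)" using i p by (intro add_pos_pos mult_pos_pos) auto
    ultimately have "(1.27 + i * (1.6129 + pi / 8))\<^sup>2 < 2.51085\<^sup>2" by (intro power_strict_mono) auto
    then have "B\<^sup>2 < 0.6129 * 2.51085\<^sup>2" unfolding B_eq power_mult_distrib s02 by simp
    also have "\<dots> + 1 < 2.2055\<^sup>2" by (simp add: power2_eq_square)
    also have "2.2055\<^sup>2 < A\<^sup>2" using A_lo by (intro power_strict_mono) auto
    finally show ?thesis by simp
  qed
  define S\<^sub>1 S\<^sub>2 where "S\<^sub>1 = 2 * pi * (A - 1)" and "S\<^sub>2 = (8 * pi ^ 3 - 64 * pi) / (16 - pi\<^sup>2)"
  have S1: "0 < S\<^sub>1" using A_lo by (simp add: S\<^sub>1_def)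
  have S12: "S\<^sub>1 < S\<^sub>2"
  proof -
    have pp: "3.141\<^sup>2 < pi\<^sup>2" "pi\<^sup>2 < 4\<^sup>2" using p by (intro power_strict_mono; simp)+
    have "(9.8658 :: real) < 3.141\<^sup>2" by (simp add: power2_eq_square)
    then have "9.8658 < pi\<^sup>2" using pp(1) by (rule less_trans)
    have "(A - 1) * (16 - pi\<^sup>2) < 1.2057 * (16 - pi\<^sup>2)" using A_hi pp by (intro mult_strict_right_mono) auto
    also have "\<dots> < 4 * pi\<^sup>2 - 32" using \<open>9.8658 < pi\<^sup>2\<close> by simp
    finally have "2 * pi * ((A - 1) * (16 - pi\<^sup>2)) < 2 * pi * (4 * pi\<^sup>2 - 32)" by (intro mult_strict_left_mono) auto
    then have "S\<^sub>1 * (16 - pi\<^sup>2) < 8 * pi ^ 3 - 64 * pi"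
      by (simp add: S\<^sub>1_def power2_eq_square power3_eq_cube algebra_simps)
    then show ?thesis using pp by (simp add: S\<^sub>2_def less_divide_eq)
  qed
  have "\<exists>\<Omega> m. convex_body \<Omega> \<and> surface_area \<Omega> = ennreal S \<and> has_total_mean_curvature \<Omega> m \<and> m < min (M\<^sub>1 S) (M\<^sub>2 S)"
    if S: "S\<^sub>1 < S" "S < S\<^sub>2" for S
  proof -
    have "M\<^sub>1 S \<le> M\<^sub>2 S" using S S1 by (intro M1_le_M2) (auto simp: S\<^sub>2_def)
    moreover have "\<exists>\<Omega> m. convex_body \<Omega> \<and> surface_area \<Omega> = ennreal S \<and> has_total_mean_curvature \<Omega> m \<and> m < M\<^sub>1 S"
      using body_beats_sphere[of C S] AB S(1) unfolding A_def B_def s0_def q_def S\<^sub>1_def by (simp add: C_def)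
    ultimately show ?thesis by (metis min_absorb1)
  qed
  then show ?thesis using S1 S12 by (intro exI[of _ S\<^sub>1] exI[of _ S\<^sub>2]) auto
qed

end
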